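(* Let $W$ be the Weyl group of an irreducible reduced crystallographic root system of rank $n$ in the Euclidean space $E_n$, let $F$ be the fundamental simplex of the affine Weyl group $W^{\rm aff}$, and for $\lambda\in P_+$ let $\phi_\lambda(x)=\sum_{\mu\in O(\lambda)}e^{2\pi \mathrm{i}\langle\mu,x\rangle}$. Let $\mathcal L^2(\overline F)$ be the Hilbert space of square-integrable complex functions on $\overline F$ with the scalar product $\langle f_1,f_2\rangle=|\overline F|^{-1}\int_{\overline F}f_1(x)\overline{f_2(x)}\,dx$. Then the orbit functions $\phi_\lambda$, $\lambda\in P_+$, form an orthogonal basis of $\mathcal L^2(\overline F)$. Consequently every $f\in\mathcal L^2(\overline F)$ has the expansion (convergent in $\mathcal L^2(\overline F)$) $$f=\sum_{\lambda\in P_+}c_\lambda\phi_\lambda,\qquad c_\lambda=|O(\lambda)|^{-1}|\overline F|^{-1}\int_{\overline F}f(x)\overline{\phi_\lambda(x)}\,dx,$$ and the Plancherel formula holds: $$\sum_{\lambda\in P_+}|O(\lambda)|\,|c_\lambda|^2=|\overline F|^{-1}\int_{\overline F}|f(x)|^2\,dx.$$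
   Context: $R$ is an irreducible reduced crystallographic root system spanning the Euclidean space $E_n$ with scalar product $\langle\cdot,\cdot\rangle$, with simple roots $\alpha_1,\dots,\alpha_n$, normalized so that long roots have squared length $2$ (all roots count as long if there is only one length). For a root $\alpha$, $\alpha^\vee=2\alpha/\langle\alpha,\alpha\rangle$ and $r_\alpha x=x-\langle x,\alpha^\vee\rangle\alpha$. $W$ is the group generated by $r_{\alpha_1},\dots,r_{\alpha_n}$. $D_+=\{x\in E_n:\langle x,\alpha_i\rangle\ge 0\ \forall i\}$; $P=\{\lambda\in E_n:\langle\lambda,\alpha_j^\vee\rangle\in\mathbb Z\ \forall j\}$ and $P_+=P\cap D_+$. $O(\lambda)=\{w\lambda:w\in W\}$ (distinct points) and $|O(\lambda)|$ is its number of elements. Let $\xi$ be the highest root. The affine Weyl group $W^{\rm aff}$ is generated by $r_{\alpha_1},\dots,r_{\alpha_n}$ and $r_0x=r_\xi x+\xi^\vee$. $F$ is the open simplex $\{y\in E_n:\langle y,\alpha_i\rangle>0\ (i=1,\dots,n),\ \langle y,\xi\rangle<1\}$, $\overline F$ its closure, $|\overline F|$ its volume, and $dx$ is Lebesgue measure. *)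

theory Defs
  imports "HOL-Analysis.Analysis" "HOL-Algebra.Bij" "HOL-Algebra.Generated_Groups"
begin

section \<open>Root systems\<close>

definition coroot :: "'a::euclidean_space \<Rightarrow> 'a" where
  "coroot a = (2 / (a \<bullet> a)) *\<^sub>R a"

definition root_reflection :: "'a::euclidean_space \<Rightarrow> 'a \<Rightarrow> 'a" where
  "root_reflection a x = x - (x \<bullet> coroot a) *\<^sub>R a"

text \<open>Reduced crystallographic root systems; the rank is \<^term>\<open>DIM('a::euclidean_space)\<close>.\<close>

definition root_system :: "'a::euclidean_space set \<Rightarrow> bool" where
  "root_system R \<longleftrightarrow>
     finite R \<and> 0 \<notin> R \<and> span R = UNIV \<and>
     (\<forall>a\<in>R. root_reflection a ` R \<subseteq> R) \<and>
     (\<forall>a\<in>R. \<forall>b\<in>R. b \<bullet> coroot a \<in> \<int>) \<and>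
     (\<forall>a\<in>R. \<forall>c. c *\<^sub>R a \<in> R \<longrightarrow> c = 1 \<or> c = -1)"

definition irreducible_root_system :: "'a::euclidean_space set \<Rightarrow> bool" where
  "irreducible_root_system R \<longleftrightarrow>
     root_system R \<and> R \<noteq> {} \<and>
     \<not> (\<exists>A B. A \<noteq> {} \<and> B \<noteq> {} \<and> R = A \<union> B \<and> (\<forall>a\<in>A. \<forall>b\<in>B. a \<bullet> b = 0))"

definition long_roots_normalized :: "'a::euclidean_space set \<Rightarrow> bool" where
  "long_roots_normalized R \<longleftrightarrow> Max ((\<lambda>a. a \<bullet> a) ` R) = 2"

text \<open>The set \<open>\<Delta>\<close> of simple roots. Together with \<open>span R = UNIV\<close>, the conditions
  make \<open>\<Delta>\<close> a vector space basis.\<close>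

definition simple_roots :: "'a::euclidean_space set \<Rightarrow> 'a set \<Rightarrow> bool" where
  "simple_roots R \<Delta> \<longleftrightarrow>
     \<Delta> \<subseteq> R \<and> independent \<Delta> \<and>
     (\<forall>b\<in>R. \<exists>k :: 'a \<Rightarrow> nat. b = (\<Sum>a\<in>\<Delta>. real (k a) *\<^sub>R a) \<or> b = - (\<Sum>a\<in>\<Delta>. real (k a) *\<^sub>R a))"

definition highest_root :: "'a::euclidean_space set \<Rightarrow> 'a set \<Rightarrow> 'a \<Rightarrow> bool" where
  "highest_root R \<Delta> \<xi> \<longleftrightarrow>
     \<xi> \<in> R \<and> (\<forall>b\<in>R. \<exists>k :: 'a \<Rightarrow> nat. \<xi> - b = (\<Sum>a\<in>\<Delta>. real (k a) *\<^sub>R a))"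

definition weyl_group :: "'a::euclidean_space set \<Rightarrow> ('a \<Rightarrow> 'a) set" where
  "weyl_group \<Delta> = generate (BijGroup UNIV) (root_reflection ` \<Delta>)"

definition weyl_orbit :: "'a::euclidean_space set \<Rightarrow> 'a \<Rightarrow> 'a set" where
  "weyl_orbit \<Delta> v = (\<lambda>w. w v) ` weyl_group \<Delta>"

definition dominant_chamber :: "'a::euclidean_space set \<Rightarrow> 'a set" where
  "dominant_chamber \<Delta> = {x. \<forall>a\<in>\<Delta>. x \<bullet> a \<ge> 0}"

definition weight_lattice :: "'a::euclidean_space set \<Rightarrow> 'a set" where
  "weight_lattice \<Delta> = {v. \<forall>a\<in>\<Delta>. v \<bullet> coroot a \<in> \<int>}"

definition dominant_weights :: "'a::euclidean_space set \<Rightarrow> 'a set" where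
  "dominant_weights \<Delta> = weight_lattice \<Delta> \<inter> dominant_chamber \<Delta>"

definition fundamental_simplex :: "'a::euclidean_space set \<Rightarrow> 'a \<Rightarrow> 'a set" where
  "fundamental_simplex \<Delta> \<xi> = {y. (\<forall>a\<in>\<Delta>. y \<bullet> a > 0) \<and> y \<bullet> \<xi> < 1}"

definition orbit_function :: "'a::euclidean_space set \<Rightarrow> 'a \<Rightarrow> 'a \<Rightarrow> complex" where
  "orbit_function \<Delta> v x =
     (\<Sum>u\<in>weyl_orbit \<Delta> v. exp (2 * complex_of_real pi * \<i> * complex_of_real (u \<bullet> x)))"


section \<open>The space of square-integrable functions\<close>

text \<open>Elements are represented by functions rather than by classes modulo equality almost
  everywhere, so \<open>L2_norm\<close> is a seminorm. The values outside \<open>S\<close> play no role.\<close>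

definition L2_functions :: "'a::euclidean_space set \<Rightarrow> ('a \<Rightarrow> complex) set" where
  "L2_functions S =
     {f. f \<in> borel_measurable (lebesgue_on S) \<and> integrable (lebesgue_on S) (\<lambda>x. (cmod (f x))\<^sup>2)}"

definition L2_inner :: "'a::euclidean_space set \<Rightarrow> ('a \<Rightarrow> complex) \<Rightarrow> ('a \<Rightarrow> complex) \<Rightarrow> complex" where
  "L2_inner S f g =
     inverse (complex_of_real (measure lebesgue S)) * (LINT x|lebesgue_on S. f x * cnj (g x))"

definition L2_norm :: "'a::euclidean_space set \<Rightarrow> ('a \<Rightarrow> complex) \<Rightarrow> real" where
  "L2_norm S f = sqrt (Re (L2_inner S f f))"

text \<open>Orthogonal basis in the Hilbert space sense: nonzero pairwise orthogonal vectors whose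
  finite linear combinations are dense.\<close>

definition L2_orthogonal_basis ::
    "'a::euclidean_space set \<Rightarrow> 'i set \<Rightarrow> ('i \<Rightarrow> 'a \<Rightarrow> complex) \<Rightarrow> bool" where
  "L2_orthogonal_basis S I \<phi> \<longleftrightarrow>
     (\<forall>i\<in>I. \<phi> i \<in> L2_functions S \<and> L2_norm S (\<phi> i) \<noteq> 0) \<and>
     (\<forall>i\<in>I. \<forall>j\<in>I. i \<noteq> j \<longrightarrow> L2_inner S (\<phi> i) (\<phi> j) = 0) \<and>
     (\<forall>f\<in>L2_functions S. \<forall>e>0. \<exists>J c. finite J \<and> J \<subseteq> I \<and>
        L2_norm S (\<lambda>x. f x - (\<Sum>j\<in>J. c j * \<phi> j x)) < e)"

text \<open>Unconditional convergence in the mean of \<open>\<Sum>i\<in>I. g i\<close> to \<open>f\<close>, in analogy to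
  \<^const>\<open>has_sum\<close>.\<close>

definition L2_has_sum ::
    "'a::euclidean_space set \<Rightarrow> ('i \<Rightarrow> 'a \<Rightarrow> complex) \<Rightarrow> ('a \<Rightarrow> complex) \<Rightarrow> 'i set \<Rightarrow> bool" where
  "L2_has_sum S g f I \<longleftrightarrow>
     ((\<lambda>J. L2_norm S (\<lambda>x. f x - (\<Sum>i\<in>J. g i x))) \<longlongrightarrow> 0) (finite_subsets_at_top I)"

definition orbit_coefficient ::
    "'a::euclidean_space set \<Rightarrow> 'a set \<Rightarrow> ('a \<Rightarrow> complex) \<Rightarrow> 'a \<Rightarrow> complex" where
  "orbit_coefficient \<Delta> S f v =
     inverse (of_nat (card (weyl_orbit \<Delta> v))) * inverse (complex_of_real (measure lebesgue S)) *
     (LINT x|lebesgue_on S. f x * cnj (orbit_function \<Delta> v x))"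

end

theory Submission
  imports Defs
begin

text \<open>The affine Weyl group is the semidirect product of \<open>W\<close> and the lattice \<open>Q\<close> dual to the weights,
  and the closed simplex meets each of its orbits exactly once. Both facts follow from the exchange
  argument for words in the reflections in the walls of a chamber and from descent on affine roots.
  Hence the \<open>W\<close>-translates of the open simplex form, up to null sets, a fundamental domain for \<open>Q\<close>.
  The integral of the character of a nonzero weight over such a domain is invariant under translating
  the integrand, so it vanishes, and orthogonality follows by averaging over \<open>W\<close>. The span of the orbit
  functions is the algebra of \<open>W\<close>-invariant trigonometric polynomials. It separates the points of the
  closed simplex because these lie in distinct orbits, so it is dense by the Stone-Weierstrass theorem.
  Best approximation then gives the expansion and the Plancherel formula.\<close>

section \<open>Chambers of affine reflection groups\<close>

text \<open>The exchange argument is needed twice, for \<open>W\<close> acting linearly and for the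
  affine group. It is carried out once, for an abstract family of affine functionals of which little
  more is asked than closure under the simple reflections, nonvanishing on the open chamber and
  genuine walls. The lattice \<open>Q\<close> is defined as the dual of the weight lattice and not
  as the span of the coroots. So characters are \<open>Q\<close>-periodic by definition, and points
  at which all characters agree differ by an element of \<open>Q\<close>, which is what separation
  of points requires. The price is a proof that translations by \<open>Q\<close> are generated by
  affine reflections; the fundamental weights pay it. No quotient torus is formed. An integral over
  the fundamental domain is compared with its translate through a finite partition of unity made of
  lattice translates. For a nonzero weight some translation multiplies the character by -1, so the
  integral equals its own negative.\<close>

text \<open>The pair \<open>(a, k)\<close> stands for the affine functional \<open>x \<mapsto> x \<bullet> a + k\<close>.\<close>

definition aff_val :: "'a::euclidean_space \<times> real \<Rightarrow> 'a \<Rightarrow> real" where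
  "aff_val f x = x \<bullet> fst f + snd f"

definition aff_refl :: "'a::euclidean_space \<times> real \<Rightarrow> 'a \<Rightarrow> 'a" where
  "aff_refl f x = x - (2 * aff_val f x / (fst f \<bullet> fst f)) *\<^sub>R fst f"

text \<open>This is \<open>f\<close> composed with the reflection in \<open>s\<close>, again written
  as a pair: the linear part is the reflected vector, and the constant absorbs the offset of the
  hyperplane of \<open>s\<close>.\<close>

definition pull :: "'a::euclidean_space \<times> real \<Rightarrow> 'a \<times> real \<Rightarrow> 'a \<times> real" where
  "pull s f = (fst f - (2 * (fst s \<bullet> fst f) / (fst s \<bullet> fst s)) *\<^sub>R fst s,
               snd f - 2 * snd s * (fst s \<bullet> fst f) / (fst s \<bullet> fst s))"

text \<open>Words rather than group elements are the primary objects, since the exchange argument is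
  an induction on length. The head of the list is applied last.\<close>

definition act :: "('a::euclidean_space \<times> real) list \<Rightarrow> 'a \<Rightarrow> 'a" where
  "act ss = foldr (\<lambda>s. (\<circ>) (aff_refl s)) ss id"

lemma act_Nil [simp]: "act [] = id"
  and act_Cons [simp]: "act (s # ss) = aff_refl s \<circ> act ss"
  by (simp_all add: act_def)

lemma act_append: "act (ss @ ts) = act ss \<circ> act ts"
  by (induction ss) (auto simp: comp_assoc)

lemma aff_val_pull: "aff_val (pull s f) x = aff_val f (aff_refl s x)"
  by (simp add: aff_val_def pull_def aff_refl_def inner_diff inner_diff_left algebra_simps
      inner_commute add_divide_distrib)

lemma aff_val_refl:
  assumes "fst s \<noteq> 0"
  shows "aff_val s (aff_refl s x) = - aff_val s x"
proof -
  have "(2 * aff_val s x / (fst s \<bullet> fst s)) * (fst s \<bullet> fst s) = 2 * aff_val s x"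
    using assms by simp
  moreover have "aff_val s (aff_refl s x) = aff_val s x - (2 * aff_val s x / (fst s \<bullet> fst s)) * (fst s \<bullet> fst s)"
    by (simp only: aff_val_def aff_refl_def inner_diff_left inner_scaleR_left)
  ultimately show ?thesis by linarith
qed

lemma aff_refl_refl:
  assumes "fst s \<noteq> 0"
  shows "aff_refl s (aff_refl s x) = x"
proof -
  have "aff_refl s (aff_refl s x) = aff_refl s x - (2 * aff_val s (aff_refl s x) / (fst s \<bullet> fst s)) *\<^sub>R fst s"
    by (simp add: aff_refl_def)
  also have "\<dots> = x"
    unfolding aff_val_refl[OF assms] by (simp add: aff_refl_def)
  finally show ?thesis .
qed

lemma aff_refl_comp_refl [simp]: "fst s \<noteq> 0 \<Longrightarrow> aff_refl s \<circ> aff_refl s = id"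
  by (auto simp: fun_eq_iff aff_refl_refl)

lemma aff_refl_fixed: "aff_val s x = 0 \<Longrightarrow> aff_refl s x = x"
  by (simp add: aff_refl_def)

lemma inner_pull_self:
  assumes "fst s \<noteq> 0"
  shows "fst (pull s f) \<bullet> fst (pull s f) = fst f \<bullet> fst f"
proof -
  have "fst s \<bullet> fst s \<noteq> 0" using assms by simp
  then show ?thesis
    by (simp add: pull_def inner_diff_left inner_diff_right inner_commute field_simps)
qed

lemma aff_refl_minus_refl:
  "aff_refl s x - aff_refl s y = (x - y) - (2 * ((x - y) \<bullet> fst s) / (fst s \<bullet> fst s)) *\<^sub>R fst s"
  by (simp add: aff_refl_def aff_val_def inner_diff_left algebra_simps diff_divide_distrib add_divide_distrib)

text \<open>Conjugating a reflection by an isometry gives the reflection in the transported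
  hyperplane. Stated without inverses, the rule pushes \<open>aff_refl f\<close> through a word
  letter by letter.\<close>

lemma aff_refl_conj:
  assumes "fst s \<noteq> 0"
  shows "aff_refl f \<circ> aff_refl s = aff_refl s \<circ> aff_refl (pull s f)"
proof
  fix x
  let ?c = "2 * aff_val f (aff_refl s x) / (fst f \<bullet> fst f)"
  let ?y = "aff_refl s x"
  have "aff_refl (pull s f) x = x - ?c *\<^sub>R fst (pull s f)"
    by (simp add: aff_refl_def[of "pull s f"] inner_pull_self[OF assms] aff_val_pull)
  moreover have "aff_refl s (x - ?c *\<^sub>R fst (pull s f)) = aff_refl s x - ?c *\<^sub>R fst f"
  proof -
    have *: "fst (pull s f) - (2 * (fst (pull s f) \<bullet> fst s) / (fst s \<bullet> fst s)) *\<^sub>R fst s = fst f"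
      using assms by (simp add: pull_def inner_diff_left inner_commute[of "fst f"])
    have "aff_refl s (x - ?c *\<^sub>R fst (pull s f)) - aff_refl s x
        = - ?c *\<^sub>R (fst (pull s f) - (2 * (fst (pull s f) \<bullet> fst s) / (fst s \<bullet> fst s)) *\<^sub>R fst s)"
      unfolding aff_refl_minus_refl by (simp add: algebra_simps)
    then show ?thesis unfolding * by (simp add: algebra_simps)
  qed
  ultimately show "(aff_refl f \<circ> aff_refl s) x = (aff_refl s \<circ> aff_refl (pull s f)) x"
    by (simp add: aff_refl_def[of f])
qed

text \<open>A reflection depends only on the zero set of its functional, so it suffices later to
  identify a functional with a wall up to a nonzero factor.\<close>

lemma aff_refl_scale:
  assumes "c \<noteq> 0"
  shows "aff_refl (c *\<^sub>R s) = aff_refl s"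
proof
  fix x show "aff_refl (c *\<^sub>R s) x = aff_refl s x"
    using assms by (simp add: aff_refl_def aff_val_def algebra_simps add_divide_distrib)
qed

lemma aff_val_segment: "aff_val f (x + t *\<^sub>R (y - x)) = aff_val f x + t * (aff_val f y - aff_val f x)"
  by (simp add: aff_val_def inner_diff_left inner_add_left algebra_simps)

lemma aff_val_add: "aff_val f (x + v) = aff_val f x + v \<bullet> fst f"
  by (simp add: aff_val_def inner_add_left)

section \<open>Chambers and the groups generated by the reflections in their walls\<close>

definition open_chamber :: "('a::euclidean_space \<times> real) set \<Rightarrow> 'a set" where
  "open_chamber S = {x. \<forall>s\<in>S. aff_val s x > 0}"

definition closed_chamber :: "('a::euclidean_space \<times> real) set \<Rightarrow> 'a set" where
  "closed_chamber S = {x. \<forall>s\<in>S. aff_val s x \<ge> 0}"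

definition reflection_group :: "('a::euclidean_space \<times> real) set \<Rightarrow> ('a \<Rightarrow> 'a) set" where
  "reflection_group S = {act ss | ss. set ss \<subseteq> S}"

lemma reflection_group_id: "id \<in> reflection_group S"
  unfolding reflection_group_def by (auto intro!: exI[of _ "[]"])

lemma reflection_group_refl: "s \<in> S \<Longrightarrow> aff_refl s \<in> reflection_group S"
  unfolding reflection_group_def by (auto intro!: exI[of _ "[s]"])

lemma reflection_group_comp:
  "g \<in> reflection_group S \<Longrightarrow> h \<in> reflection_group S \<Longrightarrow> g \<circ> h \<in> reflection_group S"
proof -
  assume "g \<in> reflection_group S" "h \<in> reflection_group S"
  then obtain ss ts where "set ss \<subseteq> S" "g = act ss" "set ts \<subseteq> S" "h = act ts"
    by (auto simp: reflection_group_def)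
  then show "g \<circ> h \<in> reflection_group S"
    unfolding reflection_group_def by (auto intro!: exI[of _ "ss @ ts"] simp: act_append)
qed

lemma reflection_group_induct [consumes 1, case_names id step]:
  assumes "g \<in> reflection_group S" "P id"
    "\<And>s g. s \<in> S \<Longrightarrow> g \<in> reflection_group S \<Longrightarrow> P g \<Longrightarrow> P (aff_refl s \<circ> g)"
  shows "P g"
proof -
  obtain ss where ss: "set ss \<subseteq> S" "g = act ss" using assms(1) by (auto simp: reflection_group_def)
  have "P (act ss)" using ss(1)
    by (induction ss) (use assms(2,3) in \<open>auto simp: reflection_group_def\<close>)
  then show ?thesis using ss by simp
qed

lemma reflection_group_inverse:
  assumes "g \<in> reflection_group S" "\<And>s. s \<in> S \<Longrightarrow> fst s \<noteq> 0"
  shows "\<exists>h\<in>reflection_group S. g \<circ> h = id \<and> h \<circ> g = id"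
  using assms(1)
proof (induction rule: reflection_group_induct)
  case id
  show ?case by (rule bexI[OF _ reflection_group_id]) simp
next
  case (step s g)
  then obtain h where h: "h \<in> reflection_group S" "g \<circ> h = id" "h \<circ> g = id" by blast
  have s: "aff_refl s \<circ> aff_refl s = id" using assms(2) step by simp
  have "(aff_refl s \<circ> g) \<circ> (h \<circ> aff_refl s) = aff_refl s \<circ> (g \<circ> h) \<circ> aff_refl s"
    "(h \<circ> aff_refl s) \<circ> (aff_refl s \<circ> g) = h \<circ> (aff_refl s \<circ> aff_refl s) \<circ> g"
    by (simp_all only: comp_assoc)
  then have "(aff_refl s \<circ> g) \<circ> (h \<circ> aff_refl s) = id" "(h \<circ> aff_refl s) \<circ> (aff_refl s \<circ> g) = id"
    unfolding h(2) s by (simp_all add: h(3) s)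
  then show ?case
    using h(1) step(1) reflection_group_comp reflection_group_refl by blast
qed

lemma eventually_aff_val_pos:
  assumes "aff_val f x > 0"
  shows "\<forall>\<^sub>F t in at_right (0::real). aff_val f (x + t *\<^sub>R v) > 0"
proof -
  have "((\<lambda>t. aff_val f x + t * (v \<bullet> fst f)) \<longlongrightarrow> aff_val f x + 0 * (v \<bullet> fst f)) (at_right 0)"
    by (intro tendsto_intros)
  then have "((\<lambda>t. aff_val f (x + t *\<^sub>R v)) \<longlongrightarrow> aff_val f x) (at_right 0)"
    by (simp add: aff_val_add)
  then show ?thesis using assms by (rule order_tendstoD)
qed

lemma norm_diff_scaleR_sq:
  fixes v a :: "'a::real_inner"
  shows "norm (v - c *\<^sub>R a) ^ 2 = norm v ^ 2 - 2 * c * (v \<bullet> a) + c * (c * (a \<bullet> a))"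
  unfolding power2_norm_eq_inner
  by (simp add: inner_diff_left inner_diff_right inner_commute[of a v] algebra_simps)

lemma open_subset_closed: "open_chamber S \<subseteq> closed_chamber S"
  by (auto simp: open_chamber_def closed_chamber_def less_imp_le)

text \<open>A chamber cut out by finitely many simple functionals \<open>S\<close> within a family
  \<Phi> of reflecting hyperplanes, none of which meets its interior. The assumption
  \<open>wall\<close> gives each simple functional a zero that is strictly inside all other
  half-spaces. The instances are the Weyl chamber and the fundamental simplex.\<close>

locale reflection_chamber =
  fixes \<Phi> S :: "('a::euclidean_space \<times> real) set"
  assumes simple_subset: "S \<subseteq> \<Phi>"
    and finite_simple: "finite S"
    and nonzero: "f \<in> \<Phi> \<Longrightarrow> fst f \<noteq> 0"
    and pull_closed: "f \<in> \<Phi> \<Longrightarrow> s \<in> S \<Longrightarrow> pull s f \<in> \<Phi>"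
    and chamber_nonempty: "open_chamber S \<noteq> {}"
    and nonvanishing: "f \<in> \<Phi> \<Longrightarrow> x \<in> open_chamber S \<Longrightarrow> aff_val f x \<noteq> 0"
    and wall: "s \<in> S \<Longrightarrow> \<exists>p. aff_val s p = 0 \<and> (\<forall>t\<in>S - {s}. aff_val t p > 0)"
begin

lemma nonzero_simple: "s \<in> S \<Longrightarrow> fst s \<noteq> 0"
  using nonzero simple_subset by blast

text \<open>The chamber is convex, so a functional taking both signs would vanish on the connecting
  segment, at the parameter \<open>t\<close> found by linear interpolation.\<close>

lemma sign_constant:
  assumes "f \<in> \<Phi>" "x \<in> open_chamber S" "y \<in> open_chamber S" "aff_val f x > 0"
  shows "aff_val f y > 0"
proof (rule ccontr)
  assume "\<not> aff_val f y > 0"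
  then have neg: "aff_val f y < 0" using nonvanishing[OF assms(1,3)] by linarith
  define t where "t = aff_val f x / (aff_val f x - aff_val f y)"
  have t: "0 < t" "t < 1" using neg assms(4) by (auto simp: t_def field_simps)
  let ?z = "x + t *\<^sub>R (y - x)"
  have "aff_val s ?z > 0" if "s \<in> S" for s
  proof -
    have "aff_val s ?z = (1 - t) * aff_val s x + t * aff_val s y"
      unfolding aff_val_segment by (simp add: algebra_simps)
    moreover have "aff_val s x > 0" "aff_val s y > 0"
      using that assms(2,3) by (auto simp: open_chamber_def)
    ultimately show ?thesis using t by (simp add: add_pos_pos)
  qed
  then have "?z \<in> open_chamber S" by (simp add: open_chamber_def)
  moreover have "aff_val f ?z = 0"
    unfolding aff_val_segment t_def using neg assms(4) by (simp add: field_simps)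
  ultimately show False using nonvanishing[OF assms(1)] by blast
qed

text \<open>In the direction \<open>fst s\<close> the value of \<open>s\<close> grows from 0, while
  the finitely many other simple functionals stay positive for small parameters.\<close>

lemma near_wall:
  assumes "s \<in> S" "aff_val s p = 0" "\<forall>t\<in>S - {s}. aff_val t p > 0"
  shows "\<forall>\<^sub>F t in at_right (0::real). p + t *\<^sub>R fst s \<in> open_chamber S"
proof -
  have "\<forall>\<^sub>F t in at_right (0::real). \<forall>r\<in>S. aff_val r (p + t *\<^sub>R fst s) > 0"
  proof (rule eventually_ball_finite[OF finite_simple], rule ballI)
    fix r assume r: "r \<in> S"
    show "\<forall>\<^sub>F t in at_right (0::real). aff_val r (p + t *\<^sub>R fst s) > 0"
    proof (cases "r = s")
      case True
      have "\<forall>\<^sub>F t in at_right (0::real). t > 0" by (rule eventually_at_right_less)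
      then show ?thesis
        by eventually_elim (use True assms nonzero_simple in \<open>auto simp: aff_val_add\<close>)
    next
      case False
      then have "aff_val r p > 0" using r assms(3) by blast
      then show ?thesis by (rule eventually_aff_val_pos)
    qed
  qed
  then show ?thesis by (simp add: open_chamber_def)
qed

text \<open>The point \<open>p\<close> is approached from both sides of the wall. Inside the chamber
  \<open>f\<close> is positive; in the mirror image it is negative, because \<open>pull s f\<close>
  has constant sign on the chamber. Both limits equal \<open>aff_val f p\<close>.\<close>

lemma vanish_on_wall:
  assumes "f \<in> \<Phi>" "s \<in> S" "x \<in> open_chamber S" "aff_val f x > 0" "aff_val f (aff_refl s x) < 0"
    and p: "aff_val s p = 0" "\<forall>t\<in>S - {s}. aff_val t p > 0"
  shows "aff_val f p = 0"
proof -
  have lim: "((\<lambda>t. aff_val f (p + t *\<^sub>R v)) \<longlongrightarrow> aff_val f p) (at_right 0)" for v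
  proof -
    have "((\<lambda>t. aff_val f p + t * (v \<bullet> fst f)) \<longlongrightarrow> aff_val f p + 0 * (v \<bullet> fst f)) (at_right 0)"
      by (intro tendsto_intros)
    then show ?thesis by (simp add: aff_val_add)
  qed
  have ev: "\<forall>\<^sub>F t in at_right (0::real). p + t *\<^sub>R fst s \<in> open_chamber S"
    by (rule near_wall[OF assms(2) p])
  have "\<forall>\<^sub>F t in at_right (0::real). 0 \<le> aff_val f (p + t *\<^sub>R fst s)"
    using ev
  proof eventually_elim
    case (elim t)
    then show ?case using sign_constant[OF assms(1,3) elim assms(4)] by simp
  qed
  then have 1: "0 \<le> aff_val f p"
    using lim tendsto_lowerbound trivial_limit_at_right_real by blast
  have mirror: "aff_refl s (p + t *\<^sub>R fst s) = p + t *\<^sub>R (- fst s)" for t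
    using nonzero_simple[OF assms(2)] p(1)
    by (simp add: aff_refl_def aff_val_add algebra_simps flip: scaleR_2)
  have "\<forall>\<^sub>F t in at_right (0::real). aff_val f (p + t *\<^sub>R (- fst s)) \<le> 0"
    using ev
  proof eventually_elim
    case (elim t)
    have "pull s f \<in> \<Phi>" using assms pull_closed by blast
    moreover have "\<not> aff_val (pull s f) x > 0" using assms by (simp add: aff_val_pull)
    ultimately have "\<not> aff_val (pull s f) (p + t *\<^sub>R fst s) > 0"
      using sign_constant elim assms(3) by blast
    then show ?case by (simp add: aff_val_pull mirror)
  qed
  then have 2: "aff_val f p \<le> 0"
    using lim tendsto_upperbound trivial_limit_at_right_real by blast
  show ?thesis using 1 2 by simp
qed

text \<open>A hyperplane that separates the chamber from its image across the wall \<open>s\<close>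
  must be that wall: \<open>f\<close> vanishes on all strict wall points, an open piece of the
  hyperplane of \<open>s\<close>, and this determines \<open>f\<close> up to a factor.\<close>

lemma adjacent:
  assumes "f \<in> \<Phi>" "s \<in> S" "x \<in> open_chamber S" "aff_val f x > 0" "aff_val f (aff_refl s x) < 0"
  obtains c where "c \<noteq> 0" "f = c *\<^sub>R s"
proof -
  obtain p where p: "aff_val s p = 0" "\<forall>t\<in>S - {s}. aff_val t p > 0"
    using wall[OF assms(2)] by blast
  let ?a = "fst s"
  define c where "c = (fst f \<bullet> ?a) / (?a \<bullet> ?a)"
  \<comment> \<open>The component of \<open>fst f\<close> orthogonal to \<open>fst s\<close>. A
    small move from \<open>p\<close> along \<open>b\<close> stays among the strict wall points,
    where \<open>f\<close> vanishes, and this forces \<open>b = 0\<close>.\<close>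
  define b where "b = fst f - c *\<^sub>R ?a"
  have orth: "b \<bullet> ?a = 0" using nonzero_simple[OF assms(2)] by (simp add: b_def c_def inner_diff_left)
  have "\<forall>\<^sub>F t in at_right (0::real). \<forall>r\<in>S - {s}. aff_val r (p + t *\<^sub>R b) > 0"
    using p(2) by (intro eventually_ball_finite finite_Diff finite_simple ballI eventually_aff_val_pos) auto
  moreover have "\<forall>\<^sub>F t in at_right (0::real). t > 0" by (rule eventually_at_right_less)
  ultimately have "\<forall>\<^sub>F t in at_right (0::real). (\<forall>r\<in>S - {s}. aff_val r (p + t *\<^sub>R b) > 0) \<and> t > 0"
    by (rule eventually_conj)
  then obtain t :: real where t: "\<forall>r\<in>S - {s}. aff_val r (p + t *\<^sub>R b) > 0" "t > 0"
    using eventually_happens' trivial_limit_at_right_real by (metis (no_types, lifting))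
  have "aff_val s (p + t *\<^sub>R b) = 0" using p(1) orth by (simp add: aff_val_add)
  then have "aff_val f (p + t *\<^sub>R b) = 0"
    using vanish_on_wall[OF assms] t by blast
  moreover have fp: "aff_val f p = 0" using vanish_on_wall[OF assms p] .
  ultimately have "b \<bullet> fst f = 0" using t(2) by (simp add: aff_val_add)
  then have "b \<bullet> b = 0" using orth by (simp add: b_def inner_diff_right)
  then have fst: "fst f = c *\<^sub>R ?a" by (simp add: b_def)
  have "snd f = c * snd s"
    using fp p(1) by (simp add: aff_val_def fst) (metis (no_types, opaque_lifting) add_eq_0_iff mult_minus_right)
  then have "f = c *\<^sub>R s" using fst by (simp add: prod_eq_iff)
  moreover have "c \<noteq> 0" using nonzero[OF assms(1)] fst by auto
  ultimately show ?thesis using that by blast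
qed

text \<open>Let \<open>t\<close> be the first letter. If \<open>pull t f\<close> is still positive
  at \<open>x\<close>, the reflection is conjugated past \<open>t\<close> and the rest of the word
  is shortened. Otherwise \<open>f\<close> changes sign across the wall \<open>t\<close>, hence is a
  multiple of \<open>t\<close>, and the two reflections cancel.\<close>

lemma exchange:
  assumes "f \<in> \<Phi>" "set ss \<subseteq> S" "x \<in> open_chamber S" "aff_val f x > 0" "aff_val f (act ss x) < 0"
  shows "\<exists>ts. set ts \<subseteq> S \<and> length ts < length ss \<and> aff_refl f \<circ> act ss = act ts"
  using assms
proof (induction ss arbitrary: f)
  case Nil
  then show ?case by simp
next
  case (Cons t ss)
  have t: "t \<in> S" "set ss \<subseteq> S" using Cons.prems by auto
  have f': "pull t f \<in> \<Phi>" using pull_closed Cons.prems t by blast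
  have conj: "aff_refl f \<circ> aff_refl t = aff_refl t \<circ> aff_refl (pull t f)"
    using aff_refl_conj nonzero_simple t by blast
  show ?case
  proof (cases "aff_val (pull t f) x > 0")
    case True
    have "aff_val (pull t f) (act ss x) < 0" using Cons.prems by (simp add: aff_val_pull)
    then obtain ts where ts: "set ts \<subseteq> S" "length ts < length ss" "aff_refl (pull t f) \<circ> act ss = act ts"
      using Cons.IH[OF f' t(2) \<open>x \<in> open_chamber S\<close> True] by blast
    have "aff_refl f \<circ> act (t # ss) = (aff_refl f \<circ> aff_refl t) \<circ> act ss" by (simp only: act_Cons comp_assoc)
    also have "\<dots> = act (t # ts)" unfolding conj comp_assoc ts(3) act_Cons ..
    finally show ?thesis using ts(1,2) t by (intro exI[of _ "t # ts"]) (simp del: act_Cons)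
  next
    case False
    then have "aff_val f (aff_refl t x) < 0"
      using nonvanishing[OF f' \<open>x \<in> open_chamber S\<close>] by (simp add: aff_val_pull)
    then obtain c where "c \<noteq> 0" "f = c *\<^sub>R t"
      using adjacent Cons.prems t by metis
    then have "aff_refl f = aff_refl t" by (simp add: aff_refl_scale)
    then have "aff_refl f \<circ> act (t # ss) = (aff_refl t \<circ> aff_refl t) \<circ> act ss" by (simp add: comp_assoc)
    also have "\<dots> = act ss" using nonzero_simple t by simp
    finally show ?thesis using t by (intro exI[of _ ss]) (simp del: act_Cons)
  qed
qed

text \<open>A functional composed with a word stays in \<Phi> and therefore has constant sign on the
  chamber: no hyperplane of \<Phi> cuts through an image of the chamber.\<close>

lemma pull_word:
  assumes "f \<in> \<Phi>" "set ss \<subseteq> S"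
  obtains g where "g \<in> \<Phi>" "\<And>x. aff_val g x = aff_val f (act ss x)"
proof -
  have "\<exists>g\<in>\<Phi>. \<forall>x. aff_val g x = aff_val f (act ss x)"
    using assms
  proof (induction ss arbitrary: f)
    case (Cons s ss)
    then have "pull s f \<in> \<Phi>" using pull_closed by auto
    from Cons.IH[OF this] Cons.prems show ?case by (auto simp: aff_val_pull)
  qed auto
  then show ?thesis using that by blast
qed

lemma segment_into_open:
  assumes "x0 \<in> open_chamber S" "x \<in> closed_chamber S"
  shows "\<forall>\<^sub>F t in at_right (0::real). x + t *\<^sub>R (x0 - x) \<in> open_chamber S"
proof -
  have "\<forall>\<^sub>F t in at_right (0::real). t > 0" by (rule eventually_at_right_less)
  moreover have "\<forall>\<^sub>F t in at_right (0::real). t < 1"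
    by (rule order_tendstoD[OF tendsto_ident_at]) simp
  ultimately show ?thesis
  proof eventually_elim
    case (elim t)
    have "aff_val s (x + t *\<^sub>R (x0 - x)) > 0" if "s \<in> S" for s
    proof -
      have "aff_val s (x + t *\<^sub>R (x0 - x)) = (1 - t) * aff_val s x + t * aff_val s x0"
        unfolding aff_val_segment by (simp add: algebra_simps)
      moreover have "aff_val s x \<ge> 0" "aff_val s x0 > 0"
        using that assms(1,2) by (auto simp: open_chamber_def closed_chamber_def)
      ultimately show ?thesis using elim by (simp add: add_nonneg_pos)
    qed
    then show ?case by (simp add: open_chamber_def)
  qed
qed

lemma segment_tendsto:
  fixes x y :: "'b::real_normed_vector"
  shows "((\<lambda>t. x + t *\<^sub>R (y - x)) \<longlongrightarrow> x) (at_right (0::real))"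
proof -
  have "((\<lambda>t. x + t *\<^sub>R (y - x)) \<longlongrightarrow> x + 0 *\<^sub>R (y - x)) (at_right (0::real))"
    by (intro tendsto_intros)
  then show ?thesis by simp
qed

lemma nonpos_on_closed:
  assumes "x0 \<in> open_chamber S" "x \<in> closed_chamber S"
    and neg: "\<And>z. z \<in> open_chamber S \<Longrightarrow> aff_val f z < 0"
  shows "aff_val f x \<le> 0"
proof -
  have "((\<lambda>t. aff_val f (x + t *\<^sub>R (x0 - x))) \<longlongrightarrow> aff_val f x) (at_right 0)"
    unfolding aff_val_def by (intro tendsto_intros segment_tendsto)
  moreover have "\<forall>\<^sub>F t in at_right (0::real). aff_val f (x + t *\<^sub>R (x0 - x)) \<le> 0"
    using segment_into_open[OF assms(1,2)] by eventually_elim (use neg in \<open>auto intro: less_imp_le\<close>)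
  ultimately show ?thesis using tendsto_upperbound trivial_limit_at_right_real by blast
qed

lemma closure_open_chamber: "closure (open_chamber S) = closed_chamber S"
proof
  have "closed_chamber S = (\<Inter>s\<in>S. {x. 0 \<le> aff_val s x})"
    by (auto simp: closed_chamber_def)
  also have "closed \<dots>"
    unfolding aff_val_def by (intro closed_INT ballI closed_Collect_le continuous_intros)
  finally have "closed (closed_chamber S)" .
  then show "closure (open_chamber S) \<subseteq> closed_chamber S"
    by (intro closure_minimal open_subset_closed)
next
  show "closed_chamber S \<subseteq> closure (open_chamber S)"
  proof
    fix x assume x: "x \<in> closed_chamber S"
    obtain x0 where x0: "x0 \<in> open_chamber S" using chamber_nonempty by blast
    have "\<forall>\<^sub>F t in at_right (0::real). x + t *\<^sub>R (x0 - x) \<in> closure (open_chamber S)"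
      using segment_into_open[OF x0 x] by eventually_elim (use closure_subset in blast)
    then show "x \<in> closure (open_chamber S)"
      using Lim_in_closed_set[OF closed_closure _ trivial_limit_at_right_real segment_tendsto] by blast
  qed
qed

text \<open>Let \<open>s\<close> be the first letter. If the image of the chamber is on the positive
  side of \<open>s\<close>, then \<open>s\<close> separates the chamber from its image under the
  remaining word, and exchange yields a shorter word for the same map. If it is on the negative
  side, the image of \<open>x\<close> lies on both closed sides of \<open>s\<close>, hence on its
  hyperplane, and dropping \<open>s\<close> does not move it. Exchange replaces the whole word, so
  the induction is on length.\<close>

theorem fundamental_domain:
  assumes "set ss \<subseteq> S" "x \<in> closed_chamber S" "act ss x \<in> closed_chamber S"
  shows "act ss x = x \<and> (x \<in> open_chamber S \<longrightarrow> act ss = id)"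
  using assms
proof (induction ss rule: length_induct)
  case (1 ss)
  obtain x0 where x0: "x0 \<in> open_chamber S" using chamber_nonempty by blast
  show ?case
  proof (cases ss)
    case Nil
    then show ?thesis by simp
  next
    case (Cons s ts)
    have s: "s \<in> S" "set ts \<subseteq> S" using "1.prems" Cons by auto
    have s\<Phi>: "s \<in> \<Phi>" using s simple_subset by blast
    obtain g where g: "g \<in> \<Phi>" "\<And>x. aff_val g x = aff_val s (act ss x)"
      using pull_word[OF s\<Phi> "1.prems"(1)] by blast
    show ?thesis
    proof (cases "aff_val s (act ss x0) > 0")
      case True
      then have "aff_val s (act ts x0) < 0"
        using Cons by (simp add: aff_val_refl nonzero_simple s)
      moreover have "aff_val s x0 > 0" using x0 s by (simp add: open_chamber_def)
      ultimately obtain us where us: "set us \<subseteq> S" "length us < length ts" "aff_refl s \<circ> act ts = act us"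
        using exchange[OF s\<Phi> s(2) x0] by blast
      have eq: "act ss = act us" using us Cons by simp
      have "length us < length ss" using us Cons by simp
      with "1.IH" us(1) "1.prems" eq show ?thesis by metis
    next
      case False
      have "aff_val g z < 0" if "z \<in> open_chamber S" for z
        using sign_constant[OF g(1) that x0] nonvanishing[OF g(1) that] False
        unfolding g(2)[symmetric] by linarith
      then have "aff_val g x \<le> 0" using nonpos_on_closed x0 "1.prems"(2) by blast
      moreover have "aff_val s (act ss x) \<ge> 0" using "1.prems"(3) s by (simp add: closed_chamber_def)
      ultimately have 0: "aff_val s (act ss x) = 0" by (simp add: g(2))
      have "aff_refl s (act ss x) = act ts x"
        using Cons by (simp add: aff_refl_refl nonzero_simple s)
      then have eq: "act ss x = act ts x" using aff_refl_fixed[OF 0] by simp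
      then have "act ts x = x" using "1.IH" "1.prems" Cons s by simp
      \<comment> \<open>The point equals its image and so lies on the hyperplane of
        \<open>s\<close>; the claim about interior points becomes vacuous.\<close>
      moreover have "x \<notin> open_chamber S"
        using 0 eq calculation s by (force simp: open_chamber_def)
      ultimately show ?thesis using eq by simp
    qed
  qed
qed

corollary fundamental_domain_group:
  assumes "g \<in> reflection_group S" "x \<in> closed_chamber S" "g x \<in> closed_chamber S"
  shows "g x = x" "x \<in> open_chamber S \<Longrightarrow> g = id"
  using fundamental_domain assms by (auto simp: reflection_group_def)

text \<open>This plays the role of induction on the height of a root. Pulling back along a simple
  \<open>s\<close> that makes an acute angle with \<open>h\<close> lowers the value at
  \<open>x0\<close>, and only finitely many functionals have a smaller positive value. If the value
  would turn negative, \<open>adjacent\<close> shows the functional to be a multiple of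
  \<open>s\<close>, the base case.\<close>

lemma descent_induct:
  assumes f: "f \<in> \<Phi>" and x0: "x0 \<in> open_chamber S" and pos: "aff_val f x0 > 0"
    and fin: "\<And>c. finite {h \<in> \<Phi>. 0 < aff_val h x0 \<and> aff_val h x0 < c}"
    and acute: "\<And>h. h \<in> \<Phi> \<Longrightarrow> aff_val h x0 > 0 \<Longrightarrow> \<exists>s\<in>S. fst h \<bullet> fst s > 0"
    and base: "\<And>h s c. h \<in> \<Phi> \<Longrightarrow> s \<in> S \<Longrightarrow> c \<noteq> 0 \<Longrightarrow> h = c *\<^sub>R s \<Longrightarrow> P h"
    and step: "\<And>h s. h \<in> \<Phi> \<Longrightarrow> s \<in> S \<Longrightarrow> P (pull s h) \<Longrightarrow> P h"
  shows "P f"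
  using f pos
proof (induction "card {h \<in> \<Phi>. 0 < aff_val h x0 \<and> aff_val h x0 < aff_val f x0}" arbitrary: f rule: less_induct)
  case less
  obtain s where s: "s \<in> S" "fst f \<bullet> fst s > 0" using acute less.prems by blast
  have s0: "fst s \<noteq> 0" using nonzero_simple s by blast
  have f': "pull s f \<in> \<Phi>" using pull_closed less.prems s by blast
  show ?case
  proof (cases "aff_val (pull s f) x0 > 0")
    case False
    then have "aff_val f (aff_refl s x0) < 0"
      using nonvanishing[OF f' x0] by (simp add: aff_val_pull)
    then show ?thesis using adjacent[OF less.prems(1) s(1) x0 less.prems(2)] base less.prems s by metis
  next
    case True
    have "aff_val (pull s f) x0 = aff_val f x0 - 2 * aff_val s x0 / (fst s \<bullet> fst s) * (fst s \<bullet> fst f)"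
      unfolding aff_val_pull by (simp add: aff_refl_def aff_val_def inner_diff_left)
    moreover have "2 * aff_val s x0 / (fst s \<bullet> fst s) * (fst s \<bullet> fst f) > 0"
      using x0 s s0 by (simp add: open_chamber_def inner_commute)
    ultimately have lt: "aff_val (pull s f) x0 < aff_val f x0" by simp
    have "card {h \<in> \<Phi>. 0 < aff_val h x0 \<and> aff_val h x0 < aff_val (pull s f) x0}
        < card {h \<in> \<Phi>. 0 < aff_val h x0 \<and> aff_val h x0 < aff_val f x0}"
      by (rule psubset_card_mono[OF fin]) (use lt True f' in auto)
    then have "P (pull s f)" using less.hyps f' True by blast
    then show ?thesis using step less.prems s by blast
  qed
qed

text \<open>The point of an orbit nearest to an interior point of the chamber lies in the closed chamber.\<close>

lemma orbit_meets_chamber: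
  assumes fin: "\<And>r. finite {y. (\<exists>g\<in>reflection_group S. y = g x) \<and> dist y x \<le> r}"
  obtains g where "g \<in> reflection_group S" "g x \<in> closed_chamber S"
proof -
  obtain x0 where x0: "x0 \<in> open_chamber S" using chamber_nonempty by blast
  define X where "X = {y. \<exists>g\<in>reflection_group S. y = g x}"
  have xX: "x \<in> X" unfolding X_def using reflection_group_id by (metis (mono_tags) id_apply mem_Collect_eq)
  define Y where "Y = {y \<in> X. dist y x0 \<le> dist x x0}"
  have "dist y x \<le> 2 * dist x x0" if "dist y x0 \<le> dist x x0" for y
    using dist_triangle2[of y x x0] that by simp
  then have "Y \<subseteq> {y. (\<exists>g\<in>reflection_group S. y = g x) \<and> dist y x \<le> 2 * dist x x0}"
    unfolding Y_def X_def by blast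
  then have "finite Y" using fin finite_subset by blast
  moreover have "Y \<noteq> {}" using xX Y_def by auto
  ultimately obtain z where z: "z \<in> Y" "\<forall>y\<in>Y. dist z x0 \<le> dist y x0"
    using arg_min_if_finite(1,2)[of Y "\<lambda>y. dist y x0"] by (metis linorder_not_le)
  have min: "dist z x0 \<le> dist y x0" if "y \<in> X" for y
    using z that by (cases "y \<in> Y") (auto simp: Y_def)
  obtain g where g: "g \<in> reflection_group S" "z = g x" using z by (auto simp: Y_def X_def)
  have "aff_val s z \<ge> 0" if s: "s \<in> S" for s
  proof (rule ccontr)
    assume neg: "\<not> aff_val s z \<ge> 0"
    let ?a = "fst s"
    let ?c = "2 * aff_val s z / (?a \<bullet> ?a)"
    have a: "?a \<bullet> ?a > 0" using nonzero_simple[OF s] by simp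
    have "aff_refl s z \<in> X" unfolding X_def using g s
      by (auto intro!: bexI[of _ "aff_refl s \<circ> g"] reflection_group_comp reflection_group_refl)
    then have le: "norm (z - x0) ^ 2 \<le> norm (aff_refl s z - x0) ^ 2"
      using min by (auto simp: dist_norm intro!: power_mono)
    have "norm (aff_refl s z - x0) ^ 2 = norm ((z - x0) - ?c *\<^sub>R ?a) ^ 2"
      by (simp add: aff_refl_def algebra_simps)
    also have "\<dots> = norm (z - x0) ^ 2 - 2 * ?c * ((z - x0) \<bullet> ?a) + ?c * (?c * (?a \<bullet> ?a))"
      by (rule norm_diff_scaleR_sq)
    also have "?c * (?a \<bullet> ?a) = 2 * aff_val s z" using a by simp
    also have "norm (z - x0) ^ 2 - 2 * ?c * ((z - x0) \<bullet> ?a) + ?c * (2 * aff_val s z)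
        = norm (z - x0) ^ 2 + 2 * ?c * aff_val s x0"
    proof -
      have "(z - x0) \<bullet> ?a = aff_val s z - aff_val s x0" by (simp add: aff_val_def inner_diff_left)
      then show ?thesis by (simp only: right_diff_distrib)
    qed
    finally have "?c * aff_val s x0 \<ge> 0" using le by simp
    moreover have "?c < 0" using neg a by (simp add: divide_neg_pos)
    moreover have "aff_val s x0 > 0" using x0 s by (simp add: open_chamber_def)
    ultimately show False using mult_neg_pos by (metis not_le)
  qed
  then have "z \<in> closed_chamber S" by (simp add: closed_chamber_def)
  then show ?thesis using that g by blast
qed

end

section \<open>The Weyl group and the affine Weyl group\<close>

abbreviation lin :: "'a::euclidean_space \<Rightarrow> 'a \<times> real" where
  "lin a \<equiv> (a, 0)"

lemma aff_refl_lin: "aff_refl (lin a) = root_reflection a"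
  by (auto simp: aff_refl_def root_reflection_def coroot_def aff_val_def)

lemma root_reflection_alt: "root_reflection a x = x - (2 * (x \<bullet> a) / (a \<bullet> a)) *\<^sub>R a"
  by (simp add: root_reflection_def coroot_def)

lemma inner_coroot: "x \<bullet> coroot a = 2 * (x \<bullet> a) / (a \<bullet> a)"
  by (simp add: coroot_def)

lemma inner_root_reflection: "root_reflection a x \<bullet> root_reflection a y = x \<bullet> y"
proof (cases "a = 0")
  case False
  then have "a \<bullet> a \<noteq> 0" by simp
  then show ?thesis
    by (simp add: root_reflection_alt inner_diff_left inner_diff_right inner_commute field_simps)
qed (simp add: root_reflection_alt)

lemma root_reflection_self: "root_reflection a a = - a"
  by (cases "a = 0") (simp_all add: root_reflection_alt algebra_simps scaleR_2)

lemma root_reflection_twice: "root_reflection a (root_reflection a x) = x"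
  by (cases "a = 0") (simp add: root_reflection_alt, metis fst_conv aff_refl_lin aff_refl_refl)

lemma linear_root_reflection: "linear (root_reflection a)"
  by (rule linearI) (simp_all add: root_reflection_def inner_add_left algebra_simps)

text \<open>Reflections are involutions, so inverses add nothing and the generated group consists of
  the words in the generators.\<close>

lemma weyl_group_eq:
  assumes "0 \<notin> \<Delta>"
  shows "weyl_group \<Delta> = reflection_group (lin ` \<Delta>)"
proof -
  let ?G = "BijGroup (UNIV :: 'a set)"
  interpret group ?G by (rule group_BijGroup)
  have bij: "root_reflection a \<in> carrier ?G" for a :: 'a
    using root_reflection_twice[of a]
    by (auto simp: BijGroup_def Bij_def extensional_def intro!: o_bij[of "root_reflection a"])
  have mult: "g \<otimes>\<^bsub>?G\<^esub> h = g \<circ> h" if "g \<in> carrier ?G" "h \<in> carrier ?G" for g h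
    using that by (auto simp: BijGroup_def compose_def)
  have one: "\<one>\<^bsub>?G\<^esub> = id" by (auto simp: BijGroup_def)
  have inv_refl: "inv\<^bsub>?G\<^esub> (root_reflection a) = root_reflection a" for a :: 'a
    by (rule inv_equality) (auto simp: mult one bij root_reflection_twice)
  have incl: "root_reflection ` \<Delta> \<subseteq> carrier ?G" using bij by blast
  show ?thesis
  proof (rule Set.set_eqI, rule iffI)
    fix w assume "w \<in> weyl_group \<Delta>"
    then have "w \<in> generate ?G (root_reflection ` \<Delta>)" by (simp add: weyl_group_def)
    then show "w \<in> reflection_group (lin ` \<Delta>)"
    proof (induction rule: generate.induct)
      case one
      show ?case unfolding \<open>\<one>\<^bsub>?G\<^esub> = id\<close> by (rule reflection_group_id)
    next
      case (incl h)
      then obtain a where "a \<in> \<Delta>" "h = root_reflection a" by blast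
      then have a: "a \<in> \<Delta>" "h = aff_refl (lin a)" by (simp_all add: aff_refl_lin)
      show ?case unfolding a(2) by (rule reflection_group_refl) (use a in blast)
    next
      case (inv h)
      then obtain a where "a \<in> \<Delta>" "h = root_reflection a" by blast
      then have a: "a \<in> \<Delta>" "inv\<^bsub>?G\<^esub> h = aff_refl (lin a)" by (simp_all add: aff_refl_lin inv_refl)
      show ?case unfolding a(2) by (rule reflection_group_refl) (use a in blast)
    next
      case (eng h1 h2)
      then have "h1 \<in> carrier ?G" "h2 \<in> carrier ?G" using generate_in_carrier[OF incl] by blast+
      then show ?case using eng mult reflection_group_comp by metis
    qed
  next
    fix w assume "w \<in> reflection_group (lin ` \<Delta>)"
    then have "w \<in> generate ?G (root_reflection ` \<Delta>)"
    proof (induction rule: reflection_group_induct)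
      case id
      show ?case using generate.one[of ?G] unfolding one .
    next
      case (step s g)
      then obtain a where a: "a \<in> \<Delta>" "aff_refl s = root_reflection a" using aff_refl_lin by auto
      have "root_reflection a \<otimes>\<^bsub>?G\<^esub> g \<in> generate ?G (root_reflection ` \<Delta>)"
        by (rule generate.eng[OF generate.incl]) (use a step in auto)
      moreover have "g \<in> carrier ?G" using step generate_in_carrier[OF incl] by blast
      ultimately show ?case unfolding a(2) using mult[OF bij] by metis
    qed
    then show "w \<in> weyl_group \<Delta>" by (simp add: weyl_group_def)
  qed
qed

section \<open>Root systems with simple roots and a highest root\<close>

locale based_root_system =
  fixes R \<Delta> :: "'a::euclidean_space set" and \<xi> :: 'a
  assumes root_system: "root_system R"
    and simple: "simple_roots R \<Delta>"
    and highest: "highest_root R \<Delta> \<xi>"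
begin

lemma finite_R: "finite R"
  and zero_R: "0 \<notin> R"
  and span_R: "span R = UNIV"
  and reflection_R: "a \<in> R \<Longrightarrow> b \<in> R \<Longrightarrow> root_reflection a b \<in> R"
  and cartan_integer: "a \<in> R \<Longrightarrow> b \<in> R \<Longrightarrow> b \<bullet> coroot a \<in> \<int>"
  and reduced: "a \<in> R \<Longrightarrow> c *\<^sub>R a \<in> R \<Longrightarrow> c = 1 \<or> c = -1"
  using root_system unfolding root_system_def by auto

lemma subset_R: "\<Delta> \<subseteq> R"
  and independent: "independent \<Delta>"
  using simple unfolding simple_roots_def by auto

lemma \<xi>_R: "\<xi> \<in> R"
  using highest unfolding highest_root_def by auto

lemma finite_\<Delta>: "finite \<Delta>"
  using finite_R subset_R finite_subset by blast

lemma zero_\<Delta>: "0 \<notin> \<Delta>"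
  using zero_R subset_R by blast

lemma neg_R: "a \<in> R \<Longrightarrow> - a \<in> R"
  using reflection_R[of a a] by (simp add: root_reflection_self)

lemma root_expansion:
  assumes "b \<in> R"
  obtains k :: "'a \<Rightarrow> nat" where "b = (\<Sum>a\<in>\<Delta>. real (k a) *\<^sub>R a) \<or> b = - (\<Sum>a\<in>\<Delta>. real (k a) *\<^sub>R a)"
  using simple assms unfolding simple_roots_def by blast

text \<open>By independence, values prescribed on \<Delta> extend to a linear form, and its adjoint
  at 1 is the vector representing it. Suitable values give interior points, wall points and dual
  bases.\<close>

lemma coweight:
  fixes c :: "'a \<Rightarrow> real"
  obtains v where "\<And>a. a \<in> \<Delta> \<Longrightarrow> v \<bullet> a = c a"
proof -
  obtain g :: "'a \<Rightarrow> real" where g: "linear g" "\<forall>a\<in>\<Delta>. g a = c a"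
    using linear_independent_extend[OF independent] by blast
  have "g a = adjoint g 1 \<bullet> a" for a
    using adjoint_works[OF g(1), of a 1] by (simp add: inner_commute)
  then show ?thesis using that g(2) by metis
qed

lemma inner_sum_\<Delta>: "x \<bullet> (\<Sum>a\<in>\<Delta>. k a *\<^sub>R a) = (\<Sum>a\<in>\<Delta>. k a * (x \<bullet> a))"
  by (simp add: inner_sum_right)

lemma eq_of_inner_\<Delta>:
  assumes "\<And>a. a \<in> \<Delta> \<Longrightarrow> x \<bullet> a = y \<bullet> a"
  shows "x = y"
proof -
  have "(x - y) \<bullet> b = 0" if b: "b \<in> R" for b
  proof -
    obtain k :: "'a \<Rightarrow> nat" where "b = (\<Sum>a\<in>\<Delta>. real (k a) *\<^sub>R a) \<or> b = - (\<Sum>a\<in>\<Delta>. real (k a) *\<^sub>R a)"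
      by (rule root_expansion[OF b])
    moreover have "(x - y) \<bullet> (\<Sum>a\<in>\<Delta>. real (k a) *\<^sub>R a) = 0"
      unfolding inner_sum_\<Delta> by (rule sum.neutral) (simp add: inner_diff_left assms)
    ultimately show ?thesis by auto
  qed
  then have "orthogonal (x - y) (x - y)"
    using orthogonal_to_span[of "x - y" R "x - y"] span_R by (simp add: orthogonal_def)
  then show ?thesis by (simp add: orthogonal_def)
qed

text \<open>Comparing \<xi> with its own negative exhibits twice \<xi> as a nonnegative combination,
  which settles the sign of the expansion at the price of halving coefficients. Comparing \<xi> with
  a simple root \<open>b\<close> then raises the coefficient of \<open>b\<close> to at least
  1.\<close>

lemma \<xi>_expansion:
  obtains m where "\<xi> = (\<Sum>a\<in>\<Delta>. m a *\<^sub>R a)" "\<And>a. a \<in> \<Delta> \<Longrightarrow> m a \<ge> 1"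
proof -
  have dom: "\<exists>k :: 'a \<Rightarrow> nat. \<xi> - b = (\<Sum>a\<in>\<Delta>. real (k a) *\<^sub>R a)" if "b \<in> R" for b
    using highest that by (auto simp: highest_root_def)
  obtain k :: "'a \<Rightarrow> nat" where k: "\<xi> - (- \<xi>) = (\<Sum>a\<in>\<Delta>. real (k a) *\<^sub>R a)"
    using dom[OF neg_R[OF \<xi>_R]] by blast
  define m where "m a = real (k a) / 2" for a
  have "\<xi> = (1 / 2) *\<^sub>R (\<xi> - (- \<xi>))" by (simp flip: scaleR_2)
  also have "\<dots> = (\<Sum>a\<in>\<Delta>. m a *\<^sub>R a)" unfolding k by (simp add: scaleR_right.sum m_def)
  finally have \<xi>: "\<xi> = (\<Sum>a\<in>\<Delta>. m a *\<^sub>R a)" .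
  have "m b \<ge> 1" if b: "b \<in> \<Delta>" for b
  proof -
    obtain v where v: "\<And>a. a \<in> \<Delta> \<Longrightarrow> v \<bullet> a = (if a = b then 1 else 0)"
      using coweight[of "\<lambda>a. if a = b then 1 else 0"] by blast
    have coef: "v \<bullet> (\<Sum>a\<in>\<Delta>. c a *\<^sub>R a) = c b" for c
    proof -
      have "(\<Sum>a\<in>\<Delta>. c a * (v \<bullet> a)) = (\<Sum>a\<in>\<Delta>. if a = b then c a else 0)"
        by (intro sum.cong) (auto simp: v)
      then show ?thesis unfolding inner_sum_\<Delta> using b finite_\<Delta> by simp
    qed
    obtain l :: "'a \<Rightarrow> nat" where l: "\<xi> - b = (\<Sum>a\<in>\<Delta>. real (l a) *\<^sub>R a)"
      using dom b subset_R by blast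
    have "m b = v \<bullet> \<xi>" using coef \<xi> by metis
    also have "\<dots> = v \<bullet> (\<xi> - b) + 1" using v[OF b] by (simp add: inner_diff_right)
    also have "\<dots> = real (l b) + 1" unfolding l coef ..
    finally show ?thesis by simp
  qed
  then show ?thesis using that \<xi> by blast
qed

lemma inner_\<xi>_nonneg:
  assumes "\<And>a. a \<in> \<Delta> \<Longrightarrow> x \<bullet> a \<ge> 0"
  shows "x \<bullet> \<xi> \<ge> 0"
proof -
  obtain m where m: "\<xi> = (\<Sum>a\<in>\<Delta>. m a *\<^sub>R a)" "\<And>a. a \<in> \<Delta> \<Longrightarrow> m a \<ge> 1"
    using \<xi>_expansion by blast
  have "0 \<le> (\<Sum>a\<in>\<Delta>. m a * (x \<bullet> a))"
    using m(2) assms by (intro sum_nonneg mult_nonneg_nonneg) force+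
  then show ?thesis by (subst m(1)) (simp only: inner_sum_\<Delta>)
qed

lemma inner_root_le_\<xi>:
  assumes "\<And>a. a \<in> \<Delta> \<Longrightarrow> x \<bullet> a \<ge> 0" "b \<in> R"
  shows "x \<bullet> b \<le> x \<bullet> \<xi>"
proof -
  obtain k :: "'a \<Rightarrow> nat" where k: "\<xi> - b = (\<Sum>a\<in>\<Delta>. real (k a) *\<^sub>R a)"
    using highest assms by (auto simp: highest_root_def)
  have "x \<bullet> (\<xi> - b) \<ge> 0"
    unfolding k inner_sum_\<Delta> using assms by (intro sum_nonneg) simp
  then show ?thesis by (simp add: inner_diff_right)
qed

text \<open>The coefficients of a root share one sign and are not all zero, so nothing cancels where
  all simple roots are positive.\<close>

lemma inner_root_nonzero:
  assumes "\<And>a. a \<in> \<Delta> \<Longrightarrow> x \<bullet> a > 0" "b \<in> R"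
  shows "x \<bullet> b \<noteq> 0"
proof -
  obtain k :: "'a \<Rightarrow> nat" where k: "b = (\<Sum>a\<in>\<Delta>. real (k a) *\<^sub>R a) \<or> b = - (\<Sum>a\<in>\<Delta>. real (k a) *\<^sub>R a)"
    by (rule root_expansion[OF assms(2)])
  have "\<exists>a\<in>\<Delta>. k a \<noteq> 0"
  proof (rule ccontr)
    assume "\<not> ?thesis"
    then have "(\<Sum>a\<in>\<Delta>. real (k a) *\<^sub>R a) = 0" by (intro sum.neutral) auto
    then show False using k zero_R assms by auto
  qed
  then obtain a where "a \<in> \<Delta>" "k a \<noteq> 0" by blast
  then have "0 < (\<Sum>a\<in>\<Delta>. real (k a) * (x \<bullet> a))"
    using assms(1) by (intro sum_pos2[OF finite_\<Delta>, of a]) (auto simp: less_imp_le)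
  then have "x \<bullet> (\<Sum>a\<in>\<Delta>. real (k a) *\<^sub>R a) > 0" unfolding inner_sum_\<Delta> .
  then show ?thesis using k by auto
qed

lemma \<xi>_pos:
  assumes "\<And>a. a \<in> \<Delta> \<Longrightarrow> x \<bullet> a > 0"
  shows "x \<bullet> \<xi> > 0"
  using inner_\<xi>_nonneg[of x] inner_root_nonzero[OF assms \<xi>_R] assms by (simp add: less_le)

lemma regular_point:
  obtains v where "\<And>a. a \<in> \<Delta> \<Longrightarrow> v \<bullet> a = 1"
  using coweight[of "\<lambda>_. 1"] by blast

lemma pull_lin: "pull (lin a) (b, k) = (root_reflection a b, k)"
  by (simp add: pull_def root_reflection_alt inner_commute)

text \<open>The nonnegative value on \<xi> is recorded so that the same vector can be scaled below
  the affine wall.\<close>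

lemma finite_wall:
  assumes "a \<in> \<Delta>"
  shows "\<exists>v. v \<bullet> a = 0 \<and> (\<forall>b\<in>\<Delta>. b \<noteq> a \<longrightarrow> v \<bullet> b = 1) \<and> v \<bullet> \<xi> \<ge> 0"
proof -
  obtain v where v: "\<And>b. b \<in> \<Delta> \<Longrightarrow> v \<bullet> b = (if b = a then 0 else 1)"
    using coweight[of "\<lambda>b. if b = a then 0 else 1"] by blast
  moreover have "v \<bullet> \<xi> \<ge> 0" by (rule inner_\<xi>_nonneg) (simp add: v)
  ultimately show ?thesis using assms by (intro exI[of _ v]) auto
qed

sublocale finite_chamber: reflection_chamber "lin ` R" "lin ` \<Delta>"
proof
  show "lin ` \<Delta> \<subseteq> lin ` R" using subset_R by blast
  show "finite (lin ` \<Delta>)" using finite_\<Delta> by blast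
  show "fst f \<noteq> 0" if "f \<in> lin ` R" for f using that zero_R by auto
  show "pull s f \<in> lin ` R" if "f \<in> lin ` R" "s \<in> lin ` \<Delta>" for f s
    using that subset_R reflection_R by (auto simp: pull_lin)
  show "open_chamber (lin ` \<Delta>) \<noteq> {}"
  proof -
    obtain v where "\<And>a. a \<in> \<Delta> \<Longrightarrow> v \<bullet> a = 1" using regular_point by blast
    then have "v \<in> open_chamber (lin ` \<Delta>)" by (auto simp: open_chamber_def aff_val_def)
    then show ?thesis by blast
  qed
  show "aff_val f x \<noteq> 0" if "f \<in> lin ` R" "x \<in> open_chamber (lin ` \<Delta>)" for f x
    using that inner_root_nonzero[of x] by (auto simp: open_chamber_def aff_val_def)
  show "\<exists>p. aff_val s p = 0 \<and> (\<forall>t\<in>lin ` \<Delta> - {s}. aff_val t p > 0)" if "s \<in> lin ` \<Delta>" for s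
  proof -
    from that obtain a where a: "a \<in> \<Delta>" "s = lin a" by blast
    obtain v where "v \<bullet> a = 0" "\<forall>b\<in>\<Delta>. b \<noteq> a \<longrightarrow> v \<bullet> b = 1"
      using finite_wall[OF a(1)] by blast
    then show ?thesis using a by (intro exI[of _ v]) (auto simp: aff_val_def)
  qed
qed

text \<open>The pair \<open>(- \<xi>, 1)\<close> is 1 minus the value on \<xi>. Its reflection sends
  \<open>x\<close> to the reflection of \<open>x\<close> in \<xi> plus the coroot of \<xi>, which is
  the extra generator of the affine Weyl group.\<close>

definition affine_simple :: "('a \<times> real) set" where
  "affine_simple = insert (- \<xi>, 1) (lin ` \<Delta>)"

lemma open_chamber_affine: "open_chamber affine_simple = fundamental_simplex \<Delta> \<xi>"
  by (auto simp: open_chamber_def affine_simple_def fundamental_simplex_def aff_val_def)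

sublocale affine_chamber: reflection_chamber "R \<times> \<int>" affine_simple
proof
  show "affine_simple \<subseteq> R \<times> \<int>" using subset_R neg_R \<xi>_R by (auto simp: affine_simple_def)
  show "finite affine_simple" using finite_\<Delta> by (simp add: affine_simple_def)
  show "fst f \<noteq> 0" if "f \<in> R \<times> \<int>" for f using that zero_R by auto
  show "pull s f \<in> R \<times> \<int>" if f: "f \<in> R \<times> \<int>" and s: "s \<in> affine_simple" for f s
  proof -
    obtain b k where bk: "f = (b, k)" "b \<in> R" "k \<in> \<int>" using f by auto
    have "pull (- \<xi>, 1) f = (root_reflection \<xi> b, k + b \<bullet> coroot \<xi>)"
      by (simp add: bk pull_def root_reflection_alt inner_coroot inner_commute)
    then show ?thesis
      using bk s subset_R reflection_R \<xi>_R cartan_integer by (auto simp: affine_simple_def pull_lin)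
  qed
  obtain v where v: "\<And>a. a \<in> \<Delta> \<Longrightarrow> v \<bullet> a = 1" using regular_point by blast
  then have v\<xi>: "v \<bullet> \<xi> > 0" by (intro \<xi>_pos) simp
  show "open_chamber affine_simple \<noteq> {}"
  proof -
    \<comment> \<open>Dividing by 1 more than the value on \<xi> brings that value below 1 and keeps
      all simple roots positive.\<close>
    have "(1 / (v \<bullet> \<xi> + 1)) *\<^sub>R v \<in> open_chamber affine_simple"
      using v\<xi> by (auto simp: open_chamber_def affine_simple_def aff_val_def v field_simps)
    then show ?thesis by blast
  qed
  show "aff_val f x \<noteq> 0" if f: "f \<in> R \<times> \<int>" and x: "x \<in> open_chamber affine_simple" for f x
  proof
    assume 0: "aff_val f x = 0"
    obtain b k where bk: "f = (b, k)" "b \<in> R" "k \<in> \<int>" using f by auto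
    have x': "\<And>a. a \<in> \<Delta> \<Longrightarrow> x \<bullet> a > 0" "x \<bullet> \<xi> < 1"
      using x by (auto simp: open_chamber_affine fundamental_simplex_def)
    \<comment> \<open>On the chamber \<xi> dominates each root and its negative, so an integer
      constant cancelling \<open>b\<close> has modulus below 1; this reduces the claim to the linear
      case.\<close>
    have "x \<bullet> b \<le> x \<bullet> \<xi>" "x \<bullet> (- b) \<le> x \<bullet> \<xi>"
      using x' bk neg_R by (auto intro!: inner_root_le_\<xi> simp: less_imp_le simp del: inner_minus_right)
    then have "\<bar>k\<bar> < 1" using 0 x'(2) by (auto simp: bk aff_val_def)
    then have "k = 0" using bk(3) by (auto elim!: Ints_cases)
    then show False using 0 inner_root_nonzero[OF x'(1) bk(2)] by (simp add: bk aff_val_def)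
  qed
  show "\<exists>p. aff_val s p = 0 \<and> (\<forall>t\<in>affine_simple - {s}. aff_val t p > 0)" if s: "s \<in> affine_simple" for s
  proof (cases "s = (- \<xi>, 1)")
    case True
    then show ?thesis
      using v\<xi> by (intro exI[of _ "(1 / (v \<bullet> \<xi>)) *\<^sub>R v"]) (auto simp: affine_simple_def aff_val_def v)
  next
    case False
    then obtain a where a: "a \<in> \<Delta>" "s = lin a" using s by (auto simp: affine_simple_def)
    obtain u where u: "u \<bullet> a = 0" "\<forall>b\<in>\<Delta>. b \<noteq> a \<longrightarrow> u \<bullet> b = 1" "u \<bullet> \<xi> \<ge> 0"
      using finite_wall[OF a(1)] by blast
    have "aff_val t ((1 / (u \<bullet> \<xi> + 1)) *\<^sub>R u) > 0" if t: "t \<in> affine_simple - {s}" for t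
    proof (cases "t = (- \<xi>, 1)")
      case True
      then show ?thesis using u(3) by (simp add: aff_val_def field_simps)
    next
      case False
      then obtain b where b: "b \<in> \<Delta>" "t = lin b" using t by (auto simp: affine_simple_def)
      then have "u \<bullet> b = 1" using u(2) t a by auto
      then show ?thesis using u(3) b by (simp add: aff_val_def)
    qed
    then show ?thesis
      using u(1) a by (intro exI[of _ "(1 / (u \<bullet> \<xi> + 1)) *\<^sub>R u"]) (auto simp: aff_val_def)
  qed
qed

section \<open>Action of the Weyl group on roots and weights\<close>

abbreviation W :: "('a \<Rightarrow> 'a) set" where "W \<equiv> weyl_group \<Delta>"

abbreviation P :: "'a set" where "P \<equiv> weight_lattice \<Delta>"

lemma W_eq: "W = reflection_group (lin ` \<Delta>)"
  by (rule weyl_group_eq[OF zero_\<Delta>])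

lemma W_induct [consumes 1, case_names id step]:
  assumes "w \<in> W" "Q id"
    and "\<And>a w. a \<in> \<Delta> \<Longrightarrow> w \<in> W \<Longrightarrow> Q w \<Longrightarrow> Q (root_reflection a \<circ> w)"
  shows "Q w"
  using assms(1) unfolding W_eq
proof (induction rule: reflection_group_induct)
  case id
  show ?case by (rule assms(2))
next
  case (step s g)
  then obtain a where a: "a \<in> \<Delta>" "s = lin a" by blast
  show ?case unfolding a aff_refl_lin using assms(3)[OF a(1)] step by (simp only: W_eq)
qed

lemma W_id: "id \<in> W"
  by (simp add: W_eq reflection_group_id)

lemma W_comp: "w \<in> W \<Longrightarrow> w' \<in> W \<Longrightarrow> w \<circ> w' \<in> W"
  by (simp add: W_eq reflection_group_comp)

lemma W_reflection: "a \<in> \<Delta> \<Longrightarrow> root_reflection a \<in> W"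
  using reflection_group_refl[of "lin a"] by (simp add: W_eq aff_refl_lin)

lemma W_inverse:
  assumes "w \<in> W"
  shows "\<exists>v\<in>W. (\<forall>x. w (v x) = x) \<and> (\<forall>x. v (w x) = x)"
proof -
  have "\<exists>h\<in>W. w \<circ> h = id \<and> h \<circ> w = id"
    unfolding W_eq by (rule reflection_group_inverse) (use assms W_eq zero_\<Delta> in auto)
  then show ?thesis by (metis comp_apply id_apply)
qed

lemma W_linear: "w \<in> W \<Longrightarrow> linear w"
  by (induction rule: W_induct) (rule linear_id, rule linear_compose[OF _ linear_root_reflection])

lemma W_inner: "w \<in> W \<Longrightarrow> w x \<bullet> w y = x \<bullet> y"
  by (induction rule: W_induct) (auto simp: inner_root_reflection)

lemma W_norm: "w \<in> W \<Longrightarrow> norm (w x) = norm x"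
  by (simp add: norm_eq_sqrt_inner W_inner)

lemma W_root: "w \<in> W \<Longrightarrow> b \<in> R \<Longrightarrow> w b \<in> R"
  by (induction rule: W_induct) (use reflection_R subset_R in auto)

lemma reflection_weight:
  assumes "a \<in> \<Delta>" "v \<in> P"
  shows "root_reflection a v \<in> P"
  unfolding weight_lattice_def
proof (intro CollectI ballI)
  fix b assume b: "b \<in> \<Delta>"
  have "root_reflection a v \<bullet> coroot b = v \<bullet> coroot b - (v \<bullet> coroot a) * (a \<bullet> coroot b)"
    by (simp add: root_reflection_def inner_diff_left)
  moreover have "a \<bullet> coroot b \<in> \<int>"
    using assms(1) b subset_R by (intro cartan_integer) auto
  moreover have "v \<bullet> coroot b \<in> \<int>" "v \<bullet> coroot a \<in> \<int>"
    using assms b by (auto simp: weight_lattice_def)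
  ultimately show "root_reflection a v \<bullet> coroot b \<in> \<int>" by simp
qed

lemma W_weight: "w \<in> W \<Longrightarrow> v \<in> P \<Longrightarrow> w v \<in> P"
  by (induction rule: W_induct) (auto intro: reflection_weight)

text \<open>An element of \<open>W\<close> is linear and maps the finite spanning set
  \<open>R\<close> into itself, so its restriction to \<open>R\<close> determines it.\<close>

lemma finite_W: "finite W"
proof -
  have "inj_on (\<lambda>w. restrict w R) W"
  proof (rule inj_onI)
    fix w w' assume w: "w \<in> W" "w' \<in> W" and eq: "restrict w R = restrict w' R"
    have "w y = w' y" if "y \<in> R" for y using fun_cong[OF eq, of y] that by simp
    then have "w x = w' x" for x
      using linear_eq_on[OF W_linear[OF w(1)] W_linear[OF w(2)], of x R] span_R by simp
    then show "w = w'" by blast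
  qed
  moreover have "(\<lambda>w. restrict w R) ` W \<subseteq> R \<rightarrow>\<^sub>E R"
    using W_root by auto
  then have "finite ((\<lambda>w. restrict w R) ` W)"
    using finite_PiE[OF finite_R, of "\<lambda>_. R"] finite_R finite_subset by blast
  ultimately show ?thesis using finite_imageD by blast
qed

lemma card_W_pos: "card W > 0"
  using finite_W W_id by (auto simp: card_gt_0_iff)

text \<open>The coroot lattice, introduced as the dual lattice of \<open>P\<close>.\<close>

definition Q :: "'a set" where
  "Q = {q. \<forall>v\<in>P. v \<bullet> q \<in> \<int>}"

lemma Q_add: "p \<in> Q \<Longrightarrow> q \<in> Q \<Longrightarrow> p + q \<in> Q"
  and Q_uminus: "q \<in> Q \<Longrightarrow> - q \<in> Q"
  and Q_zero: "0 \<in> Q"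
  by (auto simp: Q_def inner_add_right)

lemma Q_diff: "p \<in> Q \<Longrightarrow> q \<in> Q \<Longrightarrow> p - q \<in> Q"
  using Q_add[OF _ Q_uminus] by fastforce

lemma W_Q:
  assumes "w \<in> W" "q \<in> Q"
  shows "w q \<in> Q"
  unfolding Q_def
proof (intro CollectI ballI)
  fix v assume v: "v \<in> P"
  obtain u where u: "u \<in> W" "\<And>x. w (u x) = x" "\<And>x. u (w x) = x"
    using W_inverse[OF assms(1)] by blast
  have "v \<bullet> w q = w (u v) \<bullet> w q" unfolding u(2) ..
  also have "\<dots> = u v \<bullet> q" using assms by (simp add: W_inner)
  finally show "v \<bullet> w q \<in> \<int>" using assms(2) W_weight u v by (simp add: Q_def)
qed

text \<open>Every root can be moved into \<open>\<Delta>\<close> by descending its value at a point of the chamber.\<close>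

lemma root_reflection_W_and_coroot_Q:
  assumes "b \<in> R"
  shows "root_reflection b \<in> W" "coroot b \<in> Q"
proof -
  \<comment> \<open>Both assertions pass through conjugation by a simple reflection, so one descent
    proves them together. The predicate is stated on pairs, the form that
    \<open>descent_induct\<close> expects.\<close>
  define T where "T h \<longleftrightarrow> aff_refl h \<in> W \<and> coroot (fst h) \<in> Q" for h :: "'a \<times> real"
  have neg: "T (lin b) \<longleftrightarrow> T (lin (- b))" for b
  proof -
    have "aff_refl (lin (- b)) = aff_refl (lin b)" using aff_refl_scale[of "-1" "lin b"] by simp
    moreover have "coroot (- b) = - coroot b" by (simp add: coroot_def)
    ultimately show ?thesis using Q_uminus[of "coroot b"] Q_uminus[of "- coroot b"] by (auto simp: T_def)
  qed
  have pos: "T f" if f: "f \<in> lin ` R" and x0: "x0 \<in> open_chamber (lin ` \<Delta>)" and p: "aff_val f x0 > 0" for f x0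
  proof (rule finite_chamber.descent_induct[OF f x0 p])
    show "finite {h \<in> lin ` R. 0 < aff_val h x0 \<and> aff_val h x0 < c}" for c
      by (rule finite_subset[of _ "lin ` R"]) (use finite_R in auto)
  next
    fix h assume h: "h \<in> lin ` R" "aff_val h x0 > 0"
    then obtain b where b: "h = lin b" "b \<in> R" by blast
    have x0': "\<And>a. a \<in> \<Delta> \<Longrightarrow> x0 \<bullet> a > 0" using x0 by (auto simp: open_chamber_def aff_val_def)
    obtain k :: "'a \<Rightarrow> nat" where k: "b = (\<Sum>a\<in>\<Delta>. real (k a) *\<^sub>R a) \<or> b = - (\<Sum>a\<in>\<Delta>. real (k a) *\<^sub>R a)"
      by (rule root_expansion[OF b(2)])
    have "x0 \<bullet> (\<Sum>a\<in>\<Delta>. real (k a) *\<^sub>R a) \<ge> 0"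
      unfolding inner_sum_\<Delta> using x0' by (intro sum_nonneg) (simp add: less_imp_le)
    then have k: "b = (\<Sum>a\<in>\<Delta>. real (k a) *\<^sub>R a)" using k h(2) b by (auto simp: aff_val_def)
    show "\<exists>s\<in>lin ` \<Delta>. fst h \<bullet> fst s > 0"
    proof (rule ccontr)
      assume "\<not> ?thesis"
      then have "\<And>a. a \<in> \<Delta> \<Longrightarrow> b \<bullet> a \<le> 0" by (force simp: b)
      then have "b \<bullet> (\<Sum>a\<in>\<Delta>. real (k a) *\<^sub>R a) \<le> 0"
        unfolding inner_sum_\<Delta> by (intro sum_nonpos) (simp add: mult_nonneg_nonpos)
      then have "b \<bullet> b \<le> 0" using k by simp
      moreover have "b \<noteq> 0" using b zero_R by blast
      ultimately show False using inner_gt_zero_iff[of b] by linarith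
    qed
  next
    fix h s c assume 3: "h \<in> lin ` R" "s \<in> lin ` \<Delta>" "h = c *\<^sub>R s"
    then obtain a b where ab: "s = lin a" "a \<in> \<Delta>" "h = lin b" "b \<in> R" by blast
    then have "b = c *\<^sub>R a" using 3 by simp
    then have "c = 1 \<or> c = -1" using reduced[of a c] ab subset_R by auto
    moreover have "T (lin a)"
      using W_reflection[OF ab(2)] ab(2) by (auto simp: T_def aff_refl_lin Q_def weight_lattice_def)
    ultimately show "T h" using neg[of a] ab \<open>b = c *\<^sub>R a\<close> by auto
  next
    fix h s assume 4: "h \<in> lin ` R" "s \<in> lin ` \<Delta>" "T (pull s h)"
    then obtain a b where ab: "s = lin a" "a \<in> \<Delta>" "h = lin b" "b \<in> R" by blast
    let ?b = "root_reflection a b"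
    have T: "aff_refl (lin ?b) \<in> W" "coroot ?b \<in> Q" using 4(3) ab by (auto simp: T_def pull_lin)
    have a0: "fst (lin a) \<noteq> 0" using ab zero_\<Delta> by auto
    have "aff_refl h = (aff_refl h \<circ> aff_refl s) \<circ> aff_refl s"
      using aff_refl_comp_refl[OF a0] by (simp add: ab comp_assoc)
    also have "aff_refl h \<circ> aff_refl s = aff_refl s \<circ> aff_refl (lin ?b)"
      using aff_refl_conj[OF a0, of h] by (simp add: ab pull_lin)
    finally have "aff_refl h = aff_refl s \<circ> aff_refl (lin ?b) \<circ> aff_refl s" .
    moreover have "aff_refl s \<in> W" using W_reflection ab by (simp add: aff_refl_lin)
    ultimately have "aff_refl h \<in> W" using T W_comp by metis
    moreover have "root_reflection a (coroot ?b) = coroot b"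
      by (simp add: coroot_def inner_root_reflection linear_root_reflection linear_cmul root_reflection_twice)
    then have "coroot b \<in> Q" using W_Q[OF W_reflection[OF ab(2)] T(2)] by simp
    ultimately show "T h" by (simp add: T_def ab)
  qed
  obtain x0 where x0: "x0 \<in> open_chamber (lin ` \<Delta>)" using finite_chamber.chamber_nonempty by blast
  have "T (lin b)"
  proof (cases "aff_val (lin b) x0 > 0")
    case True
    then show ?thesis using pos x0 assms by blast
  next
    case False
    moreover have "aff_val (lin b) x0 \<noteq> 0" using finite_chamber.nonvanishing x0 assms by blast
    ultimately have "aff_val (lin (- b)) x0 > 0" by (simp add: aff_val_def)
    then have "T (lin (- b))" using pos x0 assms neg_R by blast
    then show ?thesis using neg by blast
  qed
  then show "root_reflection b \<in> W" "coroot b \<in> Q" by (auto simp: T_def aff_refl_lin)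
qed

section \<open>Dominant representatives, fundamental weights and discreteness of
  \<open>Q\<close>\<close>

lemma orbit_meets_dominant:
  obtains w where "w \<in> W" "w x \<in> dominant_chamber \<Delta>"
proof -
  have "finite {y. (\<exists>g\<in>reflection_group (lin ` \<Delta>). y = g x) \<and> dist y x \<le> r}" for r
    by (rule finite_subset[of _ "(\<lambda>g. g x) ` W"]) (use finite_W W_eq in auto)
  then obtain g where "g \<in> reflection_group (lin ` \<Delta>)" "g x \<in> closed_chamber (lin ` \<Delta>)"
    by (rule finite_chamber.orbit_meets_chamber)
  then show ?thesis
    using that W_eq by (auto simp: closed_chamber_def dominant_chamber_def aff_val_def)
qed

lemma dominant_unique:
  assumes "w \<in> W" "x \<in> dominant_chamber \<Delta>" "w x \<in> dominant_chamber \<Delta>"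
  shows "w x = x"
  using finite_chamber.fundamental_domain_group(1)[of w x] assms
  by (auto simp: W_eq closed_chamber_def dominant_chamber_def aff_val_def)

text \<open>The basis dual to the simple coroots. The expansion shows that elements of
  \<open>Q\<close> are integer combinations of simple coroots, because their coordinates are values
  of weights.\<close>

lemma fundamental_weights:
  obtains \<omega> where "\<And>a. a \<in> \<Delta> \<Longrightarrow> \<omega> a \<in> P"
    "\<And>x. x = (\<Sum>a\<in>\<Delta>. (\<omega> a \<bullet> x) *\<^sub>R coroot a)"
proof -
  have "\<exists>v. \<forall>b\<in>\<Delta>. v \<bullet> coroot b = (if b = a then 1 else 0)" for a
  proof -
    \<comment> \<open>The value \<open>b \<bullet> b / 2\<close> makes the pairing with the coroot
      equal to 1.\<close>
    obtain v where v: "\<And>b. b \<in> \<Delta> \<Longrightarrow> v \<bullet> b = (if b = a then b \<bullet> b / 2 else 0)"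
      using coweight[of "\<lambda>b. if b = a then b \<bullet> b / 2 else 0"] by blast
    have "v \<bullet> coroot b = (if b = a then 1 else 0)" if "b \<in> \<Delta>" for b
    proof -
      have "b \<noteq> 0" using that zero_\<Delta> by blast
      then show ?thesis using v[OF that] by (simp add: inner_coroot)
    qed
    then show ?thesis by blast
  qed
  then obtain \<omega> where \<omega>: "\<And>a b. b \<in> \<Delta> \<Longrightarrow> \<omega> a \<bullet> coroot b = (if b = a then 1 else 0)"
    by metis
  have "\<omega> a \<in> P" for a by (auto simp: weight_lattice_def \<omega>)
  moreover have "x = (\<Sum>a\<in>\<Delta>. (\<omega> a \<bullet> x) *\<^sub>R coroot a)" for x
  proof -
    have "x \<in> span \<Delta>"
    proof -
      have "R \<subseteq> span \<Delta>"
      proof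
        fix b assume "b \<in> R"
        then obtain k :: "'a \<Rightarrow> nat" where
          "b = (\<Sum>a\<in>\<Delta>. real (k a) *\<^sub>R a) \<or> b = - (\<Sum>a\<in>\<Delta>. real (k a) *\<^sub>R a)"
          by (rule root_expansion)
        moreover have "(\<Sum>a\<in>\<Delta>. real (k a) *\<^sub>R a) \<in> span \<Delta>"
          by (intro span_sum span_scale span_base)
        ultimately show "b \<in> span \<Delta>" using span_neg by blast
      qed
      then show ?thesis using span_R span_minimal[OF _ subspace_span] by blast
    qed
    then obtain c where c: "x = (\<Sum>a\<in>\<Delta>. c a *\<^sub>R a)" using span_finite[OF finite_\<Delta>] by auto
    define d where "d a = c a * (a \<bullet> a) / 2" for a
    have x: "x = (\<Sum>a\<in>\<Delta>. d a *\<^sub>R coroot a)"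
      unfolding c by (intro sum.cong refl) (use zero_\<Delta> in \<open>auto simp: d_def coroot_def\<close>)
    have "\<omega> b \<bullet> x = d b" if b: "b \<in> \<Delta>" for b
    proof -
      have "\<omega> b \<bullet> x = (\<Sum>a\<in>\<Delta>. d a * (\<omega> b \<bullet> coroot a))"
        by (subst x) (simp add: inner_sum_right)
      also have "\<dots> = (\<Sum>a\<in>\<Delta>. if a = b then d a else 0)"
        by (intro sum.cong) (auto simp: \<omega>)
      finally show ?thesis using b finite_\<Delta> by simp
    qed
    then show ?thesis using x by (metis (no_types, lifting) sum.cong)
  qed
  ultimately show ?thesis using that by blast
qed

text \<open>The integers \<open>\<omega> a \<bullet> q\<close> determine \<open>q\<close>, and
  Cauchy-Schwarz bounds them on a ball.\<close>

lemma finite_Q_bounded: "finite {q \<in> Q. norm q \<le> r}"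
proof -
  obtain \<omega> where \<omega>: "\<And>a. a \<in> \<Delta> \<Longrightarrow> \<omega> a \<in> P" "\<And>x. x = (\<Sum>a\<in>\<Delta>. (\<omega> a \<bullet> x) *\<^sub>R coroot a)"
    using fundamental_weights by metis
  let ?X = "{q \<in> Q. norm q \<le> r}"
  let ?f = "\<lambda>q. \<lambda>a\<in>\<Delta>. \<omega> a \<bullet> q"
  have "?f ` ?X \<subseteq> (\<Pi>\<^sub>E a\<in>\<Delta>. {k \<in> \<int>. - (norm (\<omega> a) * r) \<le> k \<and> k \<le> norm (\<omega> a) * r})"
  proof -
    have "\<bar>\<omega> a \<bullet> q\<bar> \<le> norm (\<omega> a) * r" if "norm q \<le> r" for a q
      using Cauchy_Schwarz_ineq2[of "\<omega> a" q] mult_left_mono[OF that, of "norm (\<omega> a)"] by simp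
    moreover have "\<omega> a \<bullet> q \<in> \<int>" if "a \<in> \<Delta>" "q \<in> Q" for a q
      using that \<omega>(1) by (simp add: Q_def)
    ultimately show ?thesis by (auto simp: abs_le_iff minus_le_iff simp del: norm_ge_zero)
  qed
  moreover have "finite (\<Pi>\<^sub>E a\<in>\<Delta>. {k \<in> \<int>. - (norm (\<omega> a) * r) \<le> k \<and> k \<le> norm (\<omega> a) * r})"
    by (intro finite_PiE finite_\<Delta> finite_int_segment)
  ultimately have "finite (?f ` ?X)" using finite_subset by blast
  moreover have "inj_on ?f ?X"
  proof (rule inj_onI)
    fix p q assume eq: "?f p = ?f q"
    have "\<omega> a \<bullet> p = \<omega> a \<bullet> q" if "a \<in> \<Delta>" for a
      using fun_cong[OF eq, of a] that by simp
    then show "p = q" using \<omega>(2)[of p] \<omega>(2)[of q] by simp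
  qed
  ultimately show ?thesis using finite_imageD by blast
qed

text \<open>Descent on affine roots. The acute angle comes from a linear relation with positive
  coefficients between \<Delta> and \<open>- \<xi>\<close>: a vector with nonpositive products
  against all of these is orthogonal to \<Delta>, hence zero.\<close>

lemma affine_reflection_in_group:
  assumes b: "b \<in> R" and k: "k \<in> \<int>"
  shows "aff_refl (b, k) \<in> reflection_group affine_simple"
proof -
  let ?G = "reflection_group affine_simple"
  have pos: "aff_refl f \<in> ?G"
    if f: "f \<in> R \<times> \<int>" and x0: "x0 \<in> open_chamber affine_simple" and p: "aff_val f x0 > 0" for f x0
  proof (rule affine_chamber.descent_induct[OF f x0 p])
    fix c
    have "{h \<in> R \<times> \<int>. 0 < aff_val h x0 \<and> aff_val h x0 < c}
        \<subseteq> (SIGMA b:R. {k \<in> \<int>. - (x0 \<bullet> b) \<le> k \<and> k \<le> c - x0 \<bullet> b})"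
      by (auto simp: aff_val_def)
    moreover have "finite (SIGMA b:R. {k \<in> \<int>. - (x0 \<bullet> b) \<le> k \<and> k \<le> c - x0 \<bullet> b})"
      by (intro finite_SigmaI finite_R finite_int_segment)
    ultimately show "finite {h \<in> R \<times> \<int>. 0 < aff_val h x0 \<and> aff_val h x0 < c}"
      using finite_subset by blast
  next
    fix h assume h: "h \<in> R \<times> \<int>" "aff_val h x0 > 0"
    let ?b = "fst h"
    show "\<exists>s\<in>affine_simple. ?b \<bullet> fst s > 0"
    proof (rule ccontr)
      assume "\<not> ?thesis"
      then have le: "\<And>a. a \<in> \<Delta> \<Longrightarrow> ?b \<bullet> a \<le> 0" and ge: "?b \<bullet> \<xi> \<ge> 0"
        by (auto simp: affine_simple_def not_less)
      obtain m where m: "\<xi> = (\<Sum>a\<in>\<Delta>. m a *\<^sub>R a)" "\<And>a. a \<in> \<Delta> \<Longrightarrow> m a \<ge> 1"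
        using \<xi>_expansion by blast
      have nonneg: "- (m a * (?b \<bullet> a)) \<ge> 0" if "a \<in> \<Delta>" for a
        using le[OF that] m(2)[OF that] by (simp add: mult_nonneg_nonpos)
      have "(\<Sum>a\<in>\<Delta>. m a * (?b \<bullet> a)) = ?b \<bullet> \<xi>"
        by (subst m(1)) (simp only: inner_sum_\<Delta>)
      then have "(\<Sum>a\<in>\<Delta>. - (m a * (?b \<bullet> a))) \<le> 0" using ge by (simp add: sum_negf)
      moreover have "(\<Sum>a\<in>\<Delta>. - (m a * (?b \<bullet> a))) \<ge> 0" by (rule sum_nonneg) (rule nonneg)
      ultimately have "(\<Sum>a\<in>\<Delta>. - (m a * (?b \<bullet> a))) = 0" by (rule antisym)
      then have "\<forall>a\<in>\<Delta>. - (m a * (?b \<bullet> a)) = 0"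
        by (subst (asm) sum_nonneg_eq_0_iff[OF finite_\<Delta> nonneg])
      then have "?b \<bullet> a = 0 \<bullet> a" if "a \<in> \<Delta>" for a using m(2)[OF that] that by auto
      then have "?b = 0" using eq_of_inner_\<Delta> by blast
      then show False using h zero_R by auto
    qed
  next
    fix h s c assume "s \<in> affine_simple" "h = c *\<^sub>R s" "c \<noteq> 0"
    then show "aff_refl h \<in> ?G" using aff_refl_scale[of c s] reflection_group_refl[of s] by simp
  next
    fix h s assume s: "s \<in> affine_simple" "aff_refl (pull s h) \<in> ?G"
    have s0: "fst s \<noteq> 0" using affine_chamber.nonzero_simple s by blast
    have "aff_refl h = (aff_refl h \<circ> aff_refl s) \<circ> aff_refl s" using s0 by (simp add: comp_assoc)
    also have "\<dots> = aff_refl s \<circ> aff_refl (pull s h) \<circ> aff_refl s" using aff_refl_conj[OF s0] by simp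
    finally show "aff_refl h \<in> ?G" using s by (simp add: reflection_group_comp reflection_group_refl)
  qed
  obtain x0 where x0: "x0 \<in> open_chamber affine_simple" using affine_chamber.chamber_nonempty by blast
  have bk: "(b, k) \<in> R \<times> \<int>" using assms by blast
  show ?thesis
  proof (cases "aff_val (b, k) x0 > 0")
    case True
    then show ?thesis using pos[OF bk x0] by blast
  next
    case False
    then have "aff_val (- b, - k) x0 > 0"
      using affine_chamber.nonvanishing[OF bk x0] by (simp add: aff_val_def)
    moreover have "(- b, - k) \<in> R \<times> \<int>" using assms neg_R by simp
    ultimately have "aff_refl (- b, - k) \<in> ?G" using pos x0 by blast
    then show ?thesis using aff_refl_scale[of "-1" "(b, k)"] by simp
  qed
qed

text \<open>Reflections in two parallel hyperplanes compose to a translation: the levels 0 and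
  \<open>k\<close> of the root \<open>b\<close> give \<open>k\<close> times the coroot of
  \<open>b\<close>. Integer combinations of coroots exhaust \<open>Q\<close>.\<close>

lemma translation_in_group:
  assumes "q \<in> Q"
  shows "(\<lambda>x. x + q) \<in> reflection_group affine_simple"
proof -
  let ?G = "reflection_group affine_simple"
  define T where "T = {q. (\<lambda>x. x + q) \<in> ?G}"
  have T0: "0 \<in> T" using reflection_group_id[of affine_simple] by (simp add: T_def id_def)
  have Tadd: "p + q \<in> T" if "p \<in> T" "q \<in> T" for p q
  proof -
    have "(\<lambda>x. x + q) \<circ> (\<lambda>x. x + p) \<in> ?G" using that by (intro reflection_group_comp) (auto simp: T_def)
    then show ?thesis by (simp add: T_def comp_def add.assoc)
  qed
  have Tint: "k *\<^sub>R coroot b \<in> T" if b: "b \<in> R" and k: "k \<in> \<int>" for b k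
  proof -
    have "aff_refl (b, - k) \<circ> aff_refl (b, 0) \<in> ?G"
      using b k by (intro reflection_group_comp affine_reflection_in_group) auto
    moreover have "(aff_refl (b, - k) \<circ> aff_refl (b, 0)) x = x + k *\<^sub>R coroot b" for x
    proof -
      have "aff_refl (b, - k) y = root_reflection b y + k *\<^sub>R coroot b" for y
        by (simp add: aff_refl_def aff_val_def root_reflection_alt coroot_def diff_divide_distrib algebra_simps)
      then show ?thesis by (simp add: aff_refl_lin root_reflection_twice)
    qed
    ultimately show ?thesis by (simp add: T_def fun_eq_iff[symmetric] comp_def)
  qed
  obtain \<omega> where \<omega>: "\<And>a. a \<in> \<Delta> \<Longrightarrow> \<omega> a \<in> P" "\<And>x. x = (\<Sum>a\<in>\<Delta>. (\<omega> a \<bullet> x) *\<^sub>R coroot a)"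
    using fundamental_weights by metis
  have "(\<Sum>a\<in>A. (\<omega> a \<bullet> q) *\<^sub>R coroot a) \<in> T" if "finite A" "A \<subseteq> \<Delta>" for A
    using that
  proof (induction A)
    case (insert a A)
    then have "\<omega> a \<bullet> q \<in> \<int>" "a \<in> R" using assms \<omega>(1) subset_R by (auto simp: Q_def)
    then show ?case using insert Tadd Tint by simp
  qed (simp add: T0)
  then have "q \<in> T" using \<omega>(2)[of q] finite_\<Delta> by (metis subset_refl)
  then show ?thesis by (simp add: T_def)
qed

lemma W_subset_affine: "w \<in> W \<Longrightarrow> w \<in> reflection_group affine_simple"
proof (induction rule: W_induct)
  case id
  show ?case by (rule reflection_group_id)
next
  case (step a w)
  have "aff_refl (lin a) \<in> reflection_group affine_simple"
    using step by (intro reflection_group_refl) (simp add: affine_simple_def)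
  then show ?case using step reflection_group_comp aff_refl_lin by metis
qed

text \<open>The translation part stays in \<open>Q\<close> under composition with a generator,
  because \<open>W\<close> preserves \<open>Q\<close> and the coroot of \<xi> lies in it.\<close>

lemma affine_group_eq:
  "reflection_group affine_simple = {\<lambda>x. w x + q | w q. w \<in> W \<and> q \<in> Q}"
proof (rule Set.set_eqI, rule iffI)
  fix g assume "g \<in> reflection_group affine_simple"
  then show "g \<in> {\<lambda>x. w x + q | w q. w \<in> W \<and> q \<in> Q}"
  proof (induction rule: reflection_group_induct)
    case id
    then show ?case using W_id Q_zero by (auto intro!: exI[of _ id] exI[of _ 0])
  next
    case (step s g)
    then obtain w q where wq: "w \<in> W" "q \<in> Q" "g = (\<lambda>x. w x + q)" by blast
    obtain b p where bp: "root_reflection b \<in> W" "p \<in> Q" "aff_refl s = (\<lambda>x. root_reflection b x + p)"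
    proof (cases "s = (- \<xi>, 1)")
      case True
      have "aff_refl s = (\<lambda>x. root_reflection \<xi> x + coroot \<xi>)"
        by (auto simp: True aff_refl_def aff_val_def root_reflection_alt coroot_def diff_divide_distrib algebra_simps)
      then show ?thesis using that root_reflection_W_and_coroot_Q[OF \<xi>_R] by blast
    next
      case False
      then obtain a where "a \<in> \<Delta>" "s = lin a" using step by (auto simp: affine_simple_def)
      then show ?thesis using that[of a 0] Q_zero W_reflection by (simp add: aff_refl_lin)
    qed
    have "aff_refl s \<circ> g = (\<lambda>x. (root_reflection b \<circ> w) x + (root_reflection b q + p))"
      by (auto simp: bp wq linear_add[OF linear_root_reflection])
    moreover have "root_reflection b \<circ> w \<in> W" using bp wq W_comp by blast
    moreover have "root_reflection b q + p \<in> Q" using bp wq W_Q Q_add by blast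
    ultimately show ?case by blast
  qed
next
  fix g assume "g \<in> {\<lambda>x. w x + q | w q. w \<in> W \<and> q \<in> Q}"
  then obtain w q where wq: "w \<in> W" "q \<in> Q" "g = (\<lambda>x. w x + q)" by blast
  have "g = (\<lambda>x. x + q) \<circ> w" by (auto simp: wq)
  then show "g \<in> reflection_group affine_simple"
    using wq translation_in_group W_subset_affine reflection_group_comp by metis
qed

section \<open>The closed simplex as a fundamental domain of the affine group\<close>

abbreviation F :: "'a set" where "F \<equiv> fundamental_simplex \<Delta> \<xi>"

lemma closure_F: "closure F = closed_chamber affine_simple"
  using affine_chamber.closure_open_chamber by (simp add: open_chamber_affine)

lemma closure_F_eq: "closure F = {x. (\<forall>a\<in>\<Delta>. x \<bullet> a \<ge> 0) \<and> x \<bullet> \<xi> \<le> 1}"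
  by (auto simp: closure_F closed_chamber_def affine_simple_def aff_val_def)

text \<open>Orbits are locally finite: \<open>w\<close> preserves norms, so a bounded displacement
  bounds the lattice part \<open>q\<close>, and finitely many pairs \<open>(w, q)\<close>
  remain.\<close>

lemma affine_orbit_meets_closure_F:
  obtains w q where "w \<in> W" "q \<in> Q" "w x + q \<in> closure F"
proof -
  have "finite {y. (\<exists>g\<in>reflection_group affine_simple. y = g x) \<and> dist y x \<le> r}" for r
  proof (rule finite_subset)
    let ?B = "{q \<in> Q. norm q \<le> r + 2 * norm x}"
    show "{y. (\<exists>g\<in>reflection_group affine_simple. y = g x) \<and> dist y x \<le> r}
        \<subseteq> (\<lambda>(w, q). w x + q) ` (W \<times> ?B)"
    proof safe
      fix g assume g: "g \<in> reflection_group affine_simple" "dist (g x) x \<le> r"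
      then obtain w q where wq: "w \<in> W" "q \<in> Q" "g = (\<lambda>x. w x + q)" by (auto simp: affine_group_eq)
      have "norm q = norm ((g x - x) + (x - w x))" by (simp add: wq)
      also have "\<dots> \<le> norm (g x - x) + norm (x - w x)" by (rule norm_triangle_ineq)
      also have "\<dots> \<le> r + (norm x + norm (w x))"
        using g norm_triangle_ineq4[of x "w x"] by (simp add: dist_norm)
      finally have "norm q \<le> r + 2 * norm x" using W_norm wq by simp
      then show "g x \<in> (\<lambda>(w, q). w x + q) ` (W \<times> ?B)" using wq by (auto intro!: image_eqI[of _ _ "(w, q)"])
    qed
    show "finite ((\<lambda>(w, q). w x + q) ` (W \<times> ?B))" using finite_W finite_Q_bounded by blast
  qed
  then obtain g where "g \<in> reflection_group affine_simple" "g x \<in> closed_chamber affine_simple"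
    by (rule affine_chamber.orbit_meets_chamber)
  then show ?thesis using that by (auto simp: affine_group_eq closure_F)
qed

lemma closure_F_unique:
  assumes "w \<in> W" "q \<in> Q" "x \<in> closure F" "w x + q \<in> closure F"
  shows "w x + q = x"
proof -
  have "(\<lambda>x. w x + q) \<in> reflection_group affine_simple" using assms by (auto simp: affine_group_eq)
  then show ?thesis using affine_chamber.fundamental_domain_group(1) assms by (auto simp: closure_F)
qed

lemma F_free:
  assumes "w \<in> W" "q \<in> Q" "x \<in> F" "w x + q \<in> F"
  shows "w = id" "q = 0"
proof -
  have g: "(\<lambda>x. w x + q) \<in> reflection_group affine_simple" using assms by (auto simp: affine_group_eq)
  have "(\<lambda>x. w x + q) = id"
    using affine_chamber.fundamental_domain_group(2)[OF g, of x] assms closure_subset[of F]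
    by (auto simp: closure_F open_chamber_affine)
  then have *: "w x + q = x" for x by (metis id_apply)
  show "q = 0" using *[of 0] linear_0[OF W_linear[OF assms(1)]] by simp
  then show "w = id" using * by auto
qed

text \<open>The affine map carrying the first image of \<open>x\<close> to the second sends a point
  of \<open>F\<close> into \<open>F\<close>, so freeness makes it the identity. This is multiplicity
  one in the tiling.\<close>

lemma affine_group_inj:
  assumes "w \<in> W" "q \<in> Q" "w' \<in> W" "q' \<in> Q" "w x + q \<in> F" "w' x + q' \<in> F"
  shows "w = w'" "q = q'"
proof -
  obtain u where u: "u \<in> W" "\<forall>x. w (u x) = x" "\<forall>x. u (w x) = x" using W_inverse[OF assms(1)] by blast
  have u': "(w' \<circ> u) \<in> W" "linear (w' \<circ> u)" using W_comp W_linear u(1) assms by blast+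
  have "(w' \<circ> u) (w x + q) + (q' - (w' \<circ> u) q) = w' x + q'"
    by (simp only: linear_add[OF u'(2)]) (simp add: u)
  moreover have "q' - (w' \<circ> u) q \<in> Q" using assms u' W_Q Q_diff by blast
  ultimately have *: "w' \<circ> u = id" "q' - (w' \<circ> u) q = 0"
    using F_free[OF u'(1), of "q' - (w' \<circ> u) q" "w x + q"] assms(5,6) by metis+
  then show "q = q'" by simp
  have "w' (u (w z)) = w z" for z using fun_cong[OF *(1), of "w z"] by simp
  then show "w = w'" using u(3) by auto
qed

end

section \<open>Invariance of Lebesgue measure under linear isometries\<close>

lemma nn_integral_lborel_shift:
  fixes f :: "'a::euclidean_space \<Rightarrow> ennreal"
  assumes [measurable]: "f \<in> borel_measurable borel"
  shows "(\<integral>\<^sup>+x. f (c + x) \<partial>lborel) = (\<integral>\<^sup>+x. f x \<partial>lborel)"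
proof -
  have "(\<integral>\<^sup>+x. f x \<partial>lborel) = (\<integral>\<^sup>+x. f x \<partial>distr lborel borel ((+) c))"
    by (simp add: lborel_distr_plus)
  also have "\<dots> = (\<integral>\<^sup>+x. f (c + x) \<partial>lborel)" by (rule nn_integral_distr) auto
  finally show ?thesis ..
qed

lemma nn_integral_lborel_uminus:
  fixes f :: "'a::euclidean_space \<Rightarrow> ennreal"
  assumes [measurable]: "f \<in> borel_measurable borel"
  shows "(\<integral>\<^sup>+x. f (- x) \<partial>lborel) = (\<integral>\<^sup>+x. f x \<partial>lborel)"
proof -
  have "lborel = distr lborel borel (uminus :: 'a \<Rightarrow> 'a)"
    using lborel_affine[of "-1" "0::'a"] by (simp add: density_1)
  then have "(\<integral>\<^sup>+x. f x \<partial>lborel) = (\<integral>\<^sup>+x. f x \<partial>distr lborel borel uminus)" by simp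
  also have "\<dots> = (\<integral>\<^sup>+x. f (- x) \<partial>lborel)" by (rule nn_integral_distr) auto
  finally show ?thesis ..
qed

text \<open>The image measure is translation invariant. Evaluating the double integral of
  \<open>indicator A (w x) * indicator B (w x + y)\<close> in both orders shows that it is proportional to
  Lebesgue measure, and the factor is 1 because the unit ball is invariant.\<close>

lemma lborel_distr_linear_isometry:
  fixes w v :: "'a::euclidean_space \<Rightarrow> 'a"
  assumes w: "linear w" "\<And>x. norm (w x) = norm x" "\<And>x. w (v x) = x"
  shows "distr lborel borel w = lborel"
proof (rule measure_eqI)
  have cont: "continuous_on UNIV w" using w(1) by (simp add: linear_continuous_on linear_conv_bounded_linear)
  then have wm [measurable]: "w \<in> borel_measurable borel" by (rule borel_measurable_continuous_onI)
  define M where "M A = (\<integral>\<^sup>+x. indicator A (w x) \<partial>lborel)" for A :: "'a set"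
  \<comment> \<open>Translating the value of \<open>w\<close> by \<open>t\<close> amounts to
    translating its argument by \<open>v t\<close>.\<close>
  have shift: "(\<integral>\<^sup>+x. f (w x + t) \<partial>lborel) = (\<integral>\<^sup>+x. f (w x) \<partial>lborel)"
    if [measurable]: "f \<in> borel_measurable borel" for f :: "'a \<Rightarrow> ennreal" and t
  proof -
    have "(\<integral>\<^sup>+x. f (w (v t + x)) \<partial>lborel) = (\<integral>\<^sup>+x. f (w x) \<partial>lborel)"
      by (rule nn_integral_lborel_shift) measurable
    then show ?thesis by (simp add: linear_add[OF w(1)] w(3) add.commute)
  qed
  have proportional: "M A * emeasure lborel B = M B * emeasure lborel A"
    if [measurable]: "A \<in> sets borel" "B \<in> sets borel" for A B
  proof -
    have "M A * emeasure lborel B = (\<integral>\<^sup>+x. indicator A (w x) * (\<integral>\<^sup>+y. indicator B y \<partial>lborel) \<partial>lborel)"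
      by (simp add: M_def nn_integral_multc)
    also have "\<dots> = (\<integral>\<^sup>+x. (\<integral>\<^sup>+y. indicator A (w x) * indicator B (w x + y) \<partial>lborel) \<partial>lborel)"
    proof (rule nn_integral_cong)
      fix x
      have "(\<integral>\<^sup>+y. indicator B (w x + y) \<partial>lborel) = (\<integral>\<^sup>+y. indicator B y \<partial>lborel :: ennreal)"
        by (rule nn_integral_lborel_shift) measurable
      then show "indicator A (w x) * (\<integral>\<^sup>+y. indicator B y \<partial>lborel)
          = (\<integral>\<^sup>+y. indicator A (w x) * indicator B (w x + y) \<partial>lborel)"
        by (subst nn_integral_cmult) auto
    qed
    also have "\<dots> = (\<integral>\<^sup>+y. (\<integral>\<^sup>+x. indicator A (w x) * indicator B (w x + y) \<partial>lborel) \<partial>lborel)"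
      by (rule lborel_pair.Fubini'[symmetric]) measurable
    also have "\<dots> = (\<integral>\<^sup>+y. (\<integral>\<^sup>+x. indicator A (w x - y) * indicator B (w x) \<partial>lborel) \<partial>lborel)"
    proof (rule nn_integral_cong)
      fix y
      have "(\<integral>\<^sup>+x. indicator A (w x + (- y)) * indicator B ((w x + (- y)) + y) \<partial>lborel)
          = (\<integral>\<^sup>+x. indicator A (w x) * indicator B (w x + y) \<partial>lborel :: ennreal)"
        by (rule shift[of "\<lambda>z. indicator A z * indicator B (z + y)"]) measurable
      then show "(\<integral>\<^sup>+x. indicator A (w x) * indicator B (w x + y) \<partial>lborel)
          = (\<integral>\<^sup>+x. indicator A (w x - y) * indicator B (w x) \<partial>lborel :: ennreal)" by simp
    qed
    also have "\<dots> = (\<integral>\<^sup>+x. (\<integral>\<^sup>+y. indicator A (w x - y) * indicator B (w x) \<partial>lborel) \<partial>lborel)"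
      by (rule lborel_pair.Fubini'[symmetric]) measurable
    also have "\<dots> = (\<integral>\<^sup>+x. emeasure lborel A * indicator B (w x) \<partial>lborel)"
    proof (rule nn_integral_cong)
      fix x
      have "(\<integral>\<^sup>+y. indicator A (w x - y) \<partial>lborel) = (\<integral>\<^sup>+y. indicator A (w x + y) \<partial>lborel :: ennreal)"
        using nn_integral_lborel_uminus[of "\<lambda>y. indicator A (w x + y)"] by simp
      also have "\<dots> = emeasure lborel A"
        by (subst nn_integral_lborel_shift) simp_all
      finally show "(\<integral>\<^sup>+y. indicator A (w x - y) * indicator B (w x) \<partial>lborel)
          = emeasure lborel A * indicator B (w x)"
        by (subst nn_integral_multc) auto
    qed
    also have "\<dots> = M B * emeasure lborel A"
      by (simp add: M_def nn_integral_cmult mult.commute)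
    finally show ?thesis .
  qed
  fix A :: "'a set" assume "A \<in> sets (distr lborel borel w)"
  then have A [measurable]: "A \<in> sets borel" by simp
  let ?B = "ball 0 1 :: 'a set"
  have "emeasure (distr lborel borel w) A = M A"
    using nn_integral_distr[of w lborel borel "indicator A"] by (simp add: M_def)
  moreover have "M ?B = emeasure lborel ?B"
  proof -
    have "indicator ?B (w x) = (indicator ?B x :: ennreal)" for x by (simp add: indicator_def w(2))
    then show ?thesis by (simp add: M_def)
  qed
  moreover have "emeasure lborel ?B \<noteq> 0" "emeasure lborel ?B \<noteq> \<infinity>"
    using content_ball_pos[of 1 "0::'a"] emeasure_lborel_ball_finite[of "0::'a" 1]
    by (auto simp: measure_def)
  ultimately show "emeasure (distr lborel borel w) A = emeasure lborel A"
    using proportional[OF A, of ?B] by (simp add: ennreal_mult_cancel_left mult.commute[of _ "emeasure lborel ?B"])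
qed simp

section \<open>Integrals of exponentials over the fundamental simplex\<close>

definition expo :: "'a::euclidean_space \<Rightarrow> 'a \<Rightarrow> complex" where
  "expo u x = cis (2 * pi * (u \<bullet> x))"

lemma orbit_function_eq: "orbit_function \<Delta> v x = (\<Sum>u\<in>weyl_orbit \<Delta> v. expo u x)"
  unfolding orbit_function_def expo_def cis_conv_exp
  by (intro sum.cong refl arg_cong[of _ _ exp]) (simp add: algebra_simps)

lemma expo_add_left: "expo (u + v) x = expo u x * expo v x"
  by (simp add: expo_def cis_mult inner_add_left algebra_simps)

lemma expo_add_right: "expo u (x + y) = expo u x * expo u y"
  by (simp add: expo_def cis_mult inner_add_right algebra_simps)

lemma expo_zero [simp]: "expo 0 x = 1"
  by (simp add: expo_def)

lemma cnj_expo: "cnj (expo u x) = expo (- u) x"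
  by (simp add: expo_def cis_cnj)

lemma norm_expo [simp]: "norm (expo u x) = 1"
  by (simp add: expo_def)

lemma expo_eq_1_iff: "expo u x = 1 \<longleftrightarrow> u \<bullet> x \<in> \<int>"
proof
  assume "expo u x = 1"
  then have "cos (2 * pi * (u \<bullet> x)) = 1" by (simp add: expo_def complex_eq_iff)
  then obtain k :: int where "2 * pi * (u \<bullet> x) = of_int k * (2 * pi)"
    by (auto simp: cos_one_2pi_int)
  then have "u \<bullet> x = of_int k" by simp
  then show "u \<bullet> x \<in> \<int>" by simp
next
  assume "u \<bullet> x \<in> \<int>"
  then obtain k :: int where "u \<bullet> x = of_int k" by (auto elim: Ints_cases)
  then show "expo u x = 1"
    using cis_multiple_2pi[of "of_int k"] by (simp add: expo_def)
qed

lemma continuous_on_expo [continuous_intros]: "continuous_on S (expo u)"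
  unfolding expo_def cis_conv_exp by (intro continuous_intros)

lemma borel_measurable_expo [measurable]: "expo u \<in> borel_measurable borel"
  by (intro borel_measurable_continuous_onI continuous_on_expo)

lemma integral_lborel_shift:
  fixes f :: "'a::euclidean_space \<Rightarrow> 'b::{banach, second_countable_topology}"
  assumes [measurable]: "f \<in> borel_measurable borel"
  shows "(\<integral>x. f (c + x) \<partial>lborel) = (\<integral>x. f x \<partial>lborel)"
proof -
  have "(\<integral>x. f x \<partial>lborel) = (\<integral>x. f x \<partial>distr lborel borel ((+) c))"
    by (simp add: lborel_distr_plus)
  also have "\<dots> = (\<integral>x. f (c + x) \<partial>lborel)" by (rule integral_distr) auto
  finally show ?thesis ..
qed

lemma integrable_bounded_support:
  fixes f :: "'a::euclidean_space \<Rightarrow> 'b::{banach, second_countable_topology}"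
  assumes "f \<in> borel_measurable borel" "\<And>x. norm (f x) \<le> B" "\<And>x. f x \<noteq> 0 \<Longrightarrow> norm x \<le> r"
  shows "integrable lborel f"
proof (rule Bochner_Integration.integrable_bound)
  show "integrable lborel (\<lambda>x. indicator (cball 0 r) x *\<^sub>R B :: real)"
    using emeasure_lborel_cball_finite[of 0 r] by (intro integrable_scaleR_left integrable_real_indicator) auto
  show "f \<in> borel_measurable lborel" using assms(1) by simp
  show "AE x in lborel. norm (f x) \<le> norm (indicator (cball 0 r) x *\<^sub>R B)"
    using assms(2,3) by (intro always_eventually allI) (force simp: indicator_def intro: order_trans[OF _ abs_ge_self])
qed

context based_root_system
begin

section \<open>Geometry of the simplex and invariance of integrals under \<open>W\<close>\<close>

lemma open_F: "open F"
proof -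
  have "F = (\<Inter>a\<in>\<Delta>. {y. 0 < y \<bullet> a}) \<inter> {y. y \<bullet> \<xi> < 1}" by (auto simp: fundamental_simplex_def)
  also have "open \<dots>"
    by (intro open_Int open_INT finite_\<Delta> ballI open_Collect_less continuous_intros)
  finally show ?thesis .
qed

lemma F_borel [measurable]: "F \<in> sets borel"
  using open_F by simp

lemma F_nonempty: "F \<noteq> {}"
  using affine_chamber.chamber_nonempty by (simp add: open_chamber_affine)

text \<open>In the basis dual to \<Delta> the coordinates \<open>x \<bullet> a\<close> of a point of
  \<open>F\<close> lie between 0 and 1, since \<xi> dominates the simple roots.\<close>

lemma bounded_F: "bounded F"
proof -
  have "\<exists>v. \<forall>b\<in>\<Delta>. v \<bullet> b = (if b = a then 1 else 0)" for a
    using coweight[of "\<lambda>b. if b = a then 1 else 0"] by metis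
  then obtain v where v: "\<And>a b. b \<in> \<Delta> \<Longrightarrow> v a \<bullet> b = (if b = a then 1 else 0)" by metis
  have exp: "x = (\<Sum>a\<in>\<Delta>. (x \<bullet> a) *\<^sub>R v a)" for x
  proof (rule eq_of_inner_\<Delta>)
    fix b assume b: "b \<in> \<Delta>"
    have "(\<Sum>a\<in>\<Delta>. (x \<bullet> a) *\<^sub>R v a) \<bullet> b = (\<Sum>a\<in>\<Delta>. (x \<bullet> a) * (v a \<bullet> b))"
      by (simp add: inner_sum_left)
    also have "\<dots> = (\<Sum>a\<in>\<Delta>. if a = b then x \<bullet> a else 0)" by (intro sum.cong) (auto simp: v b)
    finally show "x \<bullet> b = (\<Sum>a\<in>\<Delta>. (x \<bullet> a) *\<^sub>R v a) \<bullet> b" using b finite_\<Delta> by simp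
  qed
  have "norm x \<le> (\<Sum>a\<in>\<Delta>. norm (v a))" if x: "x \<in> F" for x
  proof -
    have x': "\<And>a. a \<in> \<Delta> \<Longrightarrow> x \<bullet> a \<ge> 0" "x \<bullet> \<xi> < 1"
      using x by (auto simp: fundamental_simplex_def less_imp_le)
    have "\<bar>x \<bullet> a\<bar> \<le> 1" if "a \<in> \<Delta>" for a
      using inner_root_le_\<xi>[OF x'(1), of a] x' that subset_R by fastforce
    then have "norm (\<Sum>a\<in>\<Delta>. (x \<bullet> a) *\<^sub>R v a) \<le> (\<Sum>a\<in>\<Delta>. norm (v a))"
      by (intro sum_norm_le) (simp add: mult_left_le_one_le)
    then show ?thesis using exp[of x] by simp
  qed
  then show ?thesis by (auto simp: bounded_iff)
qed

lemma F_radius: "\<exists>r\<ge>0. \<forall>x\<in>F. norm x \<le> r"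
proof -
  obtain r where "\<And>x. x \<in> F \<Longrightarrow> norm x \<le> r" using bounded_F by (auto simp: bounded_iff)
  then show ?thesis by (intro exI[of _ "max r 0"]) force
qed

lemma W_measurable: "w \<in> W \<Longrightarrow> w \<in> borel_measurable borel"
  using W_linear by (intro borel_measurable_continuous_onI) (simp add: linear_continuous_on linear_conv_bounded_linear)

lemma lborel_distr_W:
  assumes "w \<in> W"
  shows "distr lborel borel w = lborel"
proof -
  obtain v where "\<forall>x. w (v x) = x" using W_inverse[OF assms] by blast
  then show ?thesis using lborel_distr_linear_isometry[of w v] W_linear W_norm assms by blast
qed

lemma integral_lborel_W:
  fixes f :: "'a \<Rightarrow> 'b::{banach, second_countable_topology}"
  assumes w: "w \<in> W" and [measurable]: "f \<in> borel_measurable borel"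
  shows "(\<integral>x. f (w x) \<partial>lborel) = (\<integral>x. f x \<partial>lborel)"
proof -
  have [measurable]: "w \<in> borel_measurable borel" by (rule W_measurable[OF w])
  have "(\<integral>x. f x \<partial>lborel) = (\<integral>x. f x \<partial>distr lborel borel w)" by (simp add: lborel_distr_W[OF w])
  also have "\<dots> = (\<integral>x. f (w x) \<partial>lborel)" by (rule integral_distr) measurable
  finally show ?thesis ..
qed

section \<open>Tiling by lattice translates up to null sets\<close>

lemma AE_regular: "AE x in lborel. \<forall>b\<in>R. x \<bullet> b \<notin> \<int>"
proof -
  have "AE x in lborel. x \<bullet> b \<noteq> of_int k" if b: "b \<in> R" for b k
  proof -
    have "negligible {x. b \<bullet> x = of_int k}" using b zero_R by (intro negligible_hyperplane) auto
    then have "AE x in lebesgue. x \<notin> {x. b \<bullet> x = of_int k}"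
      by (intro AE_not_in) (simp add: negligible_iff_null_sets)
    then show ?thesis by (simp add: AE_completion_iff inner_commute)
  qed
  then have "AE x in lborel. \<forall>b\<in>R. \<forall>k. x \<bullet> b \<noteq> of_int k"
    using finite_R by (simp add: AE_finite_all AE_all_countable)
  then show ?thesis by eventually_elim (auto elim!: Ints_cases)
qed

lemma root_weight: "b \<in> R \<Longrightarrow> b \<in> P"
  using cartan_integer subset_R by (auto simp: weight_lattice_def)

text \<open>Lying on no integral level of any root is invariant under the affine group, because
  \<open>W\<close> permutes \<open>R\<close> and roots, being weights, are integral on
  \<open>Q\<close>. The representative in the closed simplex therefore avoids every wall.\<close>

lemma regular_orbit_meets_F:
  assumes "\<forall>b\<in>R. x \<bullet> b \<notin> \<int>"
  obtains w q where "w \<in> W" "q \<in> Q" "w x + q \<in> F"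
proof -
  obtain w q where wq: "w \<in> W" "q \<in> Q" "w x + q \<in> closure F" by (rule affine_orbit_meets_closure_F)
  have nonint: "(w x + q) \<bullet> b \<notin> \<int>" if b: "b \<in> R" for b
  proof
    assume int: "(w x + q) \<bullet> b \<in> \<int>"
    obtain v where v: "v \<in> W" "\<forall>x. w (v x) = x" using W_inverse[OF wq(1)] by blast
    have "b \<bullet> q \<in> \<int>" using root_weight[OF b] wq(2) by (simp add: Q_def)
    then have "(w x + q) \<bullet> b - b \<bullet> q \<in> \<int>" using int by (rule Ints_diff[rotated])
    moreover have "w x \<bullet> b = x \<bullet> v b" using W_inner[OF wq(1), of x "v b"] v(2) by simp
    ultimately have "x \<bullet> v b \<in> \<int>" by (simp add: inner_add_left inner_commute[of q])
    then show False using assms W_root[OF v(1) b] by blast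
  qed
  have "w x + q \<in> F"
    unfolding fundamental_simplex_def
  proof (intro CollectI conjI ballI)
    fix a assume a: "a \<in> \<Delta>"
    then have "(w x + q) \<bullet> a \<noteq> 0" using nonint[of a] subset_R by (metis Ints_0 subsetD)
    then show "(w x + q) \<bullet> a > 0" using wq(3) a by (auto simp: closure_F_eq less_le)
  next
    have "(w x + q) \<bullet> \<xi> \<noteq> 1" using nonint[OF \<xi>_R] by (metis Ints_1)
    then show "(w x + q) \<bullet> \<xi> < 1" using wq(3) by (auto simp: closure_F_eq less_le)
  qed
  then show ?thesis using that wq by blast
qed

text \<open>The union of the images of \<open>F\<close> under \<open>W\<close>, encoded as a sum of
  indicators so that integrals split over \<open>W\<close>. Up to null sets it is a fundamental
  domain for \<open>Q\<close>.\<close>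

definition tile :: "'a \<Rightarrow> real" where
  "tile x = (\<Sum>w\<in>W. indicator F (w x))"

definition Q_ball :: "real \<Rightarrow> 'a set" where
  "Q_ball r = {q \<in> Q. norm q \<le> r}"

lemma finite_Q_ball: "finite (Q_ball r)"
  unfolding Q_ball_def by (rule finite_Q_bounded)

text \<open>Exactly one pair of a lattice vector and an element of \<open>W\<close> contributes. Its
  lattice vector has norm at most \<open>r + norm x\<close>, so a finite ball already captures the
  whole sum over \<open>Q\<close>.\<close>

lemma sum_translates_tile:
  assumes reg: "\<forall>b\<in>R. x \<bullet> b \<notin> \<int>" and r: "\<And>y. y \<in> F \<Longrightarrow> norm y \<le> r" and C: "r + norm x \<le> C"
  shows "(\<Sum>q\<in>Q_ball C. tile (x + q)) = 1"
proof -
  obtain w q where wq: "w \<in> W" "q \<in> Q" "w x + q \<in> F" by (rule regular_orbit_meets_F[OF reg])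
  obtain v where v: "v \<in> W" "\<forall>x. w (v x) = x" "\<forall>x. v (w x) = x" using W_inverse[OF wq(1)] by blast
  have "norm q = norm ((w x + q) - w x)" by simp
  also have "\<dots> \<le> r + norm x"
    using norm_triangle_ineq4[of "w x + q" "w x"] r[OF wq(3)] W_norm[OF wq(1), of x] by linarith
  \<comment> \<open>The lattice vector sought is \<open>v q\<close>, since \<open>w\<close> maps
    \<open>x + v q\<close> to \<open>w x + q\<close>, a point of \<open>F\<close>.\<close>
  finally have vq: "v q \<in> Q_ball C" using C v(1) wq(2) by (simp add: Q_ball_def W_norm W_Q)
  have ind: "indicator F (w' (x + q')) = (if (q', w') = (v q, w) then 1 else 0 :: real)"
    if "w' \<in> W" "q' \<in> Q_ball C" for w' q'
  proof -
    have q': "q' \<in> Q" using that by (simp add: Q_ball_def)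
    have eq: "w' (x + q') = w' x + w' q'" by (rule linear_add[OF W_linear[OF that(1)]])
    show ?thesis
    proof (cases "w' x + w' q' \<in> F")
      case True
      have "w = w'" "q = w' q'" using affine_group_inj[OF wq(1,2) that(1) W_Q[OF that(1) q'] wq(3) True] by auto
      then show ?thesis using True eq v by simp
    next
      case False
      then have "(q', w') \<noteq> (v q, w)" using wq v by auto
      then show ?thesis using False eq by auto
    qed
  qed
  have "(\<Sum>q'\<in>Q_ball C. tile (x + q')) = (\<Sum>(q', w')\<in>Q_ball C \<times> W. indicator F (w' (x + q')))"
    unfolding tile_def by (rule sum.cartesian_product)
  also have "\<dots> = (\<Sum>p\<in>Q_ball C \<times> W. if p = (v q, w) then 1 else 0)"
    by (intro sum.cong refl) (simp add: ind split_beta mem_Times_iff)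
  also have "\<dots> = 1"
    using finite_Q_ball finite_W vq wq(1) by (subst sum.delta) auto
  finally show ?thesis .
qed

lemma tile_measurable [measurable]: "tile \<in> borel_measurable borel"
proof -
  have "(\<lambda>x. indicator F (w x) :: real) \<in> borel_measurable borel" if "w \<in> W" for w
  proof -
    have [measurable]: "w \<in> borel_measurable borel" by (rule W_measurable[OF that])
    show ?thesis by measurable
  qed
  then show ?thesis unfolding tile_def[abs_def] by (rule borel_measurable_sum)
qed

lemma tile_nonneg: "0 \<le> tile x"
  unfolding tile_def by (intro sum_nonneg) simp

lemma tile_le: "tile x \<le> card W"
proof -
  have "tile x \<le> (\<Sum>w\<in>W. 1)" unfolding tile_def by (intro sum_mono) (simp add: indicator_def)
  then show ?thesis by simp
qed

lemma tile_support:
  assumes "\<And>y. y \<in> F \<Longrightarrow> norm y \<le> r" "tile x \<noteq> 0"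
  shows "norm x \<le> r"
proof -
  obtain w where "w \<in> W" "indicator F (w x) \<noteq> (0::real)"
    using assms(2) unfolding tile_def by (meson sum.neutral)
  then show ?thesis using assms(1)[of "w x"] W_norm by (auto simp: indicator_def split: if_splits)
qed

lemma integrable_tile:
  assumes [measurable]: "f \<in> borel_measurable borel" and "\<And>x. norm (f x) \<le> B"
  shows "integrable lborel (\<lambda>x. tile x *\<^sub>R (f x :: complex))"
proof -
  obtain r where r: "\<And>x. x \<in> F \<Longrightarrow> norm x \<le> r" "r \<ge> 0" using F_radius by blast
  show ?thesis
  proof (rule integrable_bounded_support)
    show "norm (tile x *\<^sub>R f x) \<le> card W * B" for x
      using tile_nonneg[of x] tile_le[of x] assms(2)[of x] by (auto intro!: mult_mono)
    show "norm x \<le> r" if "tile x *\<^sub>R f x \<noteq> 0" for x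
      using that tile_support[OF r(1)] by auto
  qed measurable
qed

lemma expo_Q:
  assumes "u \<in> P" "q \<in> Q"
  shows "expo u (x + q) = expo u x"
proof -
  have "expo u q = 1" using assms by (simp add: expo_eq_1_iff Q_def)
  then show ?thesis by (simp add: expo_add_right)
qed

text \<open>Insert the translates \<open>tile (x + v + q)\<close>, which sum to 1 on the support of
  \<open>tile\<close>, and shift the variable by \<open>v + q\<close> in each term. The character
  ignores \<open>q\<close> and yields the factor \<open>expo u (- v)\<close>, the two tiles exchange
  roles, and summing over \<open>q\<close> removes the inserted tile again.\<close>

lemma expo_tile_shift:
  assumes u: "u \<in> P"
  shows "(\<integral>x. tile x *\<^sub>R expo u x \<partial>lborel) = expo u v * (\<integral>x. tile x *\<^sub>R expo u x \<partial>lborel)"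
proof -
  obtain r where r: "\<And>x. x \<in> F \<Longrightarrow> norm x \<le> r" "r \<ge> 0" using F_radius by blast
  \<comment> \<open>The support of \<open>tile\<close> has radius \<open>r\<close>, the shift adds
    at most \<open>norm v\<close>, and the radius of the tile reached adds another
    \<open>r\<close>.\<close>
  let ?C = "2 * r + norm v"
  have part: "AE x in lborel. tile x *\<^sub>R f x = (\<Sum>q\<in>Q_ball ?C. (tile x * tile (x + t + q)) *\<^sub>R f x)"
    if t: "norm t \<le> norm v" for t and f :: "'a \<Rightarrow> complex"
  proof -
    have "AE x in lborel. \<forall>b\<in>R. (t + x) \<bullet> b \<notin> \<int>"
    proof -
      have "AE x in distr lborel borel ((+) t). \<forall>b\<in>R. x \<bullet> b \<notin> \<int>"
        unfolding lborel_distr_plus by (rule AE_regular)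
      then show ?thesis by (rule AE_distrD[rotated]) simp
    qed
    then show ?thesis
    proof eventually_elim
      case (elim x)
      show ?case
      proof (cases "tile x = 0")
        case False
        then have "norm x \<le> r" using tile_support[OF r(1)] by blast
        then have "r + norm (x + t) \<le> ?C" using norm_triangle_ineq[of x t] t by linarith
        then have "(\<Sum>q\<in>Q_ball ?C. tile (x + t + q)) = 1"
          using sum_translates_tile[of "x + t" r ?C] r(1) elim by (simp only: add.commute[of t])
        then show ?thesis by (simp flip: scaleR_sum_left sum_distrib_left)
      qed simp
    qed
  qed
  have int: "integrable lborel (\<lambda>x. (tile x * tile (x + s + t)) *\<^sub>R (expo u x))" for s t
  proof -
    have "integrable lborel (\<lambda>x. tile x *\<^sub>R (tile (x + s + t) *\<^sub>R expo u x))"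
      by (rule integrable_tile[where B = "card W"]) (use tile_nonneg tile_le in auto)
    then show ?thesis by simp
  qed
  have "(\<integral>x. tile x *\<^sub>R expo u x \<partial>lborel)
      = (\<integral>x. (\<Sum>q\<in>Q_ball ?C. (tile x * tile (x + v + q)) *\<^sub>R expo u x) \<partial>lborel)"
    by (rule integral_cong_AE) (use part[of v] in auto)
  also have "\<dots> = (\<Sum>q\<in>Q_ball ?C. \<integral>x. (tile x * tile (x + v + q)) *\<^sub>R expo u x \<partial>lborel)"
    by (rule Bochner_Integration.integral_sum) (rule int)
  also have "\<dots> = (\<Sum>q\<in>Q_ball ?C. \<integral>x. expo u (- v) * ((tile x * tile (x - v - q)) *\<^sub>R expo u x) \<partial>lborel)"
  proof (rule sum.cong[OF refl])
    fix q assume "q \<in> Q_ball ?C"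
    then have q: "q \<in> Q" by (simp add: Q_ball_def)
    let ?f = "\<lambda>x. (tile x * tile (x + v + q)) *\<^sub>R expo u x"
    have eq: "expo u (- (v + q) + x) = expo u (- v) * expo u x" for x
    proof -
      have "expo u (- (v + q) + x) = expo u ((x + (- v)) + (- q))" by (simp add: algebra_simps)
      also have "\<dots> = expo u (x + (- v))" by (rule expo_Q[OF u Q_uminus[OF q]])
      also have "\<dots> = expo u x * expo u (- v)" by (rule expo_add_right)
      finally show ?thesis by (simp only: mult.commute)
    qed
    have "(\<integral>x. ?f x \<partial>lborel) = (\<integral>x. ?f (- (v + q) + x) \<partial>lborel)"
      by (rule integral_lborel_shift[symmetric]) measurable
    also have "\<dots> = (\<integral>x. expo u (- v) * ((tile x * tile (x - v - q)) *\<^sub>R expo u x) \<partial>lborel)"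
      unfolding eq by (intro Bochner_Integration.integral_cong refl) (simp add: algebra_simps)
    finally show "(\<integral>x. ?f x \<partial>lborel) = (\<integral>x. expo u (- v) * ((tile x * tile (x - v - q)) *\<^sub>R expo u x) \<partial>lborel)" .
  qed
  also have "\<dots> = (\<Sum>q\<in>Q_ball ?C. expo u (- v) * (\<integral>x. (tile x * tile (x - v - q)) *\<^sub>R expo u x \<partial>lborel))"
    by (intro sum.cong refl integral_mult_right_zero)
  \<comment> \<open>Replacing \<open>q\<close> by \<open>- q\<close> restores the shape of
    \<open>part\<close>, now for the shift \<open>- v\<close>.\<close>
  also have "\<dots> = (\<Sum>q\<in>Q_ball ?C. expo u (- v) * (\<integral>x. (tile x * tile (x + - v + q)) *\<^sub>R expo u x \<partial>lborel))"
    by (rule sum.reindex_bij_witness[of _ uminus uminus]) (auto simp: Q_ball_def Q_uminus)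
  also have "\<dots> = expo u (- v) * (\<integral>x. (\<Sum>q\<in>Q_ball ?C. (tile x * tile (x + - v + q)) *\<^sub>R expo u x) \<partial>lborel)"
    by (subst Bochner_Integration.integral_sum, rule int, simp add: sum_distrib_left)
  also have "(\<integral>x. (\<Sum>q\<in>Q_ball ?C. (tile x * tile (x + - v + q)) *\<^sub>R expo u x) \<partial>lborel)
      = (\<integral>x. tile x *\<^sub>R expo u x \<partial>lborel)"
    by (rule sym, rule integral_cong_AE[OF _ _ part]) simp_all
  finally have *: "(\<integral>x. tile x *\<^sub>R expo u x \<partial>lborel) = expo u (- v) * (\<integral>x. tile x *\<^sub>R expo u x \<partial>lborel)" .
  have "expo u v * expo u (- v) = 1" by (simp flip: expo_add_right) (simp add: expo_def)
  then show ?thesis by (subst *) (simp flip: mult.assoc add: mult.commute[of "expo u (- v)"])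
qed

text \<open>The vector \<open>?v\<close> is scaled so that its product with \<open>u\<close> is 1/2;
  the character takes the value -1 there, and the integral equals its negative.\<close>

lemma integral_tile_expo:
  assumes "u \<in> P" "u \<noteq> 0"
  shows "(\<integral>x. tile x *\<^sub>R expo u x \<partial>lborel) = 0"
proof -
  let ?v = "(1 / (2 * (u \<bullet> u))) *\<^sub>R u"
  have "u \<bullet> ?v = 1 / 2" using assms by simp
  then have "expo u ?v = cis (2 * pi * (1 / 2))" by (simp only: expo_def)
  then have "expo u ?v = -1" by simp
  then show ?thesis using expo_tile_shift[OF assms(1), of ?v] by simp
qed

text \<open>Every summand of \<open>tile\<close> contributes the same amount, since \<open>W\<close>
  preserves both Lebesgue measure and \<open>f\<close>.\<close>

lemma integral_tile_invariant:
  fixes f :: "'a \<Rightarrow> complex"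
  assumes f [measurable]: "f \<in> borel_measurable borel" and bound: "\<And>x. norm (f x) \<le> B"
    and inv: "\<And>w x. w \<in> W \<Longrightarrow> f (w x) = f x"
  shows "(\<integral>x. tile x *\<^sub>R f x \<partial>lborel) = of_nat (card W) * (\<integral>x. indicator F x *\<^sub>R f x \<partial>lborel)"
proof -
  obtain r where r: "\<And>x. x \<in> F \<Longrightarrow> norm x \<le> r" "r \<ge> 0" using F_radius by blast
  have B: "B \<ge> 0" using bound[of 0] norm_ge_zero order_trans by blast
  have int: "integrable lborel (\<lambda>x. indicator F (w x) *\<^sub>R f x)" if w: "w \<in> W" for w
  proof (rule integrable_bounded_support[where B = B and r = r])
    have [measurable]: "w \<in> borel_measurable borel" by (rule W_measurable[OF w])
    show "(\<lambda>x. indicator F (w x) *\<^sub>R f x) \<in> borel_measurable borel" by measurable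
    show "norm (indicator F (w x) *\<^sub>R f x) \<le> B" for x using bound[of x] B by (simp add: indicator_def)
    show "norm x \<le> r" if "indicator F (w x) *\<^sub>R f x \<noteq> 0" for x
      using that r(1)[of "w x"] W_norm[OF w] by (auto simp: indicator_def split: if_splits)
  qed
  have "(\<integral>x. tile x *\<^sub>R f x \<partial>lborel) = (\<integral>x. (\<Sum>w\<in>W. indicator F (w x) *\<^sub>R f x) \<partial>lborel)"
    by (simp add: tile_def scaleR_sum_left)
  also have "\<dots> = (\<Sum>w\<in>W. \<integral>x. indicator F (w x) *\<^sub>R f x \<partial>lborel)"
    by (intro Bochner_Integration.integral_sum int)
  also have "\<dots> = (\<Sum>w\<in>W. \<integral>x. indicator F x *\<^sub>R f x \<partial>lborel)"
  proof (rule sum.cong[OF refl])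
    fix w assume w: "w \<in> W"
    have "(\<integral>x. indicator F (w x) *\<^sub>R f x \<partial>lborel) = (\<integral>x. indicator F (w x) *\<^sub>R f (w x) \<partial>lborel)"
      by (simp add: inv[OF w])
    also have "\<dots> = (\<integral>x. indicator F x *\<^sub>R f x \<partial>lborel)"
      by (rule integral_lborel_W[OF w]) measurable
    finally show "(\<integral>x. indicator F (w x) *\<^sub>R f x \<partial>lborel) = (\<integral>x. indicator F x *\<^sub>R f x \<partial>lborel)" .
  qed
  finally show ?thesis by simp
qed

section \<open>Integration over the closed simplex\<close>

lemma convex_F: "convex F"
proof -
  have "F = (\<Inter>a\<in>\<Delta>. {y. a \<bullet> y > 0}) \<inter> {y. \<xi> \<bullet> y < 1}"
    by (auto simp: fundamental_simplex_def inner_commute)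
  also have "convex \<dots>"
    by (intro convex_Int convex_INT convex_halfspace_gt convex_halfspace_lt)
  finally show ?thesis .
qed

lemma AE_closure_F: "AE x in lborel. x \<in> closure F \<longleftrightarrow> x \<in> F"
proof -
  have "AE x in lebesgue. x \<notin> frontier F"
    using negligible_convex_frontier[OF convex_F] by (intro AE_not_in) (simp add: negligible_iff_null_sets)
  then have "AE x in lborel. x \<notin> frontier F" by (simp add: AE_completion_iff)
  then show ?thesis
    by eventually_elim (use closure_subset[of F] in \<open>auto simp: frontier_def interior_open[OF open_F]\<close>)
qed

lemma integral_closure_F:
  fixes f :: "'a \<Rightarrow> 'b::{banach, second_countable_topology}"
  assumes [measurable]: "f \<in> borel_measurable borel"
  shows "(LINT x|lebesgue_on (closure F). f x) = (\<integral>x. indicator F x *\<^sub>R f x \<partial>lborel)"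
proof -
  have [measurable]: "closure F \<in> sets borel" by simp
  have "(LINT x|lebesgue_on (closure F). f x) = (\<integral>x. indicator (closure F) x *\<^sub>R f x \<partial>lebesgue)"
    by (rule integral_restrict_space) simp
  also have "\<dots> = (\<integral>x. indicator (closure F) x *\<^sub>R f x \<partial>lborel)"
    by (rule integral_completion) measurable
  also have "\<dots> = (\<integral>x. indicator F x *\<^sub>R f x \<partial>lborel)"
    by (rule integral_cong_AE) (use AE_closure_F in \<open>auto elim!: AE_mp simp: indicator_def\<close>)
  finally show ?thesis .
qed

lemma closure_F_lmeasurable: "closure F \<in> lmeasurable"
  using bounded_F by (intro lmeasurable_compact) (simp add: compact_closure)

lemma measure_closure_F: "measure lebesgue (closure F) > 0"
proof -
  have "\<not> negligible F" using open_F F_nonempty open_not_negligible by blast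
  then have "\<not> negligible (closure F)" using negligible_subset[OF _ closure_subset[of F]] by blast
  then have "measure lebesgue (closure F) \<noteq> 0"
    using closure_F_lmeasurable negligible_iff_measure by blast
  then show ?thesis using measure_nonneg[of lebesgue "closure F"] by linarith
qed

section \<open>Weyl orbits and orthogonality of the orbit functions\<close>

lemma finite_orbit: "finite (weyl_orbit \<Delta> v)"
  using finite_W by (simp add: weyl_orbit_def)

lemma orbit_self: "v \<in> weyl_orbit \<Delta> v"
  unfolding weyl_orbit_def by (rule image_eqI[OF _ W_id]) simp

lemma card_orbit_pos: "card (weyl_orbit \<Delta> v) > 0"
  using finite_orbit orbit_self by (auto simp: card_gt_0_iff)

lemma orbit_weight: "v \<in> P \<Longrightarrow> u \<in> weyl_orbit \<Delta> v \<Longrightarrow> u \<in> P"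
  using W_weight by (auto simp: weyl_orbit_def)

lemma W_orbit: "w \<in> W \<Longrightarrow> u \<in> weyl_orbit \<Delta> v \<Longrightarrow> w u \<in> weyl_orbit \<Delta> v"
proof -
  assume w: "w \<in> W" and "u \<in> weyl_orbit \<Delta> v"
  then obtain w' where w': "w' \<in> W" "u = w' v" by (auto simp: weyl_orbit_def)
  show "w u \<in> weyl_orbit \<Delta> v"
    unfolding weyl_orbit_def by (rule image_eqI[OF _ W_comp[OF w w'(1)]]) (simp add: w')
qed

lemma orbit_sym:
  assumes "u \<in> weyl_orbit \<Delta> v"
  shows "v \<in> weyl_orbit \<Delta> u"
proof -
  obtain w where w: "w \<in> W" "u = w v" using assms by (auto simp: weyl_orbit_def)
  obtain w' where "w' \<in> W" "\<forall>x. w' (w x) = x" using W_inverse[OF w(1)] by blast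
  then show ?thesis using w by (auto simp: weyl_orbit_def intro!: image_eqI[of _ _ w'])
qed

lemma orbit_eq:
  assumes "u \<in> weyl_orbit \<Delta> v"
  shows "weyl_orbit \<Delta> u = weyl_orbit \<Delta> v"
proof -
  have sub: "weyl_orbit \<Delta> u \<subseteq> weyl_orbit \<Delta> v" if "u \<in> weyl_orbit \<Delta> v" for u v
  proof
    fix y assume "y \<in> weyl_orbit \<Delta> u"
    then obtain w where "w \<in> W" "y = w u" by (auto simp: weyl_orbit_def)
    then show "y \<in> weyl_orbit \<Delta> v" using W_orbit that by blast
  qed
  show ?thesis using sub[OF assms] sub[OF orbit_sym[OF assms]] by (rule equalityI)
qed

lemma dominant_orbits_disjoint:
  assumes "u \<in> dominant_weights \<Delta>" "v \<in> dominant_weights \<Delta>" "u \<noteq> v"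
  shows "weyl_orbit \<Delta> u \<inter> weyl_orbit \<Delta> v = {}"
proof (rule ccontr)
  assume "\<not> ?thesis"
  then obtain y where "y \<in> weyl_orbit \<Delta> u" "y \<in> weyl_orbit \<Delta> v" by blast
  then have "u \<in> weyl_orbit \<Delta> v" using orbit_eq orbit_self by metis
  then obtain w where "w \<in> W" "u = w v" by (auto simp: weyl_orbit_def)
  then have "u = v" using dominant_unique[of w v] assms by (simp add: dominant_weights_def)
  then show False using assms by simp
qed

lemma expo_W:
  assumes "w \<in> W"
  shows "expo (w u) (w x) = expo u x"
  by (simp add: expo_def W_inner[OF assms])

lemma orbit_function_invariant:
  assumes "w \<in> W"
  shows "orbit_function \<Delta> v (w x) = orbit_function \<Delta> v x"
proof -
  obtain w' where w': "w' \<in> W" "\<forall>x. w (w' x) = x" "\<forall>x. w' (w x) = x" using W_inverse[OF assms] by blast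
  have "(\<Sum>u\<in>weyl_orbit \<Delta> v. expo u x) = (\<Sum>u\<in>weyl_orbit \<Delta> v. expo u (w x))"
    by (rule sum.reindex_bij_witness[of _ w' w]) (use assms w' W_orbit expo_W in auto)
  then show ?thesis by (simp add: orbit_function_eq)
qed

lemma continuous_on_orbit_function [continuous_intros]: "continuous_on S (orbit_function \<Delta> v)"
  unfolding orbit_function_eq[abs_def] by (intro continuous_intros)

lemma borel_measurable_orbit_function [measurable]: "orbit_function \<Delta> v \<in> borel_measurable borel"
  by (intro borel_measurable_continuous_onI continuous_on_orbit_function)

lemma norm_orbit_function: "norm (orbit_function \<Delta> v x) \<le> card (weyl_orbit \<Delta> v)"
  unfolding orbit_function_eq by (rule order_trans[OF norm_sum]) simp

lemma P_diff: "u \<in> P \<Longrightarrow> v \<in> P \<Longrightarrow> u - v \<in> P"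
  and P_add: "u \<in> P \<Longrightarrow> v \<in> P \<Longrightarrow> u + v \<in> P"
  and P_uminus: "u \<in> P \<Longrightarrow> - u \<in> P"
  and P_zero: "0 \<in> P"
  by (auto simp: weight_lattice_def inner_diff_left inner_add_left)

text \<open>Invariance of the integrand trades the simplex for the whole tile at the cost of a
  factor \<open>card W\<close>. There the product expands into exponentials with frequencies
  \<open>a - b\<close>, of which only the pairs \<open>a = b\<close> survive. Distinct dominant
  weights have disjoint orbits; for \<open>u = v\<close> the diagonal has
  \<open>card (weyl_orbit \<Delta> u)\<close> pairs.\<close>

theorem orbit_function_orthogonality:
  assumes u: "u \<in> dominant_weights \<Delta>" and v: "v \<in> dominant_weights \<Delta>"
  shows "L2_inner (closure F) (orbit_function \<Delta> u) (orbit_function \<Delta> v)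
    = (if u = v then of_nat (card (weyl_orbit \<Delta> u)) else 0)"
proof -
  let ?A = "weyl_orbit \<Delta> u" and ?B = "weyl_orbit \<Delta> v"
  let ?I = "\<lambda>f :: 'a \<Rightarrow> complex. \<integral>x. tile x *\<^sub>R f x \<partial>lborel"
  let ?m = "complex_of_real (measure lebesgue (closure F))"
  have uP: "u \<in> P" and vP: "v \<in> P" using u v by (auto simp: dominant_weights_def)
  \<comment> \<open>The measure of the tile, obtained from the same invariance; its factor
    \<open>card W\<close> cancels at the end.\<close>
  have one: "?I (\<lambda>x. 1) = of_nat (card W) * ?m"
  proof -
    have "?I (\<lambda>x. 1) = of_nat (card W) * (\<integral>x. indicator F x *\<^sub>R 1 \<partial>lborel)"
      by (rule integral_tile_invariant[where B = 1]) simp_all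
    also have "(\<integral>x. indicator F x *\<^sub>R (1::complex) \<partial>lborel) = (LINT x|lebesgue_on (closure F). 1)"
      by (rule integral_closure_F[symmetric]) simp
    also have "\<dots> = ?m"
      using closure_F_lmeasurable
      by (simp add: measure_restrict_space fmeasurableD scaleR_conv_of_real)
    finally show ?thesis .
  qed
  define \<psi> where "\<psi> x = orbit_function \<Delta> u x * cnj (orbit_function \<Delta> v x)" for x
  have [measurable]: "\<psi> \<in> borel_measurable borel" unfolding \<psi>_def[abs_def]
    by (intro borel_measurable_continuous_onI continuous_intros)
  have \<psi>: "\<psi> x = (\<Sum>(a, b)\<in>?A \<times> ?B. expo (a - b) x)" for x
  proof -
    have "\<psi> x = (\<Sum>a\<in>?A. \<Sum>b\<in>?B. expo a x * cnj (expo b x))"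
      by (simp add: \<psi>_def orbit_function_eq sum_product)
    then show ?thesis by (simp add: sum.cartesian_product cnj_expo flip: expo_add_left)
  qed
  have "of_nat (card W) * (LINT x|lebesgue_on (closure F). \<psi> x) = ?I \<psi>"
  proof -
    have "?I \<psi> = of_nat (card W) * (\<integral>x. indicator F x *\<^sub>R \<psi> x \<partial>lborel)"
    proof (rule integral_tile_invariant)
      show "norm (\<psi> x) \<le> real (card ?A) * real (card ?B)" for x
        unfolding \<psi>_def using norm_orbit_function[of u x] norm_orbit_function[of v x]
        by (auto simp: norm_mult intro!: mult_mono)
      show "\<psi> (w x) = \<psi> x" if "w \<in> W" for w x by (simp add: \<psi>_def orbit_function_invariant that)
    qed measurable
    then show ?thesis by (simp add: integral_closure_F)
  qed
  also have "?I \<psi> = (\<integral>x. (\<Sum>p\<in>?A \<times> ?B. tile x *\<^sub>R expo (fst p - snd p) x) \<partial>lborel)"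
    unfolding \<psi> by (simp add: scaleR_sum_right split_beta)
  also have "\<dots> = (\<Sum>p\<in>?A \<times> ?B. ?I (expo (fst p - snd p)))"
    by (intro Bochner_Integration.integral_sum integrable_tile[where B = 1]) auto
  also have "\<dots> = (\<Sum>p\<in>?A \<times> ?B. if fst p = snd p then of_nat (card W) * ?m else 0)"
  proof (rule sum.cong[OF refl])
    fix p assume p: "p \<in> ?A \<times> ?B"
    then have "fst p - snd p \<in> P" using orbit_weight uP vP P_diff by (metis mem_Times_iff)
    then show "?I (expo (fst p - snd p)) = (if fst p = snd p then of_nat (card W) * ?m else 0)"
      using integral_tile_expo one by auto
  qed
  also have "\<dots> = (\<Sum>a\<in>?A. \<Sum>b\<in>?B. if a = b then of_nat (card W) * ?m else 0)"
    by (simp add: sum.cartesian_product split_beta)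
  also have "\<dots> = (\<Sum>a\<in>?A. if a \<in> ?B then of_nat (card W) * ?m else 0)"
    by (intro sum.cong refl) (simp add: finite_orbit)
  also have "\<dots> = of_nat (card W) * (?m * (if u = v then of_nat (card ?A) else 0))"
  proof (cases "u = v")
    case False
    then show ?thesis using dominant_orbits_disjoint[OF u v] by (auto intro!: sum.neutral)
  qed simp
  finally have "(LINT x|lebesgue_on (closure F). \<psi> x) = ?m * (if u = v then of_nat (card ?A) else 0)"
    using card_W_pos by simp
  then show ?thesis
    using measure_closure_F unfolding L2_inner_def \<psi>_def by simp
qed

end

section \<open>Square-integrable functions\<close>

text \<open>The unnormalised squared norm. Approximation arguments run on it, with the crude bound
  of \<open>L2_add\<close> in place of a triangle inequality for \<open>L2_norm\<close>.\<close>

definition L2_sq :: "'a::euclidean_space set \<Rightarrow> ('a \<Rightarrow> complex) \<Rightarrow> real" where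
  "L2_sq S f = (LINT x|lebesgue_on S. (cmod (f x))\<^sup>2)"

lemma L2_sq_nonneg: "L2_sq S f \<ge> 0"
  by (simp add: L2_sq_def integral_nonneg_AE)

lemma L2_inner_self: "L2_inner S f f = of_real (inverse (measure lebesgue S) * L2_sq S f)"
proof -
  have "(LINT x|lebesgue_on S. f x * cnj (f x)) = (LINT x|lebesgue_on S. complex_of_real ((cmod (f x))\<^sup>2))"
    by (simp only: complex_norm_square)
  also have "\<dots> = of_real (L2_sq S f)" unfolding L2_sq_def by (rule integral_complex_of_real)
  finally show ?thesis by (simp add: L2_inner_def)
qed

lemma L2_norm_eq: "L2_norm S f = sqrt (inverse (measure lebesgue S) * L2_sq S f)"
  unfolding L2_norm_def L2_inner_self Re_complex_of_real ..

lemma L2_norm_power2: "(L2_norm S f)\<^sup>2 = inverse (measure lebesgue S) * L2_sq S f"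
  unfolding L2_norm_eq by (simp add: L2_sq_nonneg)

lemma L2_norm_nonneg: "L2_norm S f \<ge> 0"
  unfolding L2_norm_eq by (simp add: L2_sq_nonneg)

lemma L2_functionsD [measurable_dest]:
  "f \<in> L2_functions S \<Longrightarrow> f \<in> borel_measurable (lebesgue_on S)"
  by (simp add: L2_functions_def)

lemma norm_add_sq_le:
  fixes a b :: "'a::real_normed_vector"
  shows "(norm (a + b))\<^sup>2 \<le> 2 * (norm a)\<^sup>2 + 2 * (norm b)\<^sup>2"
proof -
  have "(norm (a + b))\<^sup>2 \<le> (norm a + norm b)\<^sup>2"
    by (intro power_mono norm_triangle_ineq) simp
  also have "\<dots> \<le> 2 * (norm a)\<^sup>2 + 2 * (norm b)\<^sup>2"
    using sum_squares_bound[of "norm a" "norm b"] by (simp add: power2_sum)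
  finally show ?thesis .
qed

lemma L2_add:
  assumes "f \<in> L2_functions S" "g \<in> L2_functions S"
  shows "(\<lambda>x. f x + g x) \<in> L2_functions S" "L2_sq S (\<lambda>x. f x + g x) \<le> 2 * L2_sq S f + 2 * L2_sq S g"
proof -
  have [measurable]: "f \<in> borel_measurable (lebesgue_on S)" "g \<in> borel_measurable (lebesgue_on S)"
    and int: "integrable (lebesgue_on S) (\<lambda>x. (cmod (f x))\<^sup>2)" "integrable (lebesgue_on S) (\<lambda>x. (cmod (g x))\<^sup>2)"
    using assms by (auto simp: L2_functions_def)
  have int2: "integrable (lebesgue_on S) (\<lambda>x. 2 * (cmod (f x))\<^sup>2 + 2 * (cmod (g x))\<^sup>2)"
    using int by simp
  have fg: "integrable (lebesgue_on S) (\<lambda>x. (cmod (f x + g x))\<^sup>2)"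
  proof (rule Bochner_Integration.integrable_bound[OF int2])
    show "(\<lambda>x. (cmod (f x + g x))\<^sup>2) \<in> borel_measurable (lebesgue_on S)" by measurable
    show "AE x in lebesgue_on S. norm ((cmod (f x + g x))\<^sup>2) \<le> norm (2 * (cmod (f x))\<^sup>2 + 2 * (cmod (g x))\<^sup>2)"
      using norm_add_sq_le by (intro always_eventually allI) auto
  qed
  then show "(\<lambda>x. f x + g x) \<in> L2_functions S" by (simp add: L2_functions_def)
  have "L2_sq S (\<lambda>x. f x + g x) \<le> (LINT x|lebesgue_on S. 2 * (cmod (f x))\<^sup>2 + 2 * (cmod (g x))\<^sup>2)"
    unfolding L2_sq_def using fg int2 norm_add_sq_le by (rule integral_mono)
  then show "L2_sq S (\<lambda>x. f x + g x) \<le> 2 * L2_sq S f + 2 * L2_sq S g"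
    using int by (simp add: L2_sq_def)
qed

lemma L2_cmult: "f \<in> L2_functions S \<Longrightarrow> (\<lambda>x. c * f x) \<in> L2_functions S"
  by (auto simp: L2_functions_def norm_mult power_mult_distrib)

lemma L2_diff: "f \<in> L2_functions S \<Longrightarrow> g \<in> L2_functions S \<Longrightarrow> (\<lambda>x. f x - g x) \<in> L2_functions S"
  using L2_add(1)[of f S "\<lambda>x. (-1) * g x"] L2_cmult[of g S "-1"] by simp

lemma L2_zero: "(\<lambda>x. 0) \<in> L2_functions S"
  by (simp add: L2_functions_def)

lemma L2_sum:
  assumes "finite J" "\<And>j. j \<in> J \<Longrightarrow> f j \<in> L2_functions S"
  shows "(\<lambda>x. \<Sum>j\<in>J. f j x) \<in> L2_functions S"
  using assms by (induction J) (auto intro: L2_add L2_zero)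

lemma L2_bounded:
  assumes "f \<in> borel_measurable (lebesgue_on S)" "S \<in> lmeasurable" "\<And>x. x \<in> S \<Longrightarrow> cmod (f x) \<le> B"
  shows "f \<in> L2_functions S" "L2_sq S f \<le> B\<^sup>2 * measure lebesgue S"
proof -
  have S: "S \<in> sets lebesgue" using assms(2) by (rule fmeasurableD)
  have int: "integrable (lebesgue_on S) (\<lambda>x. B\<^sup>2)"
    by (rule finite_measure.integrable_const[OF finite_measure_lebesgue_on[OF assms(2)]])
  have le: "(cmod (f x))\<^sup>2 \<le> B\<^sup>2" if "x \<in> space (lebesgue_on S)" for x
    using that assms(3) by (auto intro!: power_mono)
  have fi: "integrable (lebesgue_on S) (\<lambda>x. (cmod (f x))\<^sup>2)"
  proof (rule Bochner_Integration.integrable_bound[OF int])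
    show "(\<lambda>x. (cmod (f x))\<^sup>2) \<in> borel_measurable (lebesgue_on S)" using assms(1) by measurable
  qed (use le in \<open>auto intro!: AE_I2\<close>)
  then show "f \<in> L2_functions S" using assms(1) by (simp add: L2_functions_def)
  have "L2_sq S f \<le> (LINT x|lebesgue_on S. B\<^sup>2)"
    unfolding L2_sq_def by (rule integral_mono[OF fi int le])
  then show "L2_sq S f \<le> B\<^sup>2 * measure lebesgue S"
    using S by (simp add: measure_restrict_space mult.commute)
qed

lemma L2_integrable_product:
  assumes "f \<in> L2_functions S" "g \<in> L2_functions S"
  shows "integrable (lebesgue_on S) (\<lambda>x. f x * cnj (g x))"
proof -
  have [measurable]: "f \<in> borel_measurable (lebesgue_on S)" "g \<in> borel_measurable (lebesgue_on S)"
    and int: "integrable (lebesgue_on S) (\<lambda>x. (cmod (f x))\<^sup>2 + (cmod (g x))\<^sup>2)"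
    using assms by (auto simp: L2_functions_def)
  have [measurable]: "(\<lambda>x. cnj (g x)) \<in> borel_measurable (lebesgue_on S)"
    by (rule measurable_compose[OF _ borel_measurable_continuous_onI[of cnj]]) (auto intro: continuous_intros)
  show ?thesis
  proof (rule Bochner_Integration.integrable_bound[OF int])
    have "cmod (f x * cnj (g x)) \<le> (cmod (f x))\<^sup>2 + (cmod (g x))\<^sup>2" for x
    proof -
      have "0 \<le> cmod (f x) * cmod (g x)" by simp
      then show ?thesis
        using sum_squares_bound[of "cmod (f x)" "cmod (g x)"]
        unfolding norm_mult complex_mod_cnj mult.assoc by linarith
    qed
    then show "AE x in lebesgue_on S. cmod (f x * cnj (g x)) \<le> norm ((cmod (f x))\<^sup>2 + (cmod (g x))\<^sup>2)"
      by (intro always_eventually allI) auto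
  qed measurable
qed

lemma L2_inner_add:
  assumes "f \<in> L2_functions S" "g \<in> L2_functions S" "h \<in> L2_functions S"
  shows "L2_inner S (\<lambda>x. f x + g x) h = L2_inner S f h + L2_inner S g h"
proof -
  have "(LINT x|lebesgue_on S. f x * cnj (h x) + g x * cnj (h x))
      = (LINT x|lebesgue_on S. f x * cnj (h x)) + (LINT x|lebesgue_on S. g x * cnj (h x))"
    by (intro Bochner_Integration.integral_add L2_integrable_product assms)
  then show ?thesis by (simp add: L2_inner_def distrib_right distrib_left)
qed

lemma L2_inner_cmult: "L2_inner S (\<lambda>x. c * f x) h = c * L2_inner S f h"
  by (simp add: L2_inner_def mult.assoc)

lemma L2_inner_cnj: "cnj (L2_inner S f g) = L2_inner S g f"
proof -
  have "cnj (LINT x|lebesgue_on S. f x * cnj (g x)) = (LINT x|lebesgue_on S. cnj (f x * cnj (g x)))"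
    using Bochner_Integration.integral_cnj[of "lebesgue_on S" "\<lambda>x. f x * cnj (g x)"] by (simp only:)
  then show ?thesis by (simp add: L2_inner_def mult.commute)
qed

lemma L2_inner_sum:
  assumes "finite J" "\<And>j. j \<in> J \<Longrightarrow> f j \<in> L2_functions S" "h \<in> L2_functions S"
  shows "L2_inner S (\<lambda>x. \<Sum>j\<in>J. f j x) h = (\<Sum>j\<in>J. L2_inner S (f j) h)"
  using assms
proof (induction J)
  case empty
  then show ?case by (simp add: L2_inner_def)
next
  case (insert j J)
  then show ?case by (simp add: L2_inner_add L2_sum)
qed

subsection \<open>Continuous functions are dense\<close>

text \<open>For positive \<open>k\<close> this is the radial retraction of the plane onto the disc
  of radius \<open>k\<close>. It supplies the domination that pointwise approximation by continuous
  functions lacks.\<close>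

definition clamp_norm :: "nat \<Rightarrow> complex \<Rightarrow> complex" where
  "clamp_norm k z = (real k / max (real k) (cmod z)) *\<^sub>R z"

lemma clamp_norm_le: "cmod (clamp_norm k z) \<le> k"
proof (cases "k = 0 \<and> z = 0")
  case False
  then have "max (real k) (cmod z) > 0" by (auto simp: less_max_iff_disj)
  then show ?thesis by (simp add: clamp_norm_def field_simps mult_left_mono)
qed (simp add: clamp_norm_def)

lemma clamp_norm_eq: "cmod z \<le> k \<Longrightarrow> clamp_norm k z = z"
  by (cases "k = 0") (auto simp: clamp_norm_def)

lemma clamp_norm_diff_le: "cmod (z - clamp_norm k z) \<le> cmod z"
proof -
  let ?c = "real k / max (real k) (cmod z)"
  have c: "0 \<le> ?c" "?c \<le> 1" by (auto simp: field_simps le_max_iff_disj divide_le_eq_1 less_max_iff_disj)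
  have "z - clamp_norm k z = (1 - ?c) *\<^sub>R z" by (simp add: clamp_norm_def algebra_simps)
  then have "cmod (z - clamp_norm k z) = \<bar>1 - ?c\<bar> * cmod z" by simp
  also have "\<dots> \<le> 1 * cmod z" using c by (intro mult_right_mono) auto
  finally show ?thesis by simp
qed

lemma continuous_on_clamp_norm:
  assumes "k > 0" "continuous_on S f"
  shows "continuous_on S (\<lambda>x. clamp_norm k (f x))"
  unfolding clamp_norm_def using assms
  by (intro continuous_intros) (auto simp: max_def)

lemma clamp_norm_measurable [measurable]:
  assumes "k > 0"
  shows "clamp_norm k \<in> borel_measurable borel"
  using continuous_on_clamp_norm[OF assms continuous_on_id] by (intro borel_measurable_continuous_onI) simp

lemma L2_dense_bounded:
  assumes f: "f \<in> L2_functions S" and e: "e > 0"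
  obtains k where "k > 0" "L2_sq S (\<lambda>x. f x - clamp_norm k (f x)) < e"
proof -
  have [measurable]: "f \<in> borel_measurable (lebesgue_on S)" using f by measurable
  \<comment> \<open>The level \<open>Suc k\<close> keeps the radius positive; the truncation error
    is dominated by \<open>f\<close> itself.\<close>
  have "(\<lambda>k. LINT x|lebesgue_on S. (cmod (f x - clamp_norm (Suc k) (f x)))\<^sup>2) \<longlonglongrightarrow> (LINT x|lebesgue_on S. 0)"
  proof (rule integral_dominated_convergence[where w = "\<lambda>x. (cmod (f x))\<^sup>2"])
    show "integrable (lebesgue_on S) (\<lambda>x. (cmod (f x))\<^sup>2)" using f by (simp add: L2_functions_def)
    show "AE x in lebesgue_on S. (\<lambda>k. (cmod (f x - clamp_norm (Suc k) (f x)))\<^sup>2) \<longlonglongrightarrow> 0"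
    proof (rule AE_I2, rule tendsto_eventually)
      fix x
      obtain n :: nat where n: "cmod (f x) \<le> n" using real_arch_simple by blast
      show "\<forall>\<^sub>F k in sequentially. (cmod (f x - clamp_norm (Suc k) (f x)))\<^sup>2 = 0"
        using eventually_ge_at_top[of n] by eventually_elim (use n in \<open>simp add: clamp_norm_eq\<close>)
    qed
    show "AE x in lebesgue_on S. norm ((cmod (f x - clamp_norm (Suc k) (f x)))\<^sup>2) \<le> (cmod (f x))\<^sup>2" for k
      using clamp_norm_diff_le by (intro always_eventually allI) (simp add: power_mono)
  qed measurable
  then have "(\<lambda>k. L2_sq S (\<lambda>x. f x - clamp_norm (Suc k) (f x))) \<longlonglongrightarrow> 0" by (simp add: L2_sq_def)
  then obtain k where "L2_sq S (\<lambda>x. f x - clamp_norm (Suc k) (f x)) < e"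
    using order_tendstoD(2)[OF _ e] eventually_happens' sequentially_bot by blast
  then show ?thesis using that[of "Suc k"] by blast
qed

lemma continuous_imp_measurable_lebesgue_on:
  fixes g :: "'a::euclidean_space \<Rightarrow> complex"
  assumes "continuous_on UNIV g"
  shows "g \<in> borel_measurable (lebesgue_on S)"
  using borel_measurable_continuous_onI[OF assms]
  by (intro measurable_restrict_space1 measurable_completion) simp

text \<open>Lebesgue measurability gives continuous functions converging to \<open>f\<close> off a
  null set, with no common bound. After clamping, the differences are at most \<open>2 * k\<close>,
  which is square-integrable on a set of finite measure, so dominated convergence applies.\<close>

lemma L2_dense_continuous_bounded:
  assumes f: "f \<in> borel_measurable (lebesgue_on S)" and S: "S \<in> lmeasurable"
    and k: "k > 0" and e: "e > 0"
  obtains g where "continuous_on UNIV g" "L2_sq S (\<lambda>x. clamp_norm k (f x) - clamp_norm k (g x)) < e"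
proof -
  note [measurable] = f
  have S': "S \<in> sets lebesgue" using S by (rule fmeasurableD)
  have "f measurable_on S"
    using S' by (simp add: measurable_on_iff_borel_measurable f)
  then obtain N g where N: "negligible N" and g: "\<And>n. continuous_on UNIV (g n)"
    and lim: "\<And>x. x \<notin> N \<Longrightarrow> (\<lambda>n. g n x) \<longlonglongrightarrow> (if x \<in> S then f x else 0)"
    unfolding measurable_on_def by blast
  have gm [measurable]: "g n \<in> borel_measurable (lebesgue_on S)" for n
    by (rule continuous_imp_measurable_lebesgue_on[OF g])
  have "(\<lambda>n. LINT x|lebesgue_on S. (cmod (clamp_norm k (f x) - clamp_norm k (g n x)))\<^sup>2) \<longlonglongrightarrow> (LINT x|lebesgue_on S. 0)"
  proof (rule integral_dominated_convergence[where w = "\<lambda>x. (2 * real k)\<^sup>2"])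
    show "integrable (lebesgue_on S) (\<lambda>x. (2 * real k)\<^sup>2)"
      by (rule finite_measure.integrable_const[OF finite_measure_lebesgue_on[OF S]])
    have "AE x in lebesgue. x \<notin> N" using N by (intro AE_not_in) (simp add: negligible_iff_null_sets)
    then have "AE x in lebesgue_on S. x \<notin> N"
      using S' by (subst AE_restrict_space_iff) auto
    moreover have "AE x in lebesgue_on S. x \<in> S" by (intro AE_I2) simp
    ultimately show "AE x in lebesgue_on S. (\<lambda>n. (cmod (clamp_norm k (f x) - clamp_norm k (g n x)))\<^sup>2) \<longlonglongrightarrow> 0"
    proof eventually_elim
      case (elim x)
      have "isCont (clamp_norm k) (f x)"
        using continuous_on_clamp_norm[OF k continuous_on_id, of UNIV] by (simp add: continuous_on_eq_continuous_at)
      moreover have "(\<lambda>n. g n x) \<longlonglongrightarrow> f x" using lim elim by force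
      ultimately have "(\<lambda>n. clamp_norm k (g n x)) \<longlonglongrightarrow> clamp_norm k (f x)" by (rule isCont_tendsto_compose)
      then have "(\<lambda>n. (cmod (clamp_norm k (f x) - clamp_norm k (g n x)))\<^sup>2)
          \<longlonglongrightarrow> (cmod (clamp_norm k (f x) - clamp_norm k (f x)))\<^sup>2"
        by (intro tendsto_intros)
      then show ?case by simp
    qed
    show "AE x in lebesgue_on S. norm ((cmod (clamp_norm k (f x) - clamp_norm k (g n x)))\<^sup>2) \<le> (2 * real k)\<^sup>2" for n
    proof (intro always_eventually allI)
      fix x
      have "cmod (clamp_norm k (f x) - clamp_norm k (g n x)) \<le> 2 * real k"
        using norm_triangle_ineq4[of "clamp_norm k (f x)" "clamp_norm k (g n x)"]
          clamp_norm_le[of k "f x"] clamp_norm_le[of k "g n x"] by linarith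
      then show "norm ((cmod (clamp_norm k (f x) - clamp_norm k (g n x)))\<^sup>2) \<le> (2 * real k)\<^sup>2"
        unfolding real_norm_def abs_power2 by (rule power_mono) simp
    qed
  qed (use k in measurable)
  then have "(\<lambda>n. L2_sq S (\<lambda>x. clamp_norm k (f x) - clamp_norm k (g n x))) \<longlonglongrightarrow> 0"
    by (simp add: L2_sq_def)
  then obtain n where "L2_sq S (\<lambda>x. clamp_norm k (f x) - clamp_norm k (g n x)) < e"
    using order_tendstoD(2)[OF _ e] eventually_happens' sequentially_bot by blast
  then show ?thesis using that g by blast
qed

theorem L2_dense_continuous:
  assumes f: "f \<in> L2_functions S" and S: "S \<in> lmeasurable" and e: "e > 0"
  obtains g where "continuous_on UNIV g" "g \<in> L2_functions S" "L2_sq S (\<lambda>x. f x - g x) < e"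
proof -
  \<comment> \<open>Quarters are used because \<open>L2_add\<close> loses a factor 2.\<close>
  obtain k where k: "k > 0" "L2_sq S (\<lambda>x. f x - clamp_norm k (f x)) < e / 4"
    using L2_dense_bounded[OF f, of "e / 4"] e by auto
  have fm [measurable]: "f \<in> borel_measurable (lebesgue_on S)" using f by measurable
  obtain g where g: "continuous_on UNIV g" "L2_sq S (\<lambda>x. clamp_norm k (f x) - clamp_norm k (g x)) < e / 4"
    using L2_dense_continuous_bounded[OF fm S k(1), of "e / 4"] e by auto
  have cont: "continuous_on UNIV (\<lambda>x. clamp_norm k (g x))"
    using continuous_on_clamp_norm[OF k(1) g(1)] .
  have cf: "(\<lambda>x. clamp_norm k (f x)) \<in> L2_functions S"
    by (rule L2_bounded(1)[OF _ S, where B = k]) (use k clamp_norm_le in \<open>auto intro: measurable_compose[OF fm]\<close>)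
  have cg: "(\<lambda>x. clamp_norm k (g x)) \<in> L2_functions S"
    by (rule L2_bounded(1)[OF continuous_imp_measurable_lebesgue_on[OF cont] S, where B = k]) (rule clamp_norm_le)
  have "L2_sq S (\<lambda>x. (f x - clamp_norm k (f x)) + (clamp_norm k (f x) - clamp_norm k (g x)))
      \<le> 2 * L2_sq S (\<lambda>x. f x - clamp_norm k (f x)) + 2 * L2_sq S (\<lambda>x. clamp_norm k (f x) - clamp_norm k (g x))"
    by (intro L2_add(2) L2_diff f cf cg)
  then have "L2_sq S (\<lambda>x. f x - clamp_norm k (g x)) < e" using k g by simp
  then show ?thesis using that cont cg by blast
qed

section \<open>Density of the span of the orbit functions\<close>

text \<open>The scalar is built into the generators, so that closure under addition alone already
  yields the linear span.\<close>

inductive_set trig_poly :: "'a::euclidean_space set \<Rightarrow> ('a \<Rightarrow> complex) set" for A where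
  expo: "u \<in> A \<Longrightarrow> (\<lambda>x. c * expo u x) \<in> trig_poly A"
| add: "f \<in> trig_poly A \<Longrightarrow> g \<in> trig_poly A \<Longrightarrow> (\<lambda>x. f x + g x) \<in> trig_poly A"

lemma trig_poly_continuous: "f \<in> trig_poly A \<Longrightarrow> continuous_on S f"
  by (induction rule: trig_poly.induct) (intro continuous_intros; assumption)+

context based_root_system
begin

section \<open>The algebra of trigonometric polynomials and averaging over \<open>W\<close>\<close>

abbreviation T :: "('a \<Rightarrow> complex) set" where "T \<equiv> trig_poly P"

lemma T_const: "(\<lambda>x. c) \<in> T"
  using trig_poly.expo[OF P_zero, of c] by simp

lemma T_sum:
  assumes "finite J" "\<And>j. j \<in> J \<Longrightarrow> f j \<in> T"
  shows "(\<lambda>x. \<Sum>j\<in>J. f j x) \<in> T"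
  using assms by (induction J) (auto intro: T_const trig_poly.add)

lemma T_mult:
  assumes "f \<in> T" "g \<in> T"
  shows "(\<lambda>x. f x * g x) \<in> T"
  using assms(1)
proof (induction rule: trig_poly.induct)
  case (expo u c)
  show ?case using assms(2)
  proof (induction rule: trig_poly.induct)
    case (expo v d)
    then have "(\<lambda>x. (c * d) * expo (u + v) x) \<in> T"
      using \<open>u \<in> P\<close> by (intro trig_poly.expo P_add)
    then show ?case by (simp add: expo_add_left mult_ac)
  next
    case (add f g)
    then show ?case using trig_poly.add[OF add.IH] by (simp add: distrib_left)
  qed
next
  case (add f1 f2)
  then show ?case using trig_poly.add[OF add.IH] by (simp add: distrib_right)
qed

lemma T_cnj:
  assumes "f \<in> T"
  shows "(\<lambda>x. cnj (f x)) \<in> T"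
  using assms
proof (induction rule: trig_poly.induct)
  case (expo u c)
  then show ?case using trig_poly.expo[OF P_uminus, of u "cnj c"] by (simp add: cnj_expo)
next
  case (add f g)
  then show ?case using trig_poly.add[OF add.IH] by simp
qed

lemma T_W:
  assumes "f \<in> T" "w \<in> W"
  shows "(\<lambda>x. f (w x)) \<in> T"
  using assms(1)
proof (induction rule: trig_poly.induct)
  case (expo u c)
  obtain v where v: "v \<in> W" "\<forall>x. w (v x) = x" using W_inverse[OF assms(2)] by blast
  have "expo u (w x) = expo (v u) x" for x using expo_W[OF assms(2), of "v u" x] v(2) by simp
  then show ?case using trig_poly.expo[OF W_weight[OF v(1) expo]] by simp
next
  case (add f g)
  then show ?case using trig_poly.add[OF add.IH] by simp
qed

definition orbit_span :: "('a \<Rightarrow> complex) set" where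
  "orbit_span = {h. \<exists>J c. finite J \<and> J \<subseteq> dominant_weights \<Delta> \<and>
     h = (\<lambda>x. \<Sum>j\<in>J. c j * orbit_function \<Delta> j x)}"

lemma orbit_spanI:
  assumes "finite J" "J \<subseteq> dominant_weights \<Delta>"
  shows "(\<lambda>x. \<Sum>j\<in>J. c j * orbit_function \<Delta> j x) \<in> orbit_span"
  unfolding orbit_span_def using assms by (intro CollectI exI[of _ J] exI[of _ c]) simp

lemma orbit_span_single: "v \<in> dominant_weights \<Delta> \<Longrightarrow> (\<lambda>x. c * orbit_function \<Delta> v x) \<in> orbit_span"
  using orbit_spanI[of "{v}" "\<lambda>_. c"] by simp

lemma orbit_span_add:
  assumes "f \<in> orbit_span" "g \<in> orbit_span"
  shows "(\<lambda>x. f x + g x) \<in> orbit_span"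
proof -
  obtain J c where J: "finite J" "J \<subseteq> dominant_weights \<Delta>" "f = (\<lambda>x. \<Sum>j\<in>J. c j * orbit_function \<Delta> j x)"
    using assms(1) unfolding orbit_span_def by blast
  obtain K d where K: "finite K" "K \<subseteq> dominant_weights \<Delta>" "g = (\<lambda>x. \<Sum>j\<in>K. d j * orbit_function \<Delta> j x)"
    using assms(2) unfolding orbit_span_def by blast
  \<comment> \<open>Both combinations are padded with zero coefficients to the common index set
    \<open>J \<union> K\<close>.\<close>
  have ext: "(\<Sum>j\<in>L. e j * orbit_function \<Delta> j x)
      = (\<Sum>j\<in>J \<union> K. (if j \<in> L then e j else 0) * orbit_function \<Delta> j x)"
    if "L \<subseteq> J \<union> K" for L e x
    using that J(1) K(1) by (intro sum.mono_neutral_cong_left) auto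
  have "(\<lambda>x. f x + g x)
      = (\<lambda>x. \<Sum>j\<in>J \<union> K. ((if j \<in> J then c j else 0) + (if j \<in> K then d j else 0)) * orbit_function \<Delta> j x)"
    unfolding J(3) K(3) by (simp only: ext[of J] ext[of K] Un_upper1 Un_upper2 distrib_right sum.distrib)
  moreover have "\<dots> \<in> orbit_span" by (rule orbit_spanI) (use J K in auto)
  ultimately show ?thesis by simp
qed

lemma orbit_span_cmult:
  assumes "f \<in> orbit_span"
  shows "(\<lambda>x. a * f x) \<in> orbit_span"
proof -
  obtain J c where J: "finite J" "J \<subseteq> dominant_weights \<Delta>" "f = (\<lambda>x. \<Sum>j\<in>J. c j * orbit_function \<Delta> j x)"
    using assms(1) unfolding orbit_span_def by blast
  have "(\<lambda>x. a * f x) = (\<lambda>x. \<Sum>j\<in>J. (a * c j) * orbit_function \<Delta> j x)"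
    by (simp add: J(3) sum_distrib_left mult.assoc)
  moreover have "\<dots> \<in> orbit_span" using J by (intro orbit_spanI)
  ultimately show ?thesis by simp
qed

lemma sum_W_right:
  assumes "v \<in> W"
  shows "(\<Sum>w\<in>W. f (v (w x))) = (\<Sum>w\<in>W. f (w x) :: complex)"
proof -
  obtain v' where v': "v' \<in> W" "\<forall>x. v (v' x) = x" "\<forall>x. v' (v x) = x" using W_inverse[OF assms] by blast
  show ?thesis
    by (rule sum.reindex_bij_witness[of _ "(\<circ>) v'" "(\<circ>) v"])
      (use assms v' W_comp in \<open>auto simp: fun_eq_iff\<close>)
qed

text \<open>Both sides of \<open>(\<Sum>v\<in>weyl_orbit \<Delta> u. \<Sum>w\<in>W. expo v (w x)) = card W * orbit_function \<Delta> u x\<close>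
  arise by summing over the orbit first or last, and the inner sum over \<open>W\<close> does not depend on \<open>v\<close>.\<close>

lemma sum_W_expo:
  "(\<Sum>w\<in>W. expo u (w x)) = of_nat (card W) / of_nat (card (weyl_orbit \<Delta> u)) * orbit_function \<Delta> u x"
proof -
  let ?O = "weyl_orbit \<Delta> u"
  have "(\<Sum>w\<in>W. expo v (w x)) = (\<Sum>w\<in>W. expo u (w x))" if v: "v \<in> ?O" for v
  proof -
    obtain g where g: "g \<in> W" "v = g u" using v by (auto simp: weyl_orbit_def)
    have "(\<Sum>w\<in>W. expo v (w x)) = (\<Sum>w\<in>W. expo (g u) (g (w x)))"
      unfolding g(2) by (rule sum_W_right[OF g(1), symmetric])
    then show ?thesis by (simp add: expo_W[OF g(1)])
  qed
  then have "of_nat (card ?O) * (\<Sum>w\<in>W. expo u (w x)) = (\<Sum>v\<in>?O. \<Sum>w\<in>W. expo v (w x))" by simp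
  also have "\<dots> = (\<Sum>w\<in>W. orbit_function \<Delta> u (w x))"
    unfolding orbit_function_eq by (rule sum.swap)
  also have "\<dots> = of_nat (card W) * orbit_function \<Delta> u x" by (simp add: orbit_function_invariant)
  finally show ?thesis using card_orbit_pos[of u] by (simp add: field_simps)
qed

text \<open>Averaging an exponential gives a multiple of the orbit function of its frequency, and
  the orbit of that frequency contains a dominant weight.\<close>

lemma average_in_orbit_span:
  assumes "f \<in> T"
  shows "(\<lambda>x. \<Sum>w\<in>W. f (w x)) \<in> orbit_span"
  using assms
proof (induction rule: trig_poly.induct)
  case (expo u c)
  obtain g where g: "g \<in> W" "g u \<in> dominant_chamber \<Delta>" by (rule orbit_meets_dominant)
  have "g u \<in> weyl_orbit \<Delta> u" using g(1) by (auto simp: weyl_orbit_def)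
  then have eq: "orbit_function \<Delta> u = orbit_function \<Delta> (g u)"
    using orbit_eq by (simp add: orbit_function_eq[abs_def])
  have "g u \<in> dominant_weights \<Delta>" using g W_weight expo by (simp add: dominant_weights_def)
  then have "(\<lambda>x. c * (of_nat (card W) / of_nat (card (weyl_orbit \<Delta> u))) * orbit_function \<Delta> (g u) x) \<in> orbit_span"
    by (rule orbit_span_single)
  then show ?case by (simp add: sum_W_expo eq mult.assoc flip: sum_distrib_left)
next
  case (add f g)
  then show ?case using orbit_span_add[OF add.IH] by (simp add: sum.distrib)
qed

lemma invariant_in_orbit_span:
  assumes "f \<in> T" "\<And>w x. w \<in> W \<Longrightarrow> f (w x) = f x"
  shows "f \<in> orbit_span"
proof -
  have "(\<lambda>x. (1 / of_nat (card W)) * (\<Sum>w\<in>W. f (w x))) \<in> orbit_span"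
    by (intro orbit_span_cmult average_in_orbit_span assms)
  moreover have "(1 / of_nat (card W)) * (\<Sum>w\<in>W. f (w x)) = f x" for x
    using card_W_pos assms(2) by simp
  ultimately show ?thesis by simp
qed

text \<open>Real values suit the form of the Stone-Weierstrass theorem applied below; invariance
  places the functions in the span of the orbit functions.\<close>

definition real_invariant :: "('a \<Rightarrow> real) \<Rightarrow> bool" where
  "real_invariant f \<longleftrightarrow> (\<lambda>x. complex_of_real (f x)) \<in> T \<and> (\<forall>w\<in>W. \<forall>x. f (w x) = f x)"

text \<open>A product of functions \<open>expo u - expo u b\<close> vanishes on the orbit of \<open>y\<close> but not at \<open>x\<close>;
  averaging its squared modulus over \<open>W\<close> preserves this.\<close>

lemma real_invariant_separates:
  assumes x: "x \<in> closure F" and y: "y \<in> closure F" and "x \<noteq> y"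
  shows "\<exists>f. real_invariant f \<and> f x \<noteq> f y"
proof -
  \<comment> \<open>If no weight distinguishes \<open>x\<close> from \<open>b\<close>, every weight
    is integral on \<open>x - b\<close>, which is membership in \<open>Q\<close>. Then
    \<open>x\<close> and \<open>y\<close> are points of the closed simplex in one affine orbit, so
    they coincide.\<close>
  have "\<exists>u\<in>P. expo u x \<noteq> expo u b" if b: "b \<in> weyl_orbit \<Delta> y" for b
  proof (rule ccontr)
    assume eq: "\<not> ?thesis"
    have "u \<bullet> (x - b) \<in> \<int>" if "u \<in> P" for u
    proof -
      have "expo u (x - b) * expo u b = expo u x" by (simp flip: expo_add_right)
      then have "expo u (x - b) * expo u b = 1 * expo u b" using eq that by auto
      moreover have "expo u b \<noteq> 0" using norm_expo[of u b] by force
      ultimately show ?thesis using expo_eq_1_iff by (metis mult_right_cancel)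
    qed
    then have "x - b \<in> Q" by (simp add: Q_def)
    moreover obtain w where "w \<in> W" "b = w y" using b by (auto simp: weyl_orbit_def)
    ultimately have "w y + (x - b) = y" using closure_F_unique[of w "x - b" y] x y by simp
    then show False using \<open>b = w y\<close> \<open>x \<noteq> y\<close> by simp
  qed
  then obtain u where u: "\<And>b. b \<in> weyl_orbit \<Delta> y \<Longrightarrow> u b \<in> P \<and> expo (u b) x \<noteq> expo (u b) b" by metis
  define p where "p z = (\<Prod>b\<in>weyl_orbit \<Delta> y. expo (u b) z - expo (u b) b)" for z
  have "(\<lambda>z. \<Prod>b\<in>B. expo (u b) z - expo (u b) b) \<in> T" if "finite B" "B \<subseteq> weyl_orbit \<Delta> y" for B
    using that
  proof (induction B)
    case empty
    then show ?case using T_const by simp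
  next
    case (insert b B)
    then have "u b \<in> P" using u by blast
    then have "(\<lambda>z. 1 * expo (u b) z + - expo (u b) b) \<in> T"
      by (intro trig_poly.add trig_poly.expo T_const)
    then show ?case using insert T_mult by auto
  qed
  then have pT: "p \<in> T" using finite_orbit by (simp add: p_def[abs_def])
  define f where "f z = (\<Sum>w\<in>W. (cmod (p (w z)))\<^sup>2)" for z
  have "complex_of_real (f z) = (\<Sum>w\<in>W. p (w z) * cnj (p (w z)))" for z
    unfolding f_def of_real_sum by (simp only: complex_norm_square)
  moreover have "(\<lambda>z. \<Sum>w\<in>W. p (w z) * cnj (p (w z))) \<in> T"
  proof (rule T_sum[OF finite_W])
    fix w assume "w \<in> W"
    then have pw: "(\<lambda>z. p (w z)) \<in> T" by (rule T_W[OF pT])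
    show "(\<lambda>z. p (w z) * cnj (p (w z))) \<in> T" by (rule T_mult[OF pw T_cnj[OF pw]])
  qed
  moreover have "f (v z) = f z" if v: "v \<in> W" for v z
  proof -
    obtain v' where v': "v' \<in> W" "\<forall>x. v (v' x) = x" "\<forall>x. v' (v x) = x" using W_inverse[OF v] by blast
    show ?thesis
      unfolding f_def
      by (rule sum.reindex_bij_witness[of _ "\<lambda>w. w \<circ> v'" "\<lambda>w. w \<circ> v"])
        (use v v' W_comp in \<open>auto simp: fun_eq_iff\<close>)
  qed
  ultimately have "real_invariant f" by (simp add: real_invariant_def)
  moreover have "f y = 0"
  proof -
    have "p (w y) = 0" if "w \<in> W" for w
    proof -
      have "w y \<in> weyl_orbit \<Delta> y" using that by (simp add: weyl_orbit_def)
      then show ?thesis using finite_orbit unfolding p_def by (intro prod_zero) auto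
    qed
    then show ?thesis by (simp add: f_def)
  qed
  moreover have "f x > 0"
  proof -
    have "p x \<noteq> 0" using u finite_orbit by (simp add: p_def)
    then show ?thesis unfolding f_def by (intro sum_pos2[OF finite_W W_id]) auto
  qed
  ultimately show ?thesis by (intro exI[of _ f]) simp
qed

lemma real_invariant_dense:
  assumes "continuous_on (closure F) g" "e > 0"
  obtains h where "real_invariant h" "\<And>x. x \<in> closure F \<Longrightarrow> \<bar>g x - h x\<bar> < e"
proof -
  have "\<exists>h. real_invariant h \<and> (\<forall>x\<in>closure F. \<bar>g x - h x\<bar> < e)"
  proof (rule Stone_Weierstrass_HOL[where P = real_invariant])
    show "compact (closure F)" using bounded_F by (simp add: compact_closure)
    show "real_invariant (\<lambda>x. c)" for c using T_const by (simp add: real_invariant_def)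
    show "continuous_on (closure F) f" if "real_invariant f" for f
    proof -
      have "continuous_on (closure F) (\<lambda>x. complex_of_real (f x))"
        using that by (intro trig_poly_continuous[where A = P]) (simp add: real_invariant_def)
      then have "continuous_on (closure F) (\<lambda>x. Re (complex_of_real (f x)))" by (rule continuous_on_Re)
      then show ?thesis by simp
    qed
    show "real_invariant (\<lambda>x. f x + g x)" if "real_invariant f \<and> real_invariant g" for f g
      using that trig_poly.add by (auto simp: real_invariant_def)
    show "real_invariant (\<lambda>x. f x * g x)" if "real_invariant f \<and> real_invariant g" for f g
      using that T_mult by (auto simp: real_invariant_def)
    show "\<exists>f. real_invariant f \<and> f x \<noteq> f y" if "x \<in> closure F \<and> y \<in> closure F \<and> x \<noteq> y" for x y
      using real_invariant_separates that by blast
  qed (use assms in auto)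
  then show ?thesis using that by blast
qed

lemma real_invariant_in_orbit_span: "real_invariant f \<Longrightarrow> (\<lambda>x. complex_of_real (f x)) \<in> orbit_span"
  by (rule invariant_in_orbit_span) (auto simp: real_invariant_def)

text \<open>Real and imaginary parts are approximated separately within \<open>e / 2\<close>, and
  the modulus is at most the sum of the two errors.\<close>

lemma orbit_span_uniformly_dense:
  assumes g: "continuous_on (closure F) g" and e: "e > 0"
  obtains h where "h \<in> orbit_span" "\<And>x. x \<in> closure F \<Longrightarrow> cmod (g x - h x) \<le> e"
proof -
  have e2: "e / 2 > 0" using e by simp
  obtain h1 where h1: "real_invariant h1" "\<And>x. x \<in> closure F \<Longrightarrow> \<bar>Re (g x) - h1 x\<bar> < e / 2"
    using real_invariant_dense[OF continuous_on_Re[OF g] e2] by metis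
  obtain h2 where h2: "real_invariant h2" "\<And>x. x \<in> closure F \<Longrightarrow> \<bar>Im (g x) - h2 x\<bar> < e / 2"
    using real_invariant_dense[OF continuous_on_Im[OF g] e2] by metis
  let ?h = "\<lambda>x. complex_of_real (h1 x) + \<i> * complex_of_real (h2 x)"
  have "?h \<in> orbit_span"
    by (intro orbit_span_add orbit_span_cmult real_invariant_in_orbit_span h1 h2)
  moreover have "cmod (g x - ?h x) \<le> e" if x: "x \<in> closure F" for x
    using cmod_le[of "g x - ?h x"] h1(2)[OF x] h2(2)[OF x] by simp
  ultimately show ?thesis using that by blast
qed

lemma orbit_function_L2: "orbit_function \<Delta> v \<in> L2_functions (closure F)"
  by (rule L2_bounded(1)[OF continuous_imp_measurable_lebesgue_on closure_F_lmeasurable norm_orbit_function])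
    (rule continuous_on_orbit_function)

theorem orbit_span_L2_dense:
  assumes f: "f \<in> L2_functions (closure F)" and e: "e > 0"
  obtains J c where "finite J" "J \<subseteq> dominant_weights \<Delta>"
    "L2_norm (closure F) (\<lambda>x. f x - (\<Sum>j\<in>J. c j * orbit_function \<Delta> j x)) < e"
proof -
  let ?S = "closure F"
  let ?m = "measure lebesgue ?S"
  have m: "?m > 0" by (rule measure_closure_F)
  \<comment> \<open>With this \<open>d\<close> and the uniform error \<open>e / 4\<close>, twice the
    sum of the two squared errors is at most \<open>e\<^sup>2 * ?m * (1/4 + 1/8)\<close>, which
    leaves room for the strict bound.\<close>
  define d where "d = e\<^sup>2 * ?m / 8"
  have d: "d > 0" using e m by (simp add: d_def)
  obtain g where g: "continuous_on UNIV g" "g \<in> L2_functions ?S" "L2_sq ?S (\<lambda>x. f x - g x) < d"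
    using L2_dense_continuous[OF f closure_F_lmeasurable d] by blast
  obtain h where h: "h \<in> orbit_span" "\<And>x. x \<in> ?S \<Longrightarrow> cmod (g x - h x) \<le> e / 4"
    using orbit_span_uniformly_dense[OF continuous_on_subset[OF g(1)], of "e / 4"] e by auto
  obtain J c where J: "finite J" "J \<subseteq> dominant_weights \<Delta>" "h = (\<lambda>x. \<Sum>j\<in>J. c j * orbit_function \<Delta> j x)"
    using h(1) unfolding orbit_span_def by blast
  have hL2: "h \<in> L2_functions ?S"
    unfolding J(3) by (intro L2_sum J(1) L2_cmult orbit_function_L2)
  have "(\<lambda>x. g x - h x) \<in> borel_measurable (lebesgue_on ?S)"
    using L2_diff[OF g(2) hL2] by (rule L2_functionsD)
  then have gh: "L2_sq ?S (\<lambda>x. g x - h x) \<le> (e / 4)\<^sup>2 * ?m"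
    by (rule L2_bounded(2)[OF _ closure_F_lmeasurable]) (rule h(2))
  have "L2_sq ?S (\<lambda>x. (f x - g x) + (g x - h x)) \<le> 2 * L2_sq ?S (\<lambda>x. f x - g x) + 2 * L2_sq ?S (\<lambda>x. g x - h x)"
    by (intro L2_add(2) L2_diff f g hL2)
  also have "\<dots> < 2 * d + 2 * ((e / 4)\<^sup>2 * ?m)" using g(3) gh by simp
  also have "\<dots> \<le> e\<^sup>2 * ?m" using m e by (simp add: d_def power2_eq_square field_simps)
  finally have "L2_sq ?S (\<lambda>x. f x - h x) < e\<^sup>2 * ?m" by simp
  then have "inverse ?m * L2_sq ?S (\<lambda>x. f x - h x) < e\<^sup>2" using m by (simp add: field_simps)
  then have "L2_norm ?S (\<lambda>x. f x - h x) < e"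
    unfolding L2_norm_eq using e by (intro real_less_lsqrt) auto
  then show ?thesis using that J by blast
qed

end

section \<open>Expansions in an orthogonal basis\<close>

lemma L2_norm_power2_inner: "complex_of_real ((L2_norm S f)\<^sup>2) = L2_inner S f f"
  by (simp only: L2_norm_power2 L2_inner_self)

text \<open>Here \<open>n i\<close> is the squared norm of \<open>\<phi> i\<close>; for orbit
  functions it is the size of the orbit.\<close>

locale L2_orthogonal_family =
  fixes S :: "'a::euclidean_space set" and I :: "'i set" and \<phi> :: "'i \<Rightarrow> 'a \<Rightarrow> complex" and n :: "'i \<Rightarrow> real"
  assumes L2: "i \<in> I \<Longrightarrow> \<phi> i \<in> L2_functions S"
    and orthogonal: "i \<in> I \<Longrightarrow> j \<in> I \<Longrightarrow> L2_inner S (\<phi> i) (\<phi> j) = (if i = j then of_real (n i) else 0)"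
    and norm_pos: "i \<in> I \<Longrightarrow> n i > 0"
begin

lemma inner_sum_sum:
  assumes "finite J" "J \<subseteq> I"
  shows "L2_inner S (\<lambda>x. \<Sum>j\<in>J. d j * \<phi> j x) (\<lambda>x. \<Sum>j\<in>J. d j * \<phi> j x)
    = of_real (\<Sum>j\<in>J. n j * (cmod (d j))\<^sup>2)"
proof -
  let ?p = "\<lambda>x. \<Sum>j\<in>J. d j * \<phi> j x"
  have pL2: "?p \<in> L2_functions S" using assms L2 by (intro L2_sum L2_cmult) auto
  have left: "L2_inner S ?p h = (\<Sum>j\<in>J. d j * L2_inner S (\<phi> j) h)" if "h \<in> L2_functions S" for h
    using assms L2 that by (subst L2_inner_sum) (auto simp: L2_inner_cmult intro!: L2_cmult)
  have "L2_inner S (\<phi> j) ?p = cnj (d j) * of_real (n j)" if j: "j \<in> J" for j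
  proof -
    have "L2_inner S (\<phi> j) ?p = cnj (L2_inner S ?p (\<phi> j))" by (simp add: L2_inner_cnj)
    also have "L2_inner S ?p (\<phi> j) = (\<Sum>i\<in>J. d i * L2_inner S (\<phi> i) (\<phi> j))"
      using j assms L2 by (intro left) auto
    also have "\<dots> = (\<Sum>i\<in>J. if i = j then d j * of_real (n j) else 0)"
      by (intro sum.cong refl) (use j assms in \<open>auto simp: orthogonal subset_iff\<close>)
    finally show ?thesis using j assms by simp
  qed
  then have "L2_inner S ?p ?p = (\<Sum>j\<in>J. d j * (cnj (d j) * of_real (n j)))"
    by (simp add: left[OF pL2])
  also have "\<dots> = of_real (\<Sum>j\<in>J. n j * (cmod (d j))\<^sup>2)"
    unfolding of_real_sum of_real_mult complex_norm_square by (simp add: mult_ac)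
  finally show ?thesis .
qed

definition coefficient :: "('a \<Rightarrow> complex) \<Rightarrow> 'i \<Rightarrow> complex" where
  "coefficient f i = L2_inner S f (\<phi> i) / of_real (n i)"

text \<open>Completing the square. With \<open>d\<close> arbitrary, the last sum measures the
  distance from the Fourier coefficients, so one identity yields both the residual of the Fourier
  sum and its best approximation property.\<close>

lemma norm_diff_sum:
  assumes f: "f \<in> L2_functions S" and J: "finite J" "J \<subseteq> I"
  shows "(L2_norm S (\<lambda>x. f x - (\<Sum>j\<in>J. d j * \<phi> j x)))\<^sup>2
    = (L2_norm S f)\<^sup>2 - (\<Sum>j\<in>J. n j * (cmod (coefficient f j))\<^sup>2)
      + (\<Sum>j\<in>J. n j * (cmod (coefficient f j - d j))\<^sup>2)"
proof -
  let ?c = "coefficient f"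
  let ?p = "\<lambda>x. \<Sum>j\<in>J. d j * \<phi> j x"
  \<comment> \<open>Subtraction is written as adding a multiple by -1, so that additivity and
    homogeneity in the first slot suffice, together with conjugate symmetry.\<close>
  let ?q = "\<lambda>x. -1 * ?p x"
  have pL2: "?p \<in> L2_functions S" using J L2 by (intro L2_sum L2_cmult) auto
  have qL2: "?q \<in> L2_functions S" by (rule L2_cmult[OF pL2])
  have pf: "L2_inner S ?p f = (\<Sum>j\<in>J. of_real (n j) * (d j * cnj (?c j)))"
  proof -
    have "L2_inner S ?p f = (\<Sum>j\<in>J. d j * L2_inner S (\<phi> j) f)"
      using J L2 f by (subst L2_inner_sum) (auto simp: L2_inner_cmult intro!: L2_cmult)
    also have "\<dots> = (\<Sum>j\<in>J. of_real (n j) * (d j * cnj (?c j)))"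
    proof (rule sum.cong[OF refl])
      fix j assume "j \<in> J"
      then have "n j \<noteq> 0" using norm_pos J by force
      then have "of_real (n j) * cnj (?c j) = L2_inner S (\<phi> j) f"
        by (simp add: coefficient_def L2_inner_cnj)
      then show "d j * L2_inner S (\<phi> j) f = of_real (n j) * (d j * cnj (?c j))" by (simp add: mult_ac)
    qed
    finally show ?thesis .
  qed
  have right: "L2_inner S g (\<lambda>x. f x + ?q x) = L2_inner S g f - L2_inner S g ?p" if g: "g \<in> L2_functions S" for g
  proof -
    have "L2_inner S g (\<lambda>x. f x + ?q x) = cnj (L2_inner S (\<lambda>x. f x + ?q x) g)" by (simp only: L2_inner_cnj)
    also have "L2_inner S (\<lambda>x. f x + ?q x) g = L2_inner S f g - L2_inner S ?p g"
      unfolding L2_inner_add[OF f qL2 g] L2_inner_cmult by simp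
    finally show ?thesis by (simp only: complex_cnj_diff L2_inner_cnj)
  qed
  have "complex_of_real ((L2_norm S (\<lambda>x. f x - ?p x))\<^sup>2) = L2_inner S (\<lambda>x. f x + ?q x) (\<lambda>x. f x + ?q x)"
    unfolding L2_norm_power2_inner by simp
  also have "\<dots> = L2_inner S f (\<lambda>x. f x + ?q x) - L2_inner S ?p (\<lambda>x. f x + ?q x)"
    unfolding L2_inner_add[OF f qL2 L2_add(1)[OF f qL2]] L2_inner_cmult by simp
  also have "\<dots> = L2_inner S f f - (L2_inner S ?p f + cnj (L2_inner S ?p f)) + L2_inner S ?p ?p"
    unfolding right[OF f] right[OF pL2] L2_inner_cnj by simp
  finally have "(L2_norm S (\<lambda>x. f x - ?p x))\<^sup>2
      = Re (L2_inner S f f - (L2_inner S ?p f + cnj (L2_inner S ?p f)) + L2_inner S ?p ?p)"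
    by (metis Re_complex_of_real)
  also have "\<dots> = (L2_norm S f)\<^sup>2 - 2 * Re (L2_inner S ?p f) + (\<Sum>j\<in>J. n j * (cmod (d j))\<^sup>2)"
    unfolding inner_sum_sum[OF J] L2_norm_power2_inner[of S f, symmetric] by simp
  also have "Re (L2_inner S ?p f) = (\<Sum>j\<in>J. n j * Re (d j * cnj (?c j)))"
    unfolding pf Re_sum by simp
  also have "(L2_norm S f)\<^sup>2 - 2 * (\<Sum>j\<in>J. n j * Re (d j * cnj (?c j))) + (\<Sum>j\<in>J. n j * (cmod (d j))\<^sup>2)
      = (L2_norm S f)\<^sup>2 + (\<Sum>j\<in>J. n j * ((cmod (d j))\<^sup>2 - 2 * Re (d j * cnj (?c j))))"
    by (simp add: sum_distrib_left sum_subtractf algebra_simps)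
  also have "(\<Sum>j\<in>J. n j * ((cmod (d j))\<^sup>2 - 2 * Re (d j * cnj (?c j))))
      = (\<Sum>j\<in>J. n j * (cmod (?c j - d j))\<^sup>2 - n j * (cmod (?c j))\<^sup>2)"
  proof (rule sum.cong[OF refl])
    fix j
    have "(cmod (?c j - d j))\<^sup>2 = (cmod (?c j))\<^sup>2 + ((cmod (d j))\<^sup>2 - 2 * Re (d j * cnj (?c j)))"
      unfolding cmod_power2 by (simp add: power2_eq_square algebra_simps)
    then show "n j * ((cmod (d j))\<^sup>2 - 2 * Re (d j * cnj (?c j)))
        = n j * (cmod (?c j - d j))\<^sup>2 - n j * (cmod (?c j))\<^sup>2"
      by (simp only: right_diff_distrib[symmetric]) simp
  qed
  finally show ?thesis by (simp add: sum_subtractf)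
qed

text \<open>Over a fixed \<open>J\<close> the Fourier sum is the closest combination, so an
  approximation over \<open>K\<close>, padded with zeros, bounds the residual for every
  \<open>J\<close> containing \<open>K\<close>. Density thus becomes convergence along finite
  subsets, and the residual identity turns this into the Plancherel sum.\<close>

theorem expansion:
  assumes f: "f \<in> L2_functions S"
    and dense: "\<And>e. e > 0 \<Longrightarrow> \<exists>J c. finite J \<and> J \<subseteq> I \<and> L2_norm S (\<lambda>x. f x - (\<Sum>j\<in>J. c j * \<phi> j x)) < e"
  shows "L2_has_sum S (\<lambda>i x. coefficient f i * \<phi> i x) f I"
    and "((\<lambda>i. n i * (cmod (coefficient f i))\<^sup>2) has_sum (L2_norm S f)\<^sup>2) I"
proof -
  let ?c = "coefficient f"
  let ?r = "\<lambda>J. L2_norm S (\<lambda>x. f x - (\<Sum>i\<in>J. ?c i * \<phi> i x))"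
  have sq: "(?r J)\<^sup>2 = (L2_norm S f)\<^sup>2 - (\<Sum>j\<in>J. n j * (cmod (?c j))\<^sup>2)" if "finite J" "J \<subseteq> I" for J
    using norm_diff_sum[OF f that, of ?c] by simp
  have lim: "(?r \<longlongrightarrow> 0) (finite_subsets_at_top I)"
  proof (rule order_tendstoI)
    fix a :: real assume "a < 0"
    then show "\<forall>\<^sub>F J in finite_subsets_at_top I. a < ?r J"
      by (intro always_eventually allI) (rule less_le_trans[OF _ L2_norm_nonneg])
  next
    fix e :: real assume e: "0 < e"
    obtain K d where K: "finite K" "K \<subseteq> I" "L2_norm S (\<lambda>x. f x - (\<Sum>j\<in>K. d j * \<phi> j x)) < e"
      using dense[OF e] by blast
    have "?r J < e" if J: "finite J" "K \<subseteq> J" "J \<subseteq> I" for J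
    proof -
      let ?d = "\<lambda>j. if j \<in> K then d j else 0"
      have eq: "(\<Sum>j\<in>J. ?d j * \<phi> j x) = (\<Sum>j\<in>K. d j * \<phi> j x)" for x
        using J by (intro sum.mono_neutral_cong_right) auto
      have "0 \<le> (\<Sum>j\<in>J. n j * (cmod (?c j - ?d j))\<^sup>2)"
        using norm_pos J by (intro sum_nonneg mult_nonneg_nonneg) (auto simp: less_imp_le)
      then have "(?r J)\<^sup>2 \<le> (L2_norm S (\<lambda>x. f x - (\<Sum>j\<in>J. ?d j * \<phi> j x)))\<^sup>2"
        unfolding sq[OF J(1,3)] norm_diff_sum[OF f J(1,3)] by simp
      then have "?r J \<le> L2_norm S (\<lambda>x. f x - (\<Sum>j\<in>J. ?d j * \<phi> j x))"
        using L2_norm_nonneg by (rule power2_le_imp_le)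
      then show ?thesis using K(3) unfolding eq by simp
    qed
    then show "\<forall>\<^sub>F J in finite_subsets_at_top I. ?r J < e"
      unfolding eventually_finite_subsets_at_top using K by blast
  qed
  then show "L2_has_sum S (\<lambda>i x. ?c i * \<phi> i x) f I" by (simp add: L2_has_sum_def)
  have "((\<lambda>J. (L2_norm S f)\<^sup>2 - (?r J)\<^sup>2) \<longlongrightarrow> (L2_norm S f)\<^sup>2 - 0\<^sup>2) (finite_subsets_at_top I)"
    by (intro tendsto_intros lim)
  then have "((\<lambda>J. (L2_norm S f)\<^sup>2 - (?r J)\<^sup>2) \<longlongrightarrow> (L2_norm S f)\<^sup>2) (finite_subsets_at_top I)" by simp
  moreover have "\<forall>\<^sub>F J in finite_subsets_at_top I.
      (L2_norm S f)\<^sup>2 - (?r J)\<^sup>2 = (\<Sum>j\<in>J. n j * (cmod (?c j))\<^sup>2)"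
    using eventually_finite_subsets_at_top_weakI[of I] sq by (simp add: eventually_finite_subsets_at_top_weakI)
  ultimately show "((\<lambda>i. n i * (cmod (?c i))\<^sup>2) has_sum (L2_norm S f)\<^sup>2) I"
    unfolding has_sum_def by (rule Lim_transform_eventually)
qed

end

theorem mainTheorem4:
  fixes R \<Delta> :: "'a::euclidean_space set" and \<xi> :: 'a
  assumes "irreducible_root_system R"
    and "long_roots_normalized R"
    and "simple_roots R \<Delta>"
    and "highest_root R \<Delta> \<xi>"
  shows "let Fbar = closure (fundamental_simplex \<Delta> \<xi>) in
    L2_orthogonal_basis Fbar (dominant_weights \<Delta>) (orbit_function \<Delta>) \<and>
    (\<forall>f\<in>L2_functions Fbar.
       let c = orbit_coefficient \<Delta> Fbar f in
       L2_has_sum Fbar (\<lambda>v x. c v * orbit_function \<Delta> v x) f (dominant_weights \<Delta>) \<and>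
       ((\<lambda>v. real (card (weyl_orbit \<Delta> v)) * (cmod (c v))\<^sup>2) has_sum
          inverse (measure lebesgue Fbar) * (LINT x|lebesgue_on Fbar. (cmod (f x))\<^sup>2))
         (dominant_weights \<Delta>))"
proof -
  interpret based_root_system R \<Delta> \<xi>
    using assms by unfold_locales (auto simp: irreducible_root_system_def)
  let ?n = "\<lambda>v. real (card (weyl_orbit \<Delta> v))"
  \<comment> \<open>The squared norms are the orbit sizes, so the abstract Fourier coefficient is
    exactly \<open>orbit_coefficient\<close>.\<close>
  interpret L2_orthogonal_family "closure F" "dominant_weights \<Delta>" "orbit_function \<Delta>" ?n
    by unfold_locales (use orbit_function_L2 orbit_function_orthogonality card_orbit_pos in auto)
  have coef: "orbit_coefficient \<Delta> (closure F) f = coefficient f" for f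
    by (rule ext) (simp add: orbit_coefficient_def coefficient_def L2_inner_def field_simps)
  have dense: "\<exists>J c. finite J \<and> J \<subseteq> dominant_weights \<Delta> \<and>
      L2_norm (closure F) (\<lambda>x. f x - (\<Sum>j\<in>J. c j * orbit_function \<Delta> j x)) < e"
    if "f \<in> L2_functions (closure F)" "e > 0" for f e
    using orbit_span_L2_dense[OF that] by metis
  have "L2_norm (closure F) (orbit_function \<Delta> v) \<noteq> 0" if "v \<in> dominant_weights \<Delta>" for v
    unfolding L2_norm_def using orthogonal[OF that that] norm_pos[OF that] by simp
  then have "L2_orthogonal_basis (closure F) (dominant_weights \<Delta>) (orbit_function \<Delta>)"
    unfolding L2_orthogonal_basis_def using L2 orthogonal dense by auto
  moreover have "L2_has_sum (closure F) (\<lambda>v x. orbit_coefficient \<Delta> (closure F) f v * orbit_function \<Delta> v x) f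
        (dominant_weights \<Delta>)"
    and "((\<lambda>v. ?n v * (cmod (orbit_coefficient \<Delta> (closure F) f v))\<^sup>2) has_sum
        inverse (measure lebesgue (closure F)) * (LINT x|lebesgue_on (closure F). (cmod (f x))\<^sup>2))
        (dominant_weights \<Delta>)"
    if f: "f \<in> L2_functions (closure F)" for f
    using expansion[OF f dense[OF f]] by (simp_all add: coef L2_norm_power2 L2_sq_def)
  ultimately show ?thesis unfolding Let_def by blast
qed

end
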